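(* Let $x,y,z$ be non-negative integers with $x\equiv y\pmod 2$, and let $\mathbf a=(a_1,\dots,a_m)$, $\mathbf b=(b_1,\dots,b_n)$ be two sequences of non-negative integers. Put $a=\sum_i a_i$ and $b=\sum_j b_j$. (a) If $a_1$ is even, then $$M(S^{(2)}_{x,y,z}(\mathbf a;\mathbf b))=2^{y+z+a+b-a_1}\,M\Big(R^{(2)}_{\lfloor x/2\rfloor,\lceil y/2\rceil,z}\big(\tfrac{a_1}{2},a_2,\dots,a_m;\mathbf b\big)\Big)\,M\Big(RW^{(1)}_{\lceil x/2\rceil,\lfloor y/2\rfloor,z}\big(\tfrac{a_1}{2},a_2,\dots,a_m;\mathbf b\big)\Big).$$ (b) If $a_1$ is odd, then $$M(S^{(2)}_{x,y,z}(\mathbf a;\mathbf b))=2^{y+z+a+b-a_1}\,M\Big(NR^{(1)}_{\lceil x/2\rceil,\lfloor y/2\rfloor,z}\big(\tfrac{a_1-1}{2},a_2,\dots,a_m;\mathbf b\big)\Big)\,M\Big(NR^{(4)}_{\lfloor x/2\rfloor,\lceil y/2\rceil,z}\big(\tfrac{a_1+1}{2},a_2,\dots,a_m;\mathbf b\big)\Big).$$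
   Context: Lattice and tilings. For real $u,k$ let $[u;k]$ be the point of the plane with Cartesian coordinates $(u,\frac{\sqrt3}{2}k)$. The triangular lattice has as vertices all $[u;k]$ with $k\in\mathbb Z$, $u-k/2\in\mathbb Z$ (or a horizontal translate of this set by $\frac12$, where needed); its faces are unit equilateral triangles, up-pointing or down-pointing. A region is a finite union of unit triangles. A lozenge is the union of two unit triangles sharing an edge; it is vertical if that edge is horizontal. A tiling of a region is a covering of it by lozenges contained in it, without gaps or overlaps. $M(R)$ is the sum of the weights of all tilings of $R$, the weight of a tiling being the product of the weights of its lozenges; lozenges have weight $1$ unless stated otherwise (so $M(R)$ is the number of tilings of an unweighted $R$); $M(\emptyset)=1$. Sequences. For a sequence $\mathbf a=(a_1,\dots,a_m)$: $a=\sum a_i$, and $o_a,e_a$ are the sums of the $a_i$ with $i$ odd, resp. even; similarly $b,o_b,e_b$ for $\mathbf b=(b_1,\dots,b_n)$. An empty sequence is treated as the one-term sequence $(0)$. The symmetric hexagon with three ferns removed, $S^{(2)}_{x,y,z}(\mathbf a;\mathbf b)$ ($x\equiv y$ mod 2). Let $W=x+y+2a-a_1+2b$ and take the lattice containing $[W/2;0]$. Consider the hexagon, symmetric about the vertical axis $u=0$, with side lengths, clockwise from the north side, $x+2o_a-a_1+2e_b$, $y+z+2e_a+2o_b$, $y+z+2o_a-a_1+2e_b$, $x+2e_a+2o_b$, $y+z+2o_a-a_1+2e_b$, $y+z+2e_a+2o_b$, placed so that its east and west vertices are $[\pm\frac{W+z}{2};-z]$; thus the line $\ell:k=0$, at level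 $z$ above these vertices, meets the hexagon in the segment from $[-\frac W2;0]$ to $[\frac W2;0]$. Remove: the down-pointing triangle of side $a_1$ (below $\ell$) with a side on $\ell$ from $[-\frac{a_1}2;0]$ to $[\frac{a_1}2;0]$; for $2\le i\le m$, the triangle of side $a_i$ with a side on $\ell$ from $[\frac{a_1}2+a_2+\dots+a_{i-1};0]$ to $[\frac{a_1}2+a_2+\dots+a_i;0]$ and its mirror image in $u=0$, up-pointing (above $\ell$) if $i$ is even, down-pointing (below $\ell$) if $i$ is odd; for $1\le j\le n$, the triangle of side $b_j$ with a side on $\ell$ from $[\frac W2-b_1-\dots-b_j;0]$ to $[\frac W2-b_1-\dots-b_{j-1};0]$ and its mirror image in $u=0$, up-pointing (above $\ell$) if $j$ is odd, down-pointing (below $\ell$) if $j$ is even. All lozenges have weight $1$. The halved-hexagon regions $X_{x,y,z}(\mathbf a;\mathbf b)$, $X\in\{R^{(2)},RW^{(1)},NR^{(1)},NR^{(4)}\}$ (here $x,y,z,\mathbf a,\mathbf b$ are generic arguments: non-negative integers and sequences of non-negative integers, with $a_1\ge1$ for $NR^{(4)}$). Let $L=x+y+a+b$, $h=y+e_a+o_b$, $g=y+z+o_a+e_b$, and $\ell$ the line $k=0$. Each region is determined by integers $A,B\ge-1$ and functions $\alpha,\beta$ as follows. Upper part (empty if $A=-1$): bounded by $\ell$ between $[\alpha(0);0]$ and $[L;0]$, the segment from $[L;0]$ to $[L-\frac A2;A]$, the horizontal north side at height $k=A$, and the west zigzag through $[\alpha(k);k]$, $0\le k\le A$. Lower part (empty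 if $B=-1$): bounded by $\ell$ between $[\beta(0);0]$ and $[L;0]$, the segments from $[L;0]$ to $[L+\frac z2;-z]$ and from there to $[L+z-\frac B2;-B]$, the horizontal south side at $k=-B$, and the west zigzag through $[\beta(k);-k]$, $0\le k\le B$. The region is the union of the two parts (lozenges may cross $\ell$) after removing: (i) from the lower part, everything at points $[u;-k]$ with $u<a_1-k/2$; (ii) for $2\le i\le m$, the triangle of side $a_i$ with a side on $\ell$ from $[a_1+\dots+a_{i-1};0]$ to $[a_1+\dots+a_i;0]$, up-pointing (above $\ell$) if $i$ is even, down-pointing (below $\ell$) if $i$ is odd; (iii) for $1\le j\le n$, the triangle of side $b_j$ with a side on $\ell$ from $[L-b_1-\dots-b_j;0]$ to $[L-b_1-\dots-b_{j-1};0]$, up-pointing if $j$ is odd, down-pointing if $j$ is even. Data: - $R^{(2)}$: $A=2h-1$, $B=2g-1$; $\alpha=\beta=0$ at even $k$, $\frac12$ at odd $k$; unweighted. - $RW^{(1)}$: $A=2h$, $B=2g$; $\alpha=\beta=0$ at even $k$, $-\frac12$ at odd $k$; every vertical lozenge whose two western (left) sides both lie on the west zigzags (upper or lower) has weight $\frac12$. - $NR^{(1)}$: $A=2h$, $\alpha=0$ at even $k$, $-\frac12$ at odd $k$; $B=2g+1$, $\beta=-1$ at even $k$, $-\frac12$ at odd $k$; every vertical lozenge whose two western sides both lie on the lower west zigzag has weight $\frac12$. - $NR^{(4)}$ ($a_1\ge1$): $A=2h-1$, $\alpha=0$ at even $k$, $\frac12$ at odd $k$; $B=2g-2$, $\beta=1$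 at even $k$, $\frac12$ at odd $k$; every vertical lozenge whose two western sides both lie on the upper west zigzag has weight $\frac12$. *)

theory Defs
  imports Complex_Main
begin

(* The pair (p, k) of integers stands for the point [p/2; k], i.e. first coordinates are doubled.
   lattice c consists of the [u; k] with u - k/2 - c/2 an integer: even c gives the standard
   triangular lattice, odd c its horizontal translate by 1/2. *)
type_synonym point = "int \<times> int"
type_synonym edge = "point set"
type_synonym triangle = "point set"
type_synonym lozenge = "triangle set"

definition lattice :: "int \<Rightarrow> point set" where
  "lattice c = {(p, k). even (p - k - c)}"

(* A unit triangle is identified with its set of vertices. *)
definition up_tri :: "int \<Rightarrow> int \<Rightarrow> triangle" where
  "up_tri p k = {(p, k), (p + 2, k), (p + 1, k + 1)}"

definition down_tri :: "int \<Rightarrow> int \<Rightarrow> triangle" where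
  "down_tri p k = {(p, k), (p + 2, k), (p + 1, k - 1)}"

definition unit_triangle :: "triangle \<Rightarrow> bool" where
  "unit_triangle t \<longleftrightarrow> (\<exists>p k. t = up_tri p k \<or> t = down_tri p k)"

(* The unit triangles of the lattice contained in a polygon, which is given by the set P of its
   points with integral coordinates (p, k). Testing vertices is enough for the polygons used below,
   since each of them meets every strip between consecutive horizontal lattice lines in a convex
   set. *)
definition triangles_in :: "int \<Rightarrow> point set \<Rightarrow> triangle set" where
  "triangles_in c P = {t. unit_triangle t \<and> t \<subseteq> lattice c \<and> t \<subseteq> P}"

definition is_lozenge :: "lozenge \<Rightarrow> bool" where
  "is_lozenge l \<longleftrightarrow>
     (\<exists>t t'. unit_triangle t \<and> unit_triangle t' \<and> card (t \<inter> t') = 2 \<and> l = {t, t'})"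

definition tiling :: "triangle set \<Rightarrow> lozenge set \<Rightarrow> bool" where
  "tiling R T \<longleftrightarrow> (\<forall>l\<in>T. is_lozenge l \<and> l \<subseteq> R) \<and> \<Union>T = R \<and>
     (\<forall>l\<in>T. \<forall>l'\<in>T. l \<noteq> l' \<longrightarrow> l \<inter> l' = {})"

(* A weighted region is a region R with a set E of lattice edges: a vertical lozenge whose two
   western sides both belong to E has weight 1/2, every other lozenge has weight 1. *)
type_synonym wregion = "triangle set \<times> edge set"

definition lozenge_weight :: "edge set \<Rightarrow> lozenge \<Rightarrow> real" where
  "lozenge_weight E l =
     (if \<exists>p k. l = {up_tri p k, down_tri p k} \<and>
               {(p, k), (p + 1, k + 1)} \<in> E \<and> {(p, k), (p + 1, k - 1)} \<in> E
      then 1 / 2 else 1)"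

definition M :: "wregion \<Rightarrow> real" where
  "M = (\<lambda>(R, E). \<Sum>T | tiling R T. \<Prod>l\<in>T. lozenge_weight E l)"

(* Sequences are lists, indexed from 1. Since entries beyond the end are 0, the empty list behaves
   like the one-term sequence (0). *)
definition entry :: "nat list \<Rightarrow> nat \<Rightarrow> nat" where
  "entry s i = (if 1 \<le> i \<and> i \<le> length s then s ! (i - 1) else 0)"

definition odd_sum :: "nat list \<Rightarrow> nat" where
  "odd_sum s = (\<Sum>i | i \<in> {1..length s} \<and> odd i. entry s i)"

definition even_sum :: "nat list \<Rightarrow> nat" where
  "even_sum s = (\<Sum>i | i \<in> {1..length s} \<and> even i. entry s i)"

(* The triangle of side s with a side on the line k = 0 from [p/2; 0] to [p/2 + s; 0], pointing up
   (above the line) or down (below it). *)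
definition side_tri :: "bool \<Rightarrow> int \<Rightarrow> nat \<Rightarrow> point set" where
  "side_tri up p s =
     (if up then {(q, k). 0 \<le> k \<and> p + k \<le> q \<and> q \<le> p + 2 * int s - k}
      else {(q, k). k \<le> 0 \<and> p - k \<le> q \<and> q \<le> p + 2 * int s + k})"

definition mirror :: "point set \<Rightarrow> point set" where
  "mirror P = (\<lambda>(p, k). (- p, k)) ` P"

definition S_width :: "nat \<Rightarrow> nat \<Rightarrow> nat list \<Rightarrow> nat list \<Rightarrow> int" where
  "S_width x y a b =
     int x + int y + 2 * int (sum_list a) - int (entry a 1) + 2 * int (sum_list b)"

definition S_north_east :: "nat \<Rightarrow> nat \<Rightarrow> nat list \<Rightarrow> nat list \<Rightarrow> int" where
  "S_north_east y z a b = int y + int z + 2 * int (even_sum a) + 2 * int (odd_sum b)"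

definition S_south_east :: "nat \<Rightarrow> nat \<Rightarrow> nat list \<Rightarrow> nat list \<Rightarrow> int" where
  "S_south_east y z a b =
     int y + int z + 2 * int (odd_sum a) - int (entry a 1) + 2 * int (even_sum b)"

(* The north (south) side is reached from the vertices [(W + z)/2; -z] and [-(W + z)/2; -z] by
   going up the NE and NW (down the SE and SW) sides; its length is then forced, see the lemmas
   S_north_length and S_south_length. *)
definition S_hexagon :: "nat \<Rightarrow> nat \<Rightarrow> nat \<Rightarrow> nat list \<Rightarrow> nat list \<Rightarrow> point set" where
  "S_hexagon x y z a b =
     {(p, k). - int z - S_south_east y z a b \<le> k \<and> k \<le> - int z + S_north_east y z a b \<and>
              \<bar>p\<bar> \<le> S_width x y a b + int z - \<bar>k + int z\<bar>}"

definition S_holes :: "nat \<Rightarrow> nat \<Rightarrow> nat list \<Rightarrow> nat list \<Rightarrow> point set set" where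
  "S_holes x y a b =
     (\<lambda>i. side_tri (even i) (int (entry a 1) + 2 * int (\<Sum>t\<in>{2..<i}. entry a t)) (entry a i))
        ` {2..length a} \<union>
     (\<lambda>j. side_tri (odd j) (S_width x y a b - 2 * int (\<Sum>t\<in>{1..j}. entry b t)) (entry b j))
        ` {1..length b}"

definition S2 :: "nat \<Rightarrow> nat \<Rightarrow> nat \<Rightarrow> nat list \<Rightarrow> nat list \<Rightarrow> wregion" where
  "S2 x y z a b =
     (let T = triangles_in (S_width x y a b) in
       (T (S_hexagon x y z a b)
          - T (side_tri False (- int (entry a 1)) (entry a 1))
          - (\<Union>H\<in>S_holes x y a b. T H \<union> T (mirror H)),
        {}))"

(* al and be are the functions alpha and beta with doubled values. The lower part is described in
   terms of -k, its east boundary being the minimum of the two boundary lines through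
   [L + z/2; -z]. The last three terms are the removals (i), (ii), (iii); the boundary of each
   removed set runs along lattice lines, so that every unit triangle is removed or kept whole. *)
definition halved_region ::
    "int \<Rightarrow> int \<Rightarrow> (int \<Rightarrow> int) \<Rightarrow> (int \<Rightarrow> int) \<Rightarrow>
     nat \<Rightarrow> nat \<Rightarrow> nat \<Rightarrow> nat list \<Rightarrow> nat list \<Rightarrow> triangle set" where
  "halved_region A B al be x y z a b =
     (let L = int (x + y + sum_list a + sum_list b); T = triangles_in 0 in
       (T {(p, k). 0 \<le> k \<and> k \<le> A \<and> al k \<le> p \<and> p \<le> 2 * L - k} \<union>
        T {(p, k). 0 \<le> - k \<and> - k \<le> B \<and> be (- k) \<le> p \<and>
                   p \<le> min (2 * L + (- k)) (2 * L + 2 * int z - (- k))})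
       - T {(p, k). k \<le> 0 \<and> p \<le> 2 * int (entry a 1) - (- k)}
       - (\<Union>i\<in>{2..length a}.
            T (side_tri (even i) (2 * int (\<Sum>t\<in>{1..<i}. entry a t)) (entry a i)))
       - (\<Union>j\<in>{1..length b}.
            T (side_tri (odd j) (2 * (L - int (\<Sum>t\<in>{1..j}. entry b t))) (entry b j))))"

definition zigzag :: "int \<Rightarrow> int \<Rightarrow> int \<Rightarrow> int" where
  "zigzag e d k = (if even k then e else d)"

definition upper_zigzag :: "int \<Rightarrow> (int \<Rightarrow> int) \<Rightarrow> edge set" where
  "upper_zigzag A al = (\<lambda>k. {(al k, k), (al (k + 1), k + 1)}) ` {0..<A}"

definition lower_zigzag :: "int \<Rightarrow> (int \<Rightarrow> int) \<Rightarrow> edge set" where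
  "lower_zigzag B be = (\<lambda>k. {(be k, - k), (be (k + 1), - (k + 1))}) ` {0..<B}"

definition h_par :: "nat \<Rightarrow> nat list \<Rightarrow> nat list \<Rightarrow> int" where
  "h_par y a b = int (y + even_sum a + odd_sum b)"

definition g_par :: "nat \<Rightarrow> nat \<Rightarrow> nat list \<Rightarrow> nat list \<Rightarrow> int" where
  "g_par y z a b = int (y + z + odd_sum a + even_sum b)"

definition R2 :: "nat \<Rightarrow> nat \<Rightarrow> nat \<Rightarrow> nat list \<Rightarrow> nat list \<Rightarrow> wregion" where
  "R2 x y z a b =
     (halved_region (2 * h_par y a b - 1) (2 * g_par y z a b - 1) (zigzag 0 1) (zigzag 0 1)
        x y z a b,
      {})"

definition RW1 :: "nat \<Rightarrow> nat \<Rightarrow> nat \<Rightarrow> nat list \<Rightarrow> nat list \<Rightarrow> wregion" where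
  "RW1 x y z a b =
     (halved_region (2 * h_par y a b) (2 * g_par y z a b) (zigzag 0 (- 1)) (zigzag 0 (- 1))
        x y z a b,
      upper_zigzag (2 * h_par y a b) (zigzag 0 (- 1)) \<union>
      lower_zigzag (2 * g_par y z a b) (zigzag 0 (- 1)))"

definition NR1 :: "nat \<Rightarrow> nat \<Rightarrow> nat \<Rightarrow> nat list \<Rightarrow> nat list \<Rightarrow> wregion" where
  "NR1 x y z a b =
     (halved_region (2 * h_par y a b) (2 * g_par y z a b + 1) (zigzag 0 (- 1)) (zigzag (- 2) (- 1))
        x y z a b,
      lower_zigzag (2 * g_par y z a b + 1) (zigzag (- 2) (- 1)))"

(* Used only for sequences a whose first entry is at least 1. *)
definition NR4 :: "nat \<Rightarrow> nat \<Rightarrow> nat \<Rightarrow> nat list \<Rightarrow> nat list \<Rightarrow> wregion" where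
  "NR4 x y z a b =
     (halved_region (2 * h_par y a b - 1) (2 * g_par y z a b - 2) (zigzag 0 1) (zigzag 2 1)
        x y z a b,
      upper_zigzag (2 * h_par y a b - 1) (zigzag 0 1))"

lemma sum_list_entry: "sum_list s = (\<Sum>i\<in>{1..length s}. entry s i)"
proof -
  have "(\<Sum>i\<in>{1..length s}. entry s i) = (\<Sum>i\<in>{0..<length s}. entry s (Suc i))"
    by (rule sum.reindex_bij_witness[of _ Suc "\<lambda>i. i - 1"]) auto
  also have "\<dots> = (\<Sum>i\<in>{0..<length s}. s ! i)"
    by (rule sum.cong) (auto simp: entry_def)
  finally show ?thesis by (simp add: sum_list_sum_nth)
qed

lemma odd_sum_plus_even_sum: "odd_sum s + even_sum s = sum_list s"
  unfolding odd_sum_def even_sum_def sum_list_entry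
  by (subst sum.union_disjoint[symmetric]) (auto intro!: sum.cong)

lemma S_north_length:
  "S_width x y a b + int z - S_north_east y z a b =
     int x + 2 * int (odd_sum a) - int (entry a 1) + 2 * int (even_sum b)"
  unfolding S_width_def S_north_east_def
  using odd_sum_plus_even_sum[of a] odd_sum_plus_even_sum[of b] by linarith

lemma S_south_length:
  "S_width x y a b + int z - S_south_east y z a b =
     int x + 2 * int (even_sum a) + 2 * int (odd_sum b)"
  unfolding S_width_def S_south_east_def
  using odd_sum_plus_even_sum[of a] odd_sum_plus_even_sum[of b] by linarith

end

(* Tilings of a region are the perfect matchings of its up- with its down-pointing triangles. Order the
   triangles by horizontal strips, and from left to right within each strip. The lozenges that lie in
   a strip then never cross each other, so that the sign of a matching, viewed as a permutation, is a
   product of signs attached to its vertical lozenges, the sign of a lozenge depending only on its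
   place in the region. Putting these signs into the bipartite adjacency matrix gives a matrix whose
   determinant is, up to sign, the weighted number of tilings, for any region whatsoever.

   For a symmetric region this matrix is invariant under the reflection, up to the sign
   (-1)^(number of axis triangles adjacent to level k) at the vertical lozenges of level k. This sign
   is a coboundary s(k) s(k-1) of a sign s on the strips. In a basis of vectors v +- s reflection(v) the
   matrix becomes block diagonal, the blocks being the matrices of the two halves: an axis triangle
   goes to the first half if s = 1 on its strip and to the second if s = -1, and the scaling of the basis
   produces the power of 2 and the weights 1/2. In S2 the sign s is constant if the first entry of a
   is even; otherwise it changes at the line k = 0, where the axis leaves the upper part of the
   region through a triangle that has no partner below. The halves are the regions of the
   theorem, except that a top or bottom strip with only one tiling may have been removed. *)

theory Submission
  imports "Jordan_Normal_Form.Determinant" "HOL-Library.Product_Lexorder" Defs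
begin

section \<open>The sign of a permutation by inversions\<close>

text \<open>The plain adjacency matrix does not suffice: around a triangular hole of odd side the
  terms of its determinant can differ in sign. Counting the triangles beside a vertical lozenge, as
  \<open>kappa\<close> does, takes every hole into account. Determinants are known up to sign only,
  so the factorization is proved for squares; the root can be taken because \<open>per\<close> is
  nonnegative.

  The power of 2 comes from norms. A vector of the folded basis has squared norm 2 off the axis and
  1 on it, whereas every entry of the folded matrix is twice an entry of a half, provided that a
  vertical lozenge on the axis, which has no second copy, counts 1/2. Comparing
  \<open>2 ^ (card U + card D)\<close> with the norms leaves one factor 2 for each axis triangle in
  the identity for the squares. In the hexagon each strip outside the central hole has exactly one
  axis triangle; their number \<open>height + depth - entry a 1\<close> is twice y + z + a + b -
  a_1.\<close>

definition inversions :: "nat \<Rightarrow> (nat \<Rightarrow> nat) \<Rightarrow> (nat \<times> nat) set" where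
  "inversions n p = {(i, j). i < j \<and> j < n \<and> p j < p i}"

definition pairs_below :: "nat \<Rightarrow> (nat \<times> nat) set" where
  "pairs_below n = {(i, j). i < j \<and> j < n}"

definition inv_sign :: "nat \<Rightarrow> (nat \<Rightarrow> nat) \<Rightarrow> int" where
  "inv_sign n p = (\<Prod>(i, j)\<in>pairs_below n. if p i < p j then 1 else - 1)"

lemma finite_pairs_below [simp]: "finite (pairs_below n)"
  by (rule finite_subset[of _ "{..<n} \<times> {..<n}"]) (auto simp: pairs_below_def)

text \<open>Sorting the image of a pair under \<open>q\<close> permutes the pairs, so the factors of
  \<open>p\<close> may be read off at the sorted images. The factor of \<open>p \<circ> q\<close> at
  a pair is then a factor of \<open>p\<close> times a factor of \<open>q\<close>.\<close>

lemma inv_sign_comp: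
  assumes p: "p permutes {0..<n}" and q: "q permutes {0..<n}"
  shows "inv_sign n (p \<circ> q) = inv_sign n p * inv_sign n q"
proof -
  define srt where "srt = (\<lambda>(i, j). (min (q i) (q j), max (q i) (q j)))"
  have qi: "q i = q j \<longleftrightarrow> i = j" for i j
    using permutes_inj[OF q] by (auto simp: inj_def)
  have pi: "p i = p j \<longleftrightarrow> i = j" for i j
    using permutes_inj[OF p] by (auto simp: inj_def)
  have qn: "q i < n \<longleftrightarrow> i < n" for i
    using permutes_in_image[OF q, of i] by simp
  have inj: "inj_on srt (pairs_below n)"
    by (rule inj_onI) (auto simp: srt_def pairs_below_def min_def max_def qi split: if_splits)
  have "srt ` pairs_below n \<subseteq> pairs_below n"
  proof (rule image_subsetI)
    fix x assume "x \<in> pairs_below n"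
    then obtain i j where x: "x = (i, j)" "i < j" "j < n" by (auto simp: pairs_below_def)
    then have "q i \<noteq> q j" "q i < n" "q j < n" using qi[of i j] qn by auto
    then show "srt x \<in> pairs_below n"
      unfolding x(1) by (cases "q i < q j") (auto simp: srt_def pairs_below_def min_def max_def)
  qed
  then have bij: "bij_betw srt (pairs_below n) (pairs_below n)"
    using inj by (simp add: bij_betw_def endo_inj_surj)
  have "inv_sign n p = (\<Prod>x\<in>pairs_below n. case srt x of (i, j) \<Rightarrow> if p i < p j then 1 else - 1)"
    unfolding inv_sign_def by (rule prod.reindex_bij_betw[OF bij, symmetric])
  then have "inv_sign n p * inv_sign n q =
      (\<Prod>x\<in>pairs_below n. (case srt x of (i, j) \<Rightarrow> if p i < p j then 1 else - 1) *
         (case x of (i, j) \<Rightarrow> if q i < q j then 1 else - 1))"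
    by (simp add: inv_sign_def prod.distrib)
  also have "\<dots> = inv_sign n (p \<circ> q)"
    unfolding inv_sign_def
  proof (rule prod.cong[OF refl], clarify)
    fix i j assume "(i, j) \<in> pairs_below n"
    then have "i \<noteq> j" by (auto simp: pairs_below_def)
    then have "q i \<noteq> q j" "p (q i) \<noteq> p (q j)" by (auto simp: qi pi)
    then show "(case srt (i, j) of (i, j) \<Rightarrow> if p i < p j then 1 else - 1) *
        (if q i < q j then 1 else - 1) = (if (p \<circ> q) i < (p \<circ> q) j then 1 else (- 1 :: int))"
      by (auto simp: srt_def min_def max_def)
  qed
  finally show ?thesis ..
qed

lemma inv_sign_transpose:
  assumes "a < b" "b < n"
  shows "inv_sign n (transpose a b) = - 1"
proof -
  have "inv_sign n (transpose a b) =
      (\<Prod>x\<in>pairs_below n. if x \<in> inversions n (transpose a b) then - 1 else 1)"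
    unfolding inv_sign_def
  proof (rule prod.cong[OF refl], clarify)
    fix i j assume ij: "(i, j) \<in> pairs_below n"
    then have "transpose a b i \<noteq> transpose a b j"
      by (auto simp: pairs_below_def transpose_eq_iff)
    then show "(if transpose a b i < transpose a b j then 1 else - 1) =
        (if (i, j) \<in> inversions n (transpose a b) then - 1 else (1::int))"
      using ij by (auto simp: inversions_def pairs_below_def)
  qed
  also have "\<dots> = (- 1) ^ card (inversions n (transpose a b))"
  proof -
    have "inversions n (transpose a b) \<subseteq> pairs_below n"
      by (auto simp: inversions_def pairs_below_def)
    then show ?thesis
      by (subst prod.If_cases) (auto simp: Int_absorb1)
  qed
  \<comment> \<open>Every index strictly between \<open>a\<close> and \<open>b\<close> is inverted
    with both of them, and \<open>a\<close> with \<open>b\<close>: an odd number in total.\<close>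
  also have "inversions n (transpose a b) = Pair a ` {a<..b} \<union> (\<lambda>i. (i, b)) ` {a<..<b}"
    using assms by (auto simp: inversions_def transpose_def split: if_splits)
  also have "card \<dots> = (b - a) + (b - a - 1)"
    by (subst card_Un_disjoint) (auto simp: card_image inj_on_def)
  also have "(- 1 :: int) ^ \<dots> = - 1"
    using assms by (simp add: minus_one_power_iff)
  finally show ?thesis .
qed

text \<open>Both sides are multiplicative and equal -1 on transpositions, which generate all
  permutations.\<close>

lemma sign_eq_inversions:
  assumes "p permutes {0..<n}"
  shows "sign p = (- 1) ^ card (inversions n p)"
proof -
  have "sign p = inv_sign n p"
    using finite_atLeastLessThan assms
  proof (induction rule: permutes_rev_induct)
    case id
    have "inv_sign n id = 1"
      unfolding inv_sign_def by (rule prod.neutral) (auto simp: pairs_below_def)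
    then show ?case by (simp add: id_def)
  next
    case (swap a b p)
    have "inv_sign n (transpose a b) = sign (transpose a b)"
    proof (cases a b rule: linorder_cases)
      case less then show ?thesis using swap by (simp add: inv_sign_transpose sign_swap_id)
    next
      case greater then show ?thesis
        using swap inv_sign_transpose[of b a n] by (simp add: sign_swap_id transpose_commute)
    next
      case equal
      then show ?thesis
        by (auto simp: inv_sign_def pairs_below_def sign_swap_id intro!: prod.neutral)
    qed
    moreover have "permutation p" "permutation (transpose a b)"
      using swap permutation_permutes by (auto simp: permutation_swap_id)
    moreover have "transpose a b permutes {0..<n}"
      using swap by (simp add: permutes_swap_id)
    ultimately have "sign (p \<circ> transpose a b) = inv_sign n (p \<circ> transpose a b)"
      using swap sign_compose[of p "transpose a b"] inv_sign_comp[of p n "transpose a b"] by presburger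
    then show ?case .
  qed
  also have "inv_sign n p = (\<Prod>x\<in>pairs_below n. if x \<in> inversions n p then - 1 else 1)"
    unfolding inv_sign_def
  proof (rule prod.cong[OF refl], clarify)
    fix i j assume ij: "(i, j) \<in> pairs_below n"
    then have "p i \<noteq> p j"
      using permutes_inj[OF assms] by (auto simp: pairs_below_def inj_def)
    then show "(if p i < p j then 1 else - 1) = (if (i, j) \<in> inversions n p then - 1 else (1::int))"
      using ij by (auto simp: inversions_def pairs_below_def)
  qed
  also have "\<dots> = (- 1) ^ card (inversions n p)"
  proof -
    have "inversions n p \<subseteq> pairs_below n"
      by (auto simp: inversions_def pairs_below_def)
    then show ?thesis
      by (subst prod.If_cases) (auto simp: Int_absorb1)
  qed
  finally show ?thesis .
qed

section \<open>Tilings as matchings\<close>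

definition UP :: "point \<Rightarrow> triangle" where "UP u = up_tri (fst u) (snd u)"
definition DN :: "point \<Rightarrow> triangle" where "DN d = down_tri (fst d) (snd d)"

definition ups :: "triangle set \<Rightarrow> point set" where "ups R = {u. UP u \<in> R}"
definition downs :: "triangle set \<Rightarrow> point set" where "downs R = {d. DN d \<in> R}"

text \<open>The triangle \<^term>\<open>UP (p, k)\<close> lies in the strip between the levels k and k + 1, while
  \<^term>\<open>DN (p, k)\<close> lies in the strip between the levels k - 1 and k.\<close>

definition adj :: "point \<Rightarrow> point \<Rightarrow> bool" where
  "adj u d \<longleftrightarrow> d = u \<or> d = (fst u + 1, snd u + 1) \<or> d = (fst u - 1, snd u + 1)"

text \<open>Values outside \<open>U\<close> are fixed by \<open>extensional\<close>, so that sums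
  over matchings count every tiling once.\<close>

definition matchings :: "point set \<Rightarrow> point set \<Rightarrow> (point \<Rightarrow> point) set" where
  "matchings U D = {\<pi> \<in> extensional U. bij_betw \<pi> U D \<and> (\<forall>u\<in>U. adj u (\<pi> u))}"

text \<open>A permanent of the adjacency relation in which only the vertical lozenges, pairing
  \<open>UP u\<close> with \<open>DN u\<close>, can carry a weight other than 1.\<close>

definition per :: "point set \<Rightarrow> point set \<Rightarrow> (point \<Rightarrow> real) \<Rightarrow> real" where
  "per U D w = (\<Sum>\<pi>\<in>matchings U D. \<Prod>u\<in>U. if \<pi> u = u then w u else 1)"

lemma UP_inj: "UP u = UP v \<longleftrightarrow> u = v"
proof
  assume eq: "UP u = UP v"
  obtain p k q l where u: "u = (p, k)" and v: "v = (q, l)" by (cases u; cases v)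
  have "(p, k) \<in> UP v" "(p + 2, k) \<in> UP v" "(p + 1, k + 1) \<in> UP v"
    unfolding eq[symmetric] by (simp_all add: UP_def up_tri_def u)
  then show "u = v" by (auto simp: u v UP_def up_tri_def)
qed simp

lemma DN_inj: "DN u = DN v \<longleftrightarrow> u = v"
proof
  assume eq: "DN u = DN v"
  obtain p k q l where u: "u = (p, k)" and v: "v = (q, l)" by (cases u; cases v)
  have "(p, k) \<in> DN v" "(p + 2, k) \<in> DN v" "(p + 1, k - 1) \<in> DN v"
    unfolding eq[symmetric] by (simp_all add: DN_def down_tri_def u)
  then show "u = v" by (auto simp: u v DN_def down_tri_def)
qed simp

lemma UP_neq_DN: "UP u \<noteq> DN v"
proof
  assume eq: "UP u = DN v"
  obtain p k q l where u: "u = (p, k)" and v: "v = (q, l)" by (cases u; cases v)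
  have "(p, k) \<in> DN v" "(p + 2, k) \<in> DN v" "(p + 1, k + 1) \<in> DN v"
    unfolding eq[symmetric] by (simp_all add: UP_def up_tri_def u)
  then show False by (auto simp: v DN_def down_tri_def)
qed

lemma lozenge_pair_eq: "{UP u, DN d} = {UP v, DN e} \<longleftrightarrow> u = v \<and> d = e"
  using UP_inj[of u v] DN_inj[of d e] UP_neq_DN[of u e] UP_neq_DN[of v d]
  by (auto simp: doubleton_eq_iff)

lemma unit_triangle_cases:
  assumes "unit_triangle t"
  obtains u where "t = UP u" | d where "t = DN d"
  using assms unfolding unit_triangle_def UP_def DN_def by (metis fst_conv snd_conv)

lemma card_Int_three:
  assumes "x \<noteq> y" "y \<noteq> z" "x \<noteq> z"
  shows "card ({x, y, z} \<inter> t) = of_bool (x \<in> t) + of_bool (y \<in> t) + of_bool (z \<in> t)"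
  using assms by (simp add: Int_insert_left)

lemma card_UP_UP: "card (UP u \<inter> UP v) \<noteq> 2"
proof -
  obtain p k q l where [simp]: "u = (p, k)" "v = (q, l)" by (cases u; cases v)
  have "card (UP u \<inter> UP v) = of_bool ((p, k) \<in> UP v) + of_bool ((p + 2, k) \<in> UP v)
      + of_bool ((p + 1, k + 1) \<in> UP v)"
    by (simp add: UP_def up_tri_def[of p k] card_Int_three)
  then show ?thesis by (simp add: UP_def up_tri_def split: if_splits)
qed

lemma card_DN_DN: "card (DN u \<inter> DN v) \<noteq> 2"
proof -
  obtain p k q l where [simp]: "u = (p, k)" "v = (q, l)" by (cases u; cases v)
  have "card (DN u \<inter> DN v) = of_bool ((p, k) \<in> DN v) + of_bool ((p + 2, k) \<in> DN v)
      + of_bool ((p + 1, k - 1) \<in> DN v)"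
    by (simp add: DN_def down_tri_def[of p k] card_Int_three)
  then show ?thesis by (simp add: DN_def down_tri_def split: if_splits)
qed

lemma card_UP_DN: "card (UP u \<inter> DN d) = 2 \<longleftrightarrow> adj u d"
proof -
  obtain p k q l where u: "u = (p, k)" and d: "d = (q, l)" by (cases u; cases d)
  have "card (up_tri p k \<inter> t) = of_bool ((p, k) \<in> t) + of_bool ((p + 2, k) \<in> t)
      + of_bool ((p + 1, k + 1) \<in> t)" for t
    by (simp add: up_tri_def[of p k] card_Int_three)
  note card = this[of "down_tri q l"]
  consider "l = k" "q = p" | "l = k" "q \<noteq> p" | "l = k + 1" "q = p + 1" | "l = k + 1" "q = p - 1"
    | "l = k + 1" "q \<noteq> p + 1" "q \<noteq> p - 1" | "l \<noteq> k" "l \<noteq> k + 1"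
    by blast
  then show ?thesis
    unfolding u d UP_def DN_def fst_conv snd_conv card by cases (auto simp: down_tri_def adj_def of_bool_def)
qed

lemma is_lozenge_iff: "is_lozenge l \<longleftrightarrow> (\<exists>u d. adj u d \<and> l = {UP u, DN d})"
proof
  assume "is_lozenge l"
  then obtain t t' where t: "unit_triangle t" "unit_triangle t'" "card (t \<inter> t') = 2" "l = {t, t'}"
    by (auto simp: is_lozenge_def)
  from t(1) show "\<exists>u d. adj u d \<and> l = {UP u, DN d}"
  proof (cases rule: unit_triangle_cases)
    case (1 u)
    from t(2) show ?thesis
    proof (cases rule: unit_triangle_cases)
      case (2 d)
      then have "adj u d" using t(3) 1 card_UP_DN by simp
      then show ?thesis using t(4) 1 2 by blast
    qed (use t(3) 1 card_UP_UP in auto)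
  next
    case (2 d)
    from t(2) show ?thesis
    proof (cases rule: unit_triangle_cases)
      case (1 u)
      then have "adj u d" using t(3) 2 card_UP_DN[of u d] by (simp add: Int_commute)
      moreover have "l = {UP u, DN d}" using t(4) 1 2 by (simp add: insert_commute)
      ultimately show ?thesis by blast
    qed (use t(3) 2 card_DN_DN in auto)
  qed
next
  assume "\<exists>u d. adj u d \<and> l = {UP u, DN d}"
  then show "is_lozenge l"
    unfolding is_lozenge_def unit_triangle_def UP_def DN_def using card_UP_DN[unfolded UP_def DN_def] by blast
qed

lemma lozenge_weight_pair:
  "lozenge_weight E {UP u, DN d} = (if d = u then lozenge_weight E {UP u, DN u} else 1)"
proof (cases "d = u")
  case False
  have "{UP u, DN d} \<noteq> {up_tri p k, down_tri p k}" for p k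
    using lozenge_pair_eq[of u d "(p, k)" "(p, k)"] False by (auto simp: UP_def DN_def)
  then show ?thesis using False by (simp add: lozenge_weight_def)
qed simp

text \<open>A lozenge determines its two triangles, so a matching \<open>\<pi>\<close> and the
  tiling by the lozenges \<open>{UP u, DN (\<pi> u)}\<close> determine each other.\<close>

lemma M_eq_per:
  assumes unit: "\<And>t. t \<in> R \<Longrightarrow> unit_triangle t"
    and fin: "finite (ups R)"
  shows "M (R, E) = per (ups R) (downs R) (\<lambda>u. lozenge_weight E {UP u, DN u})"
proof -
  define \<Phi> where "\<Phi> = (\<lambda>\<pi>. (\<lambda>u. {UP u, DN (\<pi> u)}) ` ups R)"
  have inj: "inj_on (\<lambda>u. {UP u, DN (\<pi> u)}) (ups R)" for \<pi>
    by (rule inj_onI) (simp only: lozenge_pair_eq)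
  have "bij_betw \<Phi> (matchings (ups R) (downs R)) {T. tiling R T}"
    unfolding bij_betw_def
  proof (intro conjI inj_onI subset_antisym subsetI)
    fix \<pi> \<pi>' assume \<pi>: "\<pi> \<in> matchings (ups R) (downs R)" "\<pi>' \<in> matchings (ups R) (downs R)"
      and eq: "\<Phi> \<pi> = \<Phi> \<pi>'"
    show "\<pi> = \<pi>'"
    proof (rule extensionalityI)
      fix u assume "u \<in> ups R"
      then have "{UP u, DN (\<pi> u)} \<in> \<Phi> \<pi>'" unfolding eq[symmetric] by (auto simp: \<Phi>_def)
      then show "\<pi> u = \<pi>' u" unfolding \<Phi>_def by (auto simp only: lozenge_pair_eq image_iff)
    qed (use \<pi> in \<open>auto simp: matchings_def\<close>)
  next
    fix T assume "T \<in> \<Phi> ` matchings (ups R) (downs R)"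
    then obtain \<pi> where \<pi>: "\<pi> \<in> matchings (ups R) (downs R)" and T: "T = \<Phi> \<pi>" by blast
    then have bij: "bij_betw \<pi> (ups R) (downs R)" and adj: "\<And>u. u \<in> ups R \<Longrightarrow> adj u (\<pi> u)"
      by (auto simp: matchings_def)
    have dn: "\<pi> u \<in> downs R" if "u \<in> ups R" for u
      using bij that by (auto simp: bij_betw_def)
    have "is_lozenge {UP u, DN (\<pi> u)}" "{UP u, DN (\<pi> u)} \<subseteq> R" if "u \<in> ups R" for u
      using adj[OF that] dn[OF that] that unfolding is_lozenge_iff by (blast, simp add: ups_def downs_def)
    then have "\<forall>l\<in>T. is_lozenge l \<and> l \<subseteq> R"
      unfolding T \<Phi>_def by blast
    moreover have "\<Union>T = R"
    proof (intro subset_antisym subsetI)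
      fix t assume t: "t \<in> R"
      from unit[OF t] show "t \<in> \<Union>T"
      proof (cases rule: unit_triangle_cases)
        case (1 u)
        then have "u \<in> ups R" using t by (simp add: ups_def)
        then show ?thesis unfolding T \<Phi>_def 1 by blast
      next
        case (2 d)
        then have "d \<in> \<pi> ` ups R" using t bij by (auto simp: downs_def bij_betw_def)
        then obtain u where "u \<in> ups R" "d = \<pi> u" by blast
        then show ?thesis unfolding T \<Phi>_def 2 by blast
      qed
    qed (use calculation in blast)
    moreover have "l \<inter> l' = {}" if l: "l \<in> T" "l' \<in> T" "l \<noteq> l'" for l l'
    proof -
      obtain u v where u: "u \<in> ups R" "l = {UP u, DN (\<pi> u)}" and v: "v \<in> ups R" "l' = {UP v, DN (\<pi> v)}"
        using l by (auto simp: T \<Phi>_def)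
      have "u \<noteq> v" using l(3) u v by auto
      then have "\<pi> u \<noteq> \<pi> v" using bij u v by (auto simp: bij_betw_def inj_on_def)
      then show ?thesis using \<open>u \<noteq> v\<close> UP_inj DN_inj UP_neq_DN UP_neq_DN[symmetric]
        unfolding u v by auto
    qed
    ultimately show "T \<in> {T. tiling R T}" by (simp add: tiling_def)
  next
    fix T assume "T \<in> {T. tiling R T}"
    then have loz: "\<And>l. l \<in> T \<Longrightarrow> is_lozenge l \<and> l \<subseteq> R" and un: "\<Union>T = R"
      and disj: "\<And>l l'. l \<in> T \<Longrightarrow> l' \<in> T \<Longrightarrow> l \<inter> l' \<noteq> {} \<Longrightarrow> l = l'"
      unfolding tiling_def mem_Collect_eq by blast+
    have exd: "\<exists>d. {UP u, DN d} \<in> T" if u: "u \<in> ups R" for u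
    proof -
      obtain l where l: "l \<in> T" "UP u \<in> l" using u unfolding ups_def un[symmetric] by blast
      then obtain v d where "l = {UP v, DN d}" using loz is_lozenge_iff by metis
      then have "{UP u, DN d} \<in> T" using l UP_inj UP_neq_DN by simp
      then show ?thesis ..
    qed
    have exu: "\<exists>u. {UP u, DN d} \<in> T" if d: "d \<in> downs R" for d
    proof -
      obtain l where l: "l \<in> T" "DN d \<in> l" using d unfolding downs_def un[symmetric] by blast
      then obtain v e where "l = {UP v, DN e}" using loz is_lozenge_iff by metis
      then have "{UP v, DN d} \<in> T" using l DN_inj UP_neq_DN[symmetric] by simp
      then show ?thesis ..
    qed
    \<comment> \<open>The choice is harmless: disjointness of the lozenges makes the partner unique,
      as \<open>mem\<close> shows.\<close>
    define \<pi> where "\<pi> = restrict (\<lambda>u. SOME d. {UP u, DN d} \<in> T) (ups R)"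
    have \<pi>T: "{UP u, DN (\<pi> u)} \<in> T" if "u \<in> ups R" for u
      using someI_ex[OF exd[OF that]] that by (simp add: \<pi>_def)
    have mem: "u \<in> ups R \<and> d \<in> downs R \<and> adj u d \<and> \<pi> u = d" if "{UP u, DN d} \<in> T" for u d
    proof -
      have u: "u \<in> ups R" "d \<in> downs R" using loz[OF that] by (auto simp: ups_def downs_def)
      have "adj u d" using loz[OF that] unfolding is_lozenge_iff lozenge_pair_eq by auto
      moreover have "{UP u, DN (\<pi> u)} = {UP u, DN d}"
        using disj[OF \<pi>T[OF u(1)] that] by auto
      ultimately show ?thesis using u by (simp only: lozenge_pair_eq)
    qed
    have "inj_on \<pi> (ups R)"
    proof (rule inj_onI)
      fix u v assume uv: "u \<in> ups R" "v \<in> ups R" "\<pi> u = \<pi> v"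
      have "{UP u, DN (\<pi> u)} = {UP v, DN (\<pi> v)}"
        using uv(3) by (intro disj \<pi>T uv(1,2)) auto
      then show "u = v" by (simp only: lozenge_pair_eq)
    qed
    moreover have "\<pi> ` ups R = downs R"
    proof (intro subset_antisym subsetI)
      fix d assume "d \<in> \<pi> ` ups R"
      then show "d \<in> downs R" using mem[OF \<pi>T] by blast
    next
      fix d assume "d \<in> downs R"
      then obtain u where "{UP u, DN d} \<in> T" using exu by blast
      then have "u \<in> ups R" "d = \<pi> u" using mem[of u d] by auto
      then show "d \<in> \<pi> ` ups R" by blast
    qed
    ultimately have "\<pi> \<in> matchings (ups R) (downs R)"
      using mem[OF \<pi>T] by (auto simp: matchings_def bij_betw_def \<pi>_def)
    moreover have "T = \<Phi> \<pi>"
    proof (intro subset_antisym subsetI)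
      fix l assume l: "l \<in> T"
      then obtain u d where "l = {UP u, DN d}" using loz is_lozenge_iff by metis
      then show "l \<in> \<Phi> \<pi>" using mem[of u d] l by (auto simp: \<Phi>_def)
    qed (auto simp: \<Phi>_def \<pi>T)
    ultimately show "T \<in> \<Phi> ` matchings (ups R) (downs R)" by blast
  qed
  then have "M (R, E) = (\<Sum>\<pi>\<in>matchings (ups R) (downs R). \<Prod>l\<in>\<Phi> \<pi>. lozenge_weight E l)"
    by (simp add: M_def sum.reindex_bij_betw[symmetric])
  also have "\<dots> = per (ups R) (downs R) (\<lambda>u. lozenge_weight E {UP u, DN u})"
    unfolding per_def \<Phi>_def
    by (intro sum.cong refl) (subst prod.reindex[OF inj], simp add: lozenge_weight_pair[symmetric])
  finally show ?thesis .
qed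

section \<open>Inversions of a matching\<close>

definition precedes :: "point \<Rightarrow> point \<Rightarrow> bool" where
  "precedes u v \<longleftrightarrow> snd u < snd v \<or> snd u = snd v \<and> fst u < fst v"

definition left_of :: "point set \<Rightarrow> point \<Rightarrow> point set" where
  "left_of S v = {u \<in> S. snd u = snd v \<and> fst u < fst v}"

definition right_of :: "point set \<Rightarrow> point \<Rightarrow> point set" where
  "right_of S v = {u \<in> S. snd u = snd v \<and> fst v < fst u}"

lemma matching_step:
  assumes "\<pi> \<in> matchings U D" "u \<in> U" "\<pi> u \<noteq> u"
  shows "snd (\<pi> u) = snd u + 1" "fst (\<pi> u) = fst u + 1 \<or> fst (\<pi> u) = fst u - 1"
  using assms by (auto simp: matchings_def adj_def)

text \<open>Two lozenges inside strips are never inverted: either their strips differ, or by the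
  lattice condition their up-pointing triangles are at least 2 apart while each partner is only 1
  away. A vertical \<open>u\<close> before a non-vertical \<open>v\<close> is not inverted either,
  since \<open>\<pi> v\<close> is one level higher.\<close>

lemma matching_inversion_iff:
  assumes \<pi>: "\<pi> \<in> matchings U D" and lat: "U \<subseteq> Defs.lattice c" and u: "u \<in> U" and v: "v \<in> U"
  shows "precedes u v \<and> precedes (\<pi> v) (\<pi> u) \<longleftrightarrow>
    \<pi> v = v \<and> \<pi> u \<noteq> u \<and> precedes u v \<and> precedes v (\<pi> u)"
proof (cases "\<pi> v = v")
  case True then show ?thesis by (auto simp: precedes_def)
next
  case False
  have par: "even (fst v - snd v - (fst u - snd u))"
  proof -
    have "u \<in> Defs.lattice c" "v \<in> Defs.lattice c" using lat u v by auto
    then show ?thesis by (cases u; cases v) (auto simp: Defs.lattice_def)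
  qed
  note mv = matching_step[OF \<pi> v False]
  show ?thesis
  proof (cases "\<pi> u = u")
    case True then show ?thesis using mv by (auto simp: precedes_def)
  next
    case f2: False
    note mu = matching_step[OF \<pi> u f2]
    have "\<not> (precedes u v \<and> precedes (\<pi> v) (\<pi> u))"
    proof
      assume "precedes u v \<and> precedes (\<pi> v) (\<pi> u)"
      then have "snd u = snd v" "fst u < fst v" "fst (\<pi> v) < fst (\<pi> u)"
        using mu(1) mv(1) by (auto simp: precedes_def)
      moreover from this have "fst v = fst u + 1" using mu(2) mv(2) by linarith
      ultimately show False using par by simp
    qed
    then show ?thesis using False by blast
  qed
qed

text \<open>A vertical \<open>v\<close> is inverted with the lozenges that start to its left on its
  level (\<open>A v\<close>) and with those that end to its right on its level (\<open>B v\<close>).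
  Vertical lozenges complete these sets to \<open>left_of U v\<close> and
  \<open>right_of D v\<close>; their contributions agree in total and disappear modulo 2. What
  remains depends on the place of \<open>v\<close> only, not on the matching.\<close>

lemma card_matching_inversions:
  assumes fin: "finite U" "finite D" and \<pi>: "\<pi> \<in> matchings U D" and lat: "U \<subseteq> Defs.lattice c"
  defines "V \<equiv> {v \<in> U. \<pi> v = v}"
  shows "card {(u, v). u \<in> U \<and> v \<in> U \<and> precedes u v \<and> precedes (\<pi> v) (\<pi> u)}
    + 2 * (\<Sum>v\<in>V. card (left_of V v)) = (\<Sum>v\<in>V. card (left_of U v) + card (right_of D v))"
proof -
  have inj: "inj_on \<pi> U" and im: "\<pi> ` U = D" using \<pi> by (auto simp: matchings_def bij_betw_def)
  have finV: "finite V" using fin by (simp add: V_def)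
  define A where "A v = {u \<in> U - V. snd u = snd v \<and> fst u < fst v}" for v
  define B where "B v = {u \<in> U - V. snd u + 1 = snd v \<and> fst v < fst (\<pi> u)}" for v
  have step: "snd (\<pi> u) = snd u + 1" "fst (\<pi> u) = fst u + 1 \<or> fst (\<pi> u) = fst u - 1" if "u \<in> U - V" for u
    using matching_step[OF \<pi>, of u] that by (auto simp: V_def)
  have AB: "{u \<in> U - V. precedes u v \<and> precedes v (\<pi> u)} = A v \<union> B v" for v
    using step by (fastforce simp: A_def B_def precedes_def)
  have "{(u, v). u \<in> U \<and> v \<in> U \<and> precedes u v \<and> precedes (\<pi> v) (\<pi> u)} =
      prod.swap ` (SIGMA v:V. A v \<union> B v)"
    (is "?I = ?J")
  proof (rule Set.set_eqI)
    fix x :: "point \<times> point"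
    obtain u v where x: "x = (u, v)" by (cases x)
    have "x \<in> ?J \<longleftrightarrow> v \<in> V \<and> u \<in> U - V \<and> precedes u v \<and> precedes v (\<pi> u)"
      unfolding x AB[symmetric] by simp
    also have "\<dots> \<longleftrightarrow> x \<in> ?I"
      using matching_inversion_iff[OF \<pi> lat, of u v] unfolding x V_def by auto
    finally show "x \<in> ?I \<longleftrightarrow> x \<in> ?J" ..
  qed
  then have "card {(u, v). u \<in> U \<and> v \<in> U \<and> precedes u v \<and> precedes (\<pi> v) (\<pi> u)} =
      (\<Sum>v\<in>V. card (A v \<union> B v))"
    using fin finV by (simp add: card_image A_def B_def)
  also have "\<dots> = (\<Sum>v\<in>V. card (A v) + card (B v))"
    by (intro sum.cong refl card_Un_disjoint) (auto simp: A_def B_def fin)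
  finally have I: "card {(u, v). u \<in> U \<and> v \<in> U \<and> precedes u v \<and> precedes (\<pi> v) (\<pi> u)} =
      (\<Sum>v\<in>V. card (A v) + card (B v))" .
  have L: "card (A v) + card (left_of V v) = card (left_of U v)" for v
  proof -
    have "left_of U v = A v \<union> left_of V v" "A v \<inter> left_of V v = {}"
      by (auto simp: A_def left_of_def V_def)
    then show ?thesis using fin finV by (simp add: card_Un_disjoint A_def left_of_def)
  qed
  have R: "card (B v) + card (right_of V v) = card (right_of D v)" for v
  proof -
    have VD: "V \<subseteq> D" using im by (force simp: V_def)
    have nV: "\<pi> u \<notin> V" if "u \<in> U - V" for u
    proof
      assume "\<pi> u \<in> V"
      then have "\<pi> (\<pi> u) = \<pi> u" "\<pi> u \<in> U" by (auto simp: V_def)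
      then have "\<pi> u = u" using inj that by (auto simp: inj_on_def)
      then show False using that by (auto simp: V_def)
    qed
    have "right_of D v = \<pi> ` B v \<union> right_of V v"
    proof (intro subset_antisym subsetI)
      fix d assume d: "d \<in> right_of D v"
      then obtain u where u: "u \<in> U" "d = \<pi> u" using im by (auto simp: right_of_def)
      show "d \<in> \<pi> ` B v \<union> right_of V v"
        using d u step[of u] by (cases "u \<in> V") (auto simp: right_of_def B_def V_def)
    next
      fix d assume "d \<in> \<pi> ` B v \<union> right_of V v"
      then show "d \<in> right_of D v"
        using VD im step by (auto simp: right_of_def B_def)
    qed
    moreover have "\<pi> ` B v \<inter> right_of V v = {}"
      using nV by (auto simp: right_of_def B_def)
    moreover have "card (\<pi> ` B v) = card (B v)"
      by (rule card_image) (rule inj_on_subset[OF inj], auto simp: B_def)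
    ultimately show ?thesis using fin finV by (simp add: card_Un_disjoint B_def right_of_def)
  qed
  \<comment> \<open>Both sides count the pairs of vertical lozenges on a common level.\<close>
  have LR: "(\<Sum>v\<in>V. card (left_of V v)) = (\<Sum>v\<in>V. card (right_of V v))"
  proof -
    have "(\<Sum>v\<in>V. card (left_of V v)) = card (SIGMA v:V. left_of V v)"
      using finV by (simp add: left_of_def)
    also have "(SIGMA v:V. left_of V v) = prod.swap ` (SIGMA v:V. right_of V v)"
      by (auto simp: left_of_def right_of_def image_iff)
    also have "card \<dots> = (\<Sum>v\<in>V. card (right_of V v))"
      using finV by (simp add: card_image right_of_def)
    finally show ?thesis .
  qed
  show ?thesis
    unfolding I L[symmetric] R[symmetric] sum.distrib using LR by simp
qed

lemma ex_sorted_enumeration: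
  assumes "finite U"
  obtains f :: "nat \<Rightarrow> point" where "bij_betw f {0..<card U} U"
    "\<And>i j. i < card U \<Longrightarrow> j < card U \<Longrightarrow> precedes (f i) (f j) \<longleftrightarrow> i < j"
proof -
  \<comment> \<open>Swapping puts the level first, which turns the lexicographic order on pairs into
    \<open>precedes\<close>.\<close>
  define xs where "xs = sorted_list_of_set (prod.swap ` U)"
  define f where "f i = prod.swap (xs ! i)" for i
  have len: "length xs = card U" and dist: "distinct xs" and set: "set xs = prod.swap ` U"
    and srt: "sorted_wrt (<) xs"
    using assms by (simp_all add: xs_def card_image)
  have mono: "precedes (f i) (f j)" if "i < j" "j < card U" for i j
    using sorted_wrt_nth_less[OF srt, of i j] that len
    by (auto simp: f_def precedes_def less_prod_def split: prod.splits)
  have irr: "\<not> (precedes u v \<and> precedes v u)" "\<not> precedes u u" for u v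
    by (auto simp: precedes_def)
  have "bij_betw f {0..<card U} U"
  proof -
    have "f ` {0..<card U} = prod.swap ` set xs"
      unfolding f_def len[symmetric] set_conv_nth by force
    then have "f ` {0..<card U} = U" by (simp add: set image_image)
    then show ?thesis by (simp add: bij_betw_def eq_card_imp_inj_on)
  qed
  moreover have "precedes (f i) (f j) \<longleftrightarrow> i < j" if "i < card U" "j < card U" for i j
    using mono[of i j] mono[of j i] that irr by (metis linorder_neqE_nat)
  ultimately show ?thesis by (rule that)
qed

section \<open>A Kasteleyn matrix for an arbitrary region\<close>

definition kast :: "(point \<Rightarrow> real) \<Rightarrow> point \<Rightarrow> point \<Rightarrow> real" where
  "kast w u d = (if d = u then w u else if adj u d then 1 else 0)"

text \<open>The inversions of a matching involve the up-pointing triangles to the left of a vertical lozenge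
  and the down-pointing ones to its right. Counting both on the right changes the signs by a factor
  that depends on the level only, which does not affect the absolute value of the determinant, and
  makes the sign of a lozenge in the right half of a region insensitive to the left half.\<close>

definition kappa :: "point set \<Rightarrow> point set \<Rightarrow> point \<Rightarrow> real" where
  "kappa U D v = (- 1) ^ (card (right_of U v) + card (right_of D v))"

definition perm_matching :: "nat \<Rightarrow> (nat \<Rightarrow> point) \<Rightarrow> (nat \<Rightarrow> point) \<Rightarrow> point set \<Rightarrow> (nat \<Rightarrow> nat) \<Rightarrow> point \<Rightarrow> point"
  where "perm_matching n f g U p = restrict (\<lambda>u. g (p (inv_into {0..<n} f u))) U"

definition adj_perms :: "nat \<Rightarrow> (nat \<Rightarrow> point) \<Rightarrow> (nat \<Rightarrow> point) \<Rightarrow> (nat \<Rightarrow> nat) set" where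
  "adj_perms n f g = {p. p permutes {0..<n} \<and> (\<forall>i<n. adj (f i) (g (p i)))}"

lemma perm_matching_apply:
  assumes "bij_betw f {0..<n} U" "i < n"
  shows "perm_matching n f g U p (f i) = g (p i)"
proof -
  have "f i \<in> U" "inv_into {0..<n} f (f i) = i"
    using assms by (auto simp: bij_betw_def)
  then show ?thesis by (simp add: perm_matching_def)
qed

lemma bij_betw_perm_matching:
  assumes f: "bij_betw f {0..<n} U" and g: "bij_betw g {0..<n} D"
  shows "bij_betw (perm_matching n f g U) (adj_perms n f g) (matchings U D)"
proof -
  define \<Psi> where "\<Psi> \<pi> i = (if i < n then inv_into {0..<n} g (\<pi> (f i)) else i)" for \<pi> i
  have fU: "f i \<in> U" if "i < n" for i using f that by (auto simp: bij_betw_def)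
  have gi: "inv_into {0..<n} g (g i) = i" if "i < n" for i using g that by (auto simp: bij_betw_def)
  have exf: "\<exists>i<n. u = f i" if "u \<in> U" for u using f that by (force simp: bij_betw_def)
  have gD: "g (inv_into {0..<n} g d) = d" "inv_into {0..<n} g d < n" if "d \<in> D" for d
    using g that f_inv_into_f[of d g "{0..<n}"] inv_into_into[of d g "{0..<n}"] by (auto simp: bij_betw_def)
  have pm: "perm_matching n f g U p (f i) = g (p i)" if "i < n" for p i
    by (rule perm_matching_apply[OF f that])
  show ?thesis
  proof (rule bij_betw_byWitness[where f' = \<Psi>])
    show "\<forall>p\<in>adj_perms n f g. \<Psi> (perm_matching n f g U p) = p"
    proof
      fix p assume "p \<in> adj_perms n f g"
      then have p: "p permutes {0..<n}" by (simp add: adj_perms_def)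
      have "\<Psi> (perm_matching n f g U p) i = p i" for i
        using pm[of i p] gi[of "p i"] permutes_in_image[OF p, of i] permutes_not_in[OF p, of i]
        by (simp add: \<Psi>_def)
      then show "\<Psi> (perm_matching n f g U p) = p" ..
    qed
    show "\<forall>\<pi>\<in>matchings U D. perm_matching n f g U (\<Psi> \<pi>) = \<pi>"
    proof
      fix \<pi> assume \<pi>: "\<pi> \<in> matchings U D"
      then have D: "\<pi> u \<in> D" if "u \<in> U" for u using that by (auto simp: matchings_def bij_betw_def)
      show "perm_matching n f g U (\<Psi> \<pi>) = \<pi>"
      proof (rule extensionalityI[of _ U])
        fix u assume "u \<in> U"
        then obtain i where "i < n" "u = f i" using exf by blast
        then show "perm_matching n f g U (\<Psi> \<pi>) u = \<pi> u"
          using pm D[OF \<open>u \<in> U\<close>] gD by (simp add: \<Psi>_def)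
      qed (use \<pi> in \<open>simp_all add: perm_matching_def matchings_def\<close>)
    qed
    show "perm_matching n f g U ` adj_perms n f g \<subseteq> matchings U D"
    proof (rule image_subsetI)
      fix p assume "p \<in> adj_perms n f g"
      then have p: "p permutes {0..<n}" and a: "\<And>i. i < n \<Longrightarrow> adj (f i) (g (p i))"
        by (simp_all add: adj_perms_def)
      have "bij_betw (g \<circ> p \<circ> inv_into {0..<n} f) U D"
        using bij_betw_trans[OF bij_betw_trans[OF bij_betw_inv_into[OF f] permutes_imp_bij[OF p]] g]
        by (simp add: comp_assoc)
      then have "bij_betw (perm_matching n f g U p) U D"
        by (rule bij_betw_cong[THEN iffD1, rotated]) (simp add: perm_matching_def)
      moreover have "adj u (perm_matching n f g U p u)" if "u \<in> U" for u
        using exf[OF that] a pm by auto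
      ultimately show "perm_matching n f g U p \<in> matchings U D"
        by (simp add: matchings_def perm_matching_def)
    qed
    show "\<Psi> ` matchings U D \<subseteq> adj_perms n f g"
    proof (rule image_subsetI)
      fix \<pi> assume \<pi>: "\<pi> \<in> matchings U D"
      then have bij: "bij_betw \<pi> U D" and a: "\<And>u. u \<in> U \<Longrightarrow> adj u (\<pi> u)"
        by (simp_all add: matchings_def)
      have D: "\<pi> u \<in> D" if "u \<in> U" for u using bij that by (auto simp: bij_betw_def)
      have "bij_betw (inv_into {0..<n} g \<circ> \<pi> \<circ> f) {0..<n} {0..<n}"
        using bij_betw_trans[OF bij_betw_trans[OF f bij] bij_betw_inv_into[OF g]]
        by (simp add: comp_assoc)
      then have "bij_betw (\<Psi> \<pi>) {0..<n} {0..<n}"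
        by (rule bij_betw_cong[THEN iffD1, rotated]) (simp add: \<Psi>_def)
      then have "\<Psi> \<pi> permutes {0..<n}"
        by (rule bij_imp_permutes) (auto simp: \<Psi>_def)
      moreover have "adj (f i) (g (\<Psi> \<pi> i))" if "i < n" for i
        using a[OF fU[OF that]] gD(1)[OF D[OF fU[OF that]]] that by (simp add: \<Psi>_def)
      ultimately show "\<Psi> \<pi> \<in> adj_perms n f g" by (simp add: adj_perms_def)
    qed
  qed
qed

lemma transition_permutes:
  fixes f h :: "nat \<Rightarrow> 'a"
  assumes f: "bij_betw f {0..<n} U" and h: "bij_betw h {0..<n} U"
  obtains r where "r permutes {0..<n}" "\<And>i. i < n \<Longrightarrow> f i = h (r i)"
proof -
  define r where "r i = (if i < n then inv_into {0..<n} h (f i) else i)" for i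
  have "bij_betw (inv_into {0..<n} h \<circ> f) {0..<n} {0..<n}"
    by (rule bij_betw_trans[OF f bij_betw_inv_into[OF h]])
  then have "bij_betw r {0..<n} {0..<n}"
    by (rule bij_betw_cong[THEN iffD1, rotated]) (simp add: r_def)
  then have "r permutes {0..<n}"
    by (rule bij_imp_permutes) (auto simp: r_def)
  moreover have "f i = h (r i)" if "i < n" for i
    using f h that f_inv_into_f[of "f i" h "{0..<n}"] by (auto simp: bij_betw_def r_def)
  ultimately show ?thesis by (rule that)
qed

text \<open>A sign depending on the level alone is a coboundary \<open>s k * s (k - 1)\<close>. Give
  every triangle the sign \<open>s\<close> of its strip: a lozenge inside a strip contributes a
  square, a vertical one contributes \<open>c\<close>, and the product over all triangles does not
  see the matching.\<close>

lemma level_sign_const: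
  fixes c :: "int \<Rightarrow> real"
  assumes fin: "finite U" "finite D" and c: "\<And>k. c k = 1 \<or> c k = - 1"
  obtains C :: real where "C = 1 \<or> C = - 1"
    "\<And>\<pi>. \<pi> \<in> matchings U D \<Longrightarrow> (\<Prod>u\<in>U. if \<pi> u = u then c (snd u) else 1) = C"
proof -
  define s where "s k = (\<Prod>j\<in>{j \<in> snd ` U. j \<le> k}. c j)" for k
  have finJ: "finite {j \<in> snd ` U. j \<le> k}" for k :: int using fin by simp
  have s1: "s k = 1 \<or> s k = - 1" for k
    unfolding s_def using finJ[of k]
  proof (induction rule: finite_induct)
    case (insert j J)
    then show ?case using c[of j] by auto
  qed simp
  then have s2: "s k * s k = 1" for k by (metis mult_1 mult_minus1 minus_minus)
  have sc: "s k * s (k - 1) = c k" if "k \<in> snd ` U" for k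
  proof -
    have "{j \<in> snd ` U. j \<le> k} = insert k {j \<in> snd ` U. j \<le> k - 1}" using that by auto
    then have "s k = c k * s (k - 1)" unfolding s_def using finJ[of "k - 1"] by simp
    then show ?thesis using s2[of "k - 1"] by simp
  qed
  define C where "C = (\<Prod>u\<in>U. s (snd u)) * (\<Prod>d\<in>D. s (snd d - 1))"
  have pm: "(\<Prod>x\<in>X. s (h x)) = 1 \<or> (\<Prod>x\<in>X. s (h x)) = - 1" if "finite X" for X and h :: "point \<Rightarrow> int"
    using that
  proof (induction rule: finite_induct)
    case (insert x X)
    then show ?case using s1[of "h x"] by auto
  qed simp
  have "C = 1 \<or> C = - 1"
    using pm[OF fin(1), of snd] pm[OF fin(2), of "\<lambda>d. snd d - 1"] by (auto simp: C_def)
  moreover have "(\<Prod>u\<in>U. if \<pi> u = u then c (snd u) else 1) = C" if \<pi>: "\<pi> \<in> matchings U D" for \<pi>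
  proof -
    have "bij_betw \<pi> U D" using \<pi> by (simp add: matchings_def)
    then have "C = (\<Prod>u\<in>U. s (snd u)) * (\<Prod>u\<in>U. s (snd (\<pi> u) - 1))"
      unfolding C_def by (subst prod.reindex_bij_betw[symmetric]) auto
    also have "\<dots> = (\<Prod>u\<in>U. s (snd u) * s (snd (\<pi> u) - 1))" by (simp add: prod.distrib)
    also have "\<dots> = (\<Prod>u\<in>U. if \<pi> u = u then c (snd u) else 1)"
      using matching_step(1)[OF \<pi>] sc s2 by (intro prod.cong refl) auto
    finally show ?thesis ..
  qed
  ultimately show ?thesis by (rule that)
qed

text \<open>Arbitrary enumerations are allowed because the folding argument lists one half before
  the other. Passing to the sorted ones costs the signs of \<open>r\<close> and \<open>t\<close>,
  which do not depend on the matching.\<close>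

lemma kasteleyn_sign_const:
  assumes fin: "finite U" "finite D" and lat: "U \<subseteq> Defs.lattice c"
    and f: "bij_betw f {0..<n} U" and g: "bij_betw g {0..<n} D"
  obtains C :: real where "C = 1 \<or> C = - 1"
    "\<And>p. p \<in> adj_perms n f g \<Longrightarrow>
      of_int (sign p) * (\<Prod>i\<in>{0..<n}. if g (p i) = f i then kappa U D (f i) else 1) = C"
proof -
  have n: "card U = n" "card D = n" using bij_betw_same_card[OF f] bij_betw_same_card[OF g] by auto
  obtain f0 where f0: "bij_betw f0 {0..<n} U"
    and f0s: "\<And>i j. i < n \<Longrightarrow> j < n \<Longrightarrow> precedes (f0 i) (f0 j) \<longleftrightarrow> i < j"
    using ex_sorted_enumeration[OF fin(1)] n by metis
  obtain g0 where g0: "bij_betw g0 {0..<n} D"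
    and g0s: "\<And>i j. i < n \<Longrightarrow> j < n \<Longrightarrow> precedes (g0 i) (g0 j) \<longleftrightarrow> i < j"
    using ex_sorted_enumeration[OF fin(2)] n by metis
  obtain r where r: "r permutes {0..<n}" and fr: "\<And>i. i < n \<Longrightarrow> f i = f0 (r i)"
    using transition_permutes[OF f f0] by blast
  obtain t where t: "t permutes {0..<n}" and gt: "\<And>i. i < n \<Longrightarrow> g i = g0 (t i)"
    using transition_permutes[OF g g0] by blast
  \<comment> \<open>Replacing \<open>left_of U v\<close> by \<open>right_of U v\<close> changes the
    exponent, modulo 2, by the number of other triangles of \<open>U\<close> on the level of
    \<open>v\<close>.\<close>
  define c :: "int \<Rightarrow> real" where "c k = (- 1) ^ (card {u \<in> U. snd u = k} + 1)" for k
  have c1: "c k = 1 \<or> c k = - 1" for k by (simp add: c_def minus_one_power_iff)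
  obtain C where C: "C = 1 \<or> C = - 1"
    and cC: "\<And>\<pi>. \<pi> \<in> matchings U D \<Longrightarrow> (\<Prod>u\<in>U. if \<pi> u = u then c (snd u) else 1) = C"
    by (rule level_sign_const[OF fin c1]) (rule that)
  have main: "of_int (sign p) * (\<Prod>i\<in>{0..<n}. if g (p i) = f i then kappa U D (f i) else 1) =
      of_int (sign t * sign r) * C" if p: "p \<in> adj_perms n f g" for p
  proof -
    define \<pi> where "\<pi> = perm_matching n f g U p"
    have \<pi>: "\<pi> \<in> matchings U D"
      using bij_betw_perm_matching[OF f g] p by (auto simp: \<pi>_def bij_betw_def)
    have pp: "p permutes {0..<n}" using p by (simp add: adj_perms_def)
    define ri where "ri = Hilbert_Choice.inv r"
    have ri: "ri permutes {0..<n}" unfolding ri_def by (rule permutes_inv[OF r])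
    define q where "q = t \<circ> p \<circ> ri"
    have q: "q permutes {0..<n}"
      unfolding q_def by (intro permutes_compose ri t pp)
    have perm: "permutation t" "permutation p" "permutation r" "permutation ri"
      using r t pp ri permutation_permutes by blast+
    have "sign ri = sign r" unfolding ri_def using perm(3) by (rule sign_inverse)
    then have sq: "sign q = sign t * sign p * sign r"
      unfolding q_def using perm by (simp add: sign_compose permutation_compose)
    have \<pi>f0: "\<pi> (f0 i) = g0 (q i)" if "i < n" for i
    proof -
      have i: "ri i < n" using permutes_in_image[OF ri, of i] that by simp
      then have "f0 i = f (ri i)" using fr permutes_inverses(1)[OF r] by (simp add: ri_def)
      then have "\<pi> (f0 i) = g (p (ri i))" using perm_matching_apply[OF f i] by (simp add: \<pi>_def)
      also have "\<dots> = g0 (q i)" using gt permutes_in_image[OF pp, of "ri i"] i by (simp add: q_def)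
      finally show ?thesis .
    qed
    have qn: "q i < n" if "i < n" for i using permutes_in_image[OF q, of i] that by simp
    let ?I = "{(u, v). u \<in> U \<and> v \<in> U \<and> precedes u v \<and> precedes (\<pi> v) (\<pi> u)}"
    have "?I = map_prod f0 f0 ` inversions n q"
    proof (rule Set.set_eqI)
      fix x :: "point \<times> point"
      obtain u v where x: "x = (u, v)" by (cases x)
      show "x \<in> ?I \<longleftrightarrow> x \<in> map_prod f0 f0 ` inversions n q"
      proof
        assume "x \<in> ?I"
        then have I: "u \<in> U" "v \<in> U" "precedes u v" "precedes (\<pi> v) (\<pi> u)" by (auto simp: x)
        then obtain i j where ij: "i < n" "j < n" "u = f0 i" "v = f0 j"
          using f0 by (force simp: bij_betw_def)
        then have "(i, j) \<in> inversions n q"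
          using I f0s g0s qn \<pi>f0 by (simp add: inversions_def)
        then show "x \<in> map_prod f0 f0 ` inversions n q" using x ij by force
      next
        assume "x \<in> map_prod f0 f0 ` inversions n q"
        then obtain i j where ij: "i < j" "j < n" "q j < q i" "u = f0 i" "v = f0 j"
          by (auto simp: x inversions_def)
        moreover have "u \<in> U" "v \<in> U" using ij f0 by (auto simp: bij_betw_def)
        ultimately show "x \<in> ?I" using f0s g0s qn \<pi>f0 by (simp add: x)
      qed
    qed
    moreover have "inj_on (map_prod f0 f0) (inversions n q)"
      using f0 by (intro inj_on_subset[OF map_prod_inj_on[of f0 "{0..<n}" f0 "{0..<n}"]])
        (auto simp: bij_betw_def inversions_def)
    ultimately have cI: "card ?I = card (inversions n q)" by (simp add: card_image)
    define V where "V = {v \<in> U. \<pi> v = v}"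
    have finV: "finite V" using fin by (simp add: V_def)
    have "card ?I + 2 * (\<Sum>v\<in>V. card (left_of V v)) =
        (\<Sum>v\<in>V. card (left_of U v) + card (right_of D v))"
      unfolding V_def by (rule card_matching_inversions[OF fin \<pi> lat])
    then have "(- 1 :: real) ^ card (inversions n q) * (- 1) ^ (2 * (\<Sum>v\<in>V. card (left_of V v))) =
        (- 1) ^ (\<Sum>v\<in>V. card (left_of U v) + card (right_of D v))"
      unfolding cI by (simp only: power_add[symmetric])
    then have sgn: "of_int (sign q) = (\<Prod>v\<in>V. (- 1 :: real) ^ (card (left_of U v) + card (right_of D v)))"
      by (simp add: sign_eq_inversions[OF q] power_sum)
    have "(\<Prod>i\<in>{0..<n}. if g (p i) = f i then kappa U D (f i) else 1) =
        (\<Prod>i\<in>{0..<n}. (\<lambda>u. if \<pi> u = u then kappa U D u else 1) (f i))"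
      using perm_matching_apply[OF f] by (intro prod.cong refl) (simp add: \<pi>_def)
    also have "\<dots> = (\<Prod>u\<in>U. if \<pi> u = u then kappa U D u else 1)"
      by (rule prod.reindex_bij_betw[OF f])
    also have "\<dots> = (\<Prod>v\<in>V. kappa U D v)"
      unfolding V_def using fin by (simp add: prod.inter_filter)
    finally have "of_int (sign q) * (\<Prod>i\<in>{0..<n}. if g (p i) = f i then kappa U D (f i) else 1) =
        (\<Prod>v\<in>V. (- 1) ^ (card (left_of U v) + card (right_of D v)) * kappa U D v)"
      by (simp add: sgn prod.distrib)
    also have "\<dots> = (\<Prod>v\<in>V. c (snd v))"
    proof (rule prod.cong[OF refl])
      fix v assume "v \<in> V"
      then have "{u \<in> U. snd u = snd v} = insert v (left_of U v \<union> right_of U v)"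
        by (auto simp: left_of_def right_of_def V_def prod_eq_iff)
      moreover have "finite (left_of U v)" "finite (right_of U v)" "left_of U v \<inter> right_of U v = {}"
        "v \<notin> left_of U v \<union> right_of U v"
        using fin by (auto simp: left_of_def right_of_def)
      ultimately have "card {u \<in> U. snd u = snd v} = Suc (card (left_of U v) + card (right_of U v))"
        by (simp add: card_Un_disjoint)
      then show "(- 1) ^ (card (left_of U v) + card (right_of D v)) * kappa U D v = c (snd v)"
        by (simp add: c_def kappa_def power_add flip: power_mult_distrib)
    qed
    also have "\<dots> = C"
      unfolding V_def cC[OF \<pi>, symmetric] using fin by (simp add: prod.inter_filter)
    finally have "of_int (sign q) * (\<Prod>i\<in>{0..<n}. if g (p i) = f i then kappa U D (f i) else 1) = C" .
    moreover have "sign p = sign t * sign r * sign q"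
      unfolding sq by (simp add: ac_simps)
    ultimately show ?thesis by (simp add: mult.assoc)
  qed
  have "of_int (sign t * sign r) * C = 1 \<or> of_int (sign t * sign r) * C = - 1"
    using C by (cases t rule: sign_cases; cases r rule: sign_cases) auto
  then show ?thesis using that main by blast
qed

text \<open>In the Leibniz expansion only permutations that pair adjacent triangles survive. They
  are the matchings, and \<open>kappa\<close> reduces all their signs to one constant.\<close>

theorem abs_det_kasteleyn:
  assumes fin: "finite U" "finite D" and lat: "U \<subseteq> Defs.lattice c"
    and f: "bij_betw f {0..<n} U" and g: "bij_betw g {0..<n} D"
  shows "\<bar>det (mat n n (\<lambda>(i, j). kast (\<lambda>u. kappa U D u * w u) (f i) (g j)))\<bar> = \<bar>per U D w\<bar>"
proof -
  let ?A = "mat n n (\<lambda>(i, j). kast (\<lambda>u. kappa U D u * w u) (f i) (g j))"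
  obtain C where C: "C = 1 \<or> C = - 1" and CC: "\<And>p. p \<in> adj_perms n f g \<Longrightarrow>
      of_int (sign p) * (\<Prod>i\<in>{0..<n}. if g (p i) = f i then kappa U D (f i) else 1) = C"
    by (rule kasteleyn_sign_const[OF fin lat f g]) (rule that)
  have pn: "p i < n" if "p permutes {0..<n}" "i < n" for p i
    using permutes_in_image[OF that(1), of i] that(2) by simp
  have "det ?A = (\<Sum>p\<in>{p. p permutes {0..<n}}. of_int (sign p) *
      (\<Prod>i\<in>{0..<n}. kast (\<lambda>u. kappa U D u * w u) (f i) (g (p i))))"
    by (subst det_def'[of _ n]) (auto intro!: sum.cong prod.cong simp: pn)
  also have "\<dots> = (\<Sum>p\<in>adj_perms n f g. of_int (sign p) *
      (\<Prod>i\<in>{0..<n}. kast (\<lambda>u. kappa U D u * w u) (f i) (g (p i))))"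
  proof (rule sum.mono_neutral_right)
    show "\<forall>p\<in>{p. p permutes {0..<n}} - adj_perms n f g. of_int (sign p) *
      (\<Prod>i\<in>{0..<n}. kast (\<lambda>u. kappa U D u * w u) (f i) (g (p i))) = 0"
    proof
      fix p assume "p \<in> {p. p permutes {0..<n}} - adj_perms n f g"
      then obtain i where "i < n" "\<not> adj (f i) (g (p i))" by (auto simp: adj_perms_def)
      then have "\<exists>i\<in>{0..<n}. kast (\<lambda>u. kappa U D u * w u) (f i) (g (p i)) = 0"
        by (intro bexI[of _ i]) (auto simp: kast_def adj_def)
      then show "of_int (sign p) *
        (\<Prod>i\<in>{0..<n}. kast (\<lambda>u. kappa U D u * w u) (f i) (g (p i))) = 0" by (simp add: prod_zero_iff)
    qed
  qed (auto simp: adj_perms_def finite_permutations)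
  also have "\<dots> = (\<Sum>p\<in>adj_perms n f g. C * (\<Prod>u\<in>U. if perm_matching n f g U p u = u then w u else 1))"
  proof (rule sum.cong[OF refl])
    fix p assume p: "p \<in> adj_perms n f g"
    have "(\<Prod>i\<in>{0..<n}. kast (\<lambda>u. kappa U D u * w u) (f i) (g (p i))) =
      (\<Prod>i\<in>{0..<n}. (if g (p i) = f i then kappa U D (f i) else 1) *
        (\<lambda>u. if perm_matching n f g U p u = u then w u else 1) (f i))"
      using p perm_matching_apply[OF f] by (intro prod.cong refl) (auto simp: kast_def adj_perms_def)
    also have "\<dots> = (\<Prod>i\<in>{0..<n}. if g (p i) = f i then kappa U D (f i) else 1) *
        (\<Prod>u\<in>U. if perm_matching n f g U p u = u then w u else 1)"
      unfolding prod.distrib by (subst prod.reindex_bij_betw[OF f]) (rule refl)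
    finally show "of_int (sign p) * (\<Prod>i\<in>{0..<n}. kast (\<lambda>u. kappa U D u * w u) (f i) (g (p i))) =
      C * (\<Prod>u\<in>U. if perm_matching n f g U p u = u then w u else 1)"
      using CC[OF p] by (simp add: mult.assoc[symmetric])
  qed
  also have "\<dots> = C * per U D w"
    unfolding per_def sum_distrib_left[symmetric]
    by (subst sum.reindex_bij_betw[OF bij_betw_perm_matching[OF f g], symmetric]) (rule refl)
  finally show ?thesis using C by (auto simp: abs_mult)
qed

section \<open>Folding a symmetric Kasteleyn matrix\<close>

lemma per_nonneg: "(\<And>u. u \<in> U \<Longrightarrow> 0 \<le> w u) \<Longrightarrow> 0 \<le> per U D w"
  unfolding per_def by (intro sum_nonneg prod_nonneg) auto

lemma per_card_neq: "card U \<noteq> card D \<Longrightarrow> per U D w = 0"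
proof -
  assume "card U \<noteq> card D"
  then have "matchings U D = {}" by (auto simp: matchings_def dest: bij_betw_same_card)
  then show ?thesis by (simp add: per_def)
qed

text \<open>A triangle is named by the left end of its horizontal side, which has length 2 in
  doubled coordinates. Reflection exchanges the ends, hence the -2; the axis triangles are those
  with first coordinate -1.\<close>

definition mirror_pt :: "point \<Rightarrow> point" where "mirror_pt u = (- fst u - 2, snd u)"

lemma mirror_pt_mirror_pt [simp]: "mirror_pt (mirror_pt u) = u" by (simp add: mirror_pt_def)
lemma fst_mirror_pt [simp]: "fst (mirror_pt u) = - fst u - 2" by (simp add: mirror_pt_def)
lemma snd_mirror_pt [simp]: "snd (mirror_pt u) = snd u" by (simp add: mirror_pt_def)
lemma mirror_pt_axis: "fst u = - 1 \<Longrightarrow> mirror_pt u = u" by (simp add: mirror_pt_def prod_eq_iff)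
lemma mirror_pt_eq_iff: "mirror_pt u = v \<longleftrightarrow> u = mirror_pt v" by (metis mirror_pt_mirror_pt)
lemma inj_mirror_pt: "inj_on mirror_pt A" by (metis inj_onI mirror_pt_mirror_pt)

lemma mirror_pt_mem_iff: "mirror_pt ` A = A \<Longrightarrow> mirror_pt u \<in> A \<longleftrightarrow> u \<in> A"
  by (metis image_eqI mirror_pt_mirror_pt)

definition half :: "point set \<Rightarrow> (point \<Rightarrow> bool) \<Rightarrow> point set" where
  "half A P = {u \<in> A. 0 \<le> fst u \<or> fst u = - 1 \<and> P u}"

definition axis_weight :: "point \<Rightarrow> real" where
  "axis_weight u = (if fst u = - 1 then 1 / 2 else 1)"

text \<open>The vectors of the new basis are indexed by the triangles themselves: a triangle v on the right
  gives v + t v * mirror image, a triangle on the left gives its mirror image minus t v * v.\<close>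

definition fold_coeff :: "(point \<Rightarrow> real) \<Rightarrow> point \<Rightarrow> point \<Rightarrow> real" where
  "fold_coeff t v u = (if fst v = - 1 then of_bool (u = v)
     else if 0 \<le> fst v then of_bool (u = v) + t v * of_bool (u = mirror_pt v)
     else of_bool (u = mirror_pt v) - t v * of_bool (u = v))"

text \<open>The pairing of \<open>X\<close> with the basis vector \<open>fold_coeff t v\<close>,
  with the sum already evaluated.\<close>

definition fold_row :: "(point \<Rightarrow> real) \<Rightarrow> (point \<Rightarrow> real) \<Rightarrow> point \<Rightarrow> real" where
  "fold_row t X v = (if fst v = - 1 then X v
     else if 0 \<le> fst v then X v + t v * X (mirror_pt v) else X (mirror_pt v) - t v * X v)"

lemma sum_fold_coeff:
  assumes "finite U" "mirror_pt ` U = U" "v \<in> U"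
  shows "(\<Sum>u\<in>U. fold_coeff t v u * X u) = fold_row t X v"
proof -
  have v: "v \<in> U" "mirror_pt v \<in> U" using assms mirror_pt_mem_iff by auto
  have d: "(\<Sum>u\<in>U. of_bool (u = a) * X u) = X a" if "a \<in> U" for a
  proof -
    have "(\<Sum>u\<in>U. of_bool (u = a) * X u) = (\<Sum>u\<in>U. if u = a then X u else 0)"
      by (intro sum.cong refl) auto
    then show ?thesis using that assms(1) by simp
  qed
  show ?thesis
    using d[OF v(1)] d[OF v(2)]
    by (simp add: fold_coeff_def fold_row_def distrib_right left_diff_distrib sum.distrib
        sum_subtractf mult.assoc flip: sum_distrib_left)
qed

text \<open>These are the inner products of the basis vectors. A vector off the axis has two
  components of modulus 1, one on the axis has a single component; the mixed products of the two
  vectors of a mirror pair cancel because \<open>t\<close> is symmetric.\<close>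

lemma fold_row_orthogonal:
  assumes t: "t v * t v = 1" and tr: "t (mirror_pt v) = t v"
  shows "fold_row t (fold_coeff t w) v = (if v = w then if fst v = - 1 then 1 else 2 else 0)"
proof -
  consider "fst v = - 1" | "0 \<le> fst v" | "fst v \<le> - 2" by linarith
  then show ?thesis
  proof cases
    case 1
    then show ?thesis
      using mirror_pt_axis[OF 1] by (auto simp: fold_row_def fold_coeff_def mirror_pt_eq_iff)
  next
    case 2
    have "mirror_pt v \<noteq> v" using 2 by (auto simp: mirror_pt_def prod_eq_iff)
    then show ?thesis
      using 2 t tr by (auto simp: fold_row_def fold_coeff_def mirror_pt_eq_iff)
  next
    case 3
    have "mirror_pt v \<noteq> v" using 3 by (auto simp: mirror_pt_def prod_eq_iff)
    then show ?thesis
      using 3 t tr by (auto simp: fold_row_def fold_coeff_def mirror_pt_eq_iff)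
  qed
qed

text \<open>Triangles off the axis come in mirror pairs.\<close>

lemma card_level_parity:
  assumes fin: "finite S" and S: "mirror_pt ` S = S"
  shows "(- 1 :: real) ^ card {u \<in> S. snd u = k} = (- 1) ^ of_bool ((- 1, k) \<in> S)"
proof -
  define A where "A = {u \<in> S. snd u = k \<and> 0 \<le> fst u}"
  define B where "B = {u \<in> S. snd u = k \<and> fst u = - 1}"
  have B: "B = (if (- 1, k) \<in> S then {(- 1, k)} else {})"
    by (auto simp: B_def prod_eq_iff)
  have "{u \<in> S. snd u = k} = A \<union> mirror_pt ` A \<union> B"
  proof (intro subset_antisym subsetI)
    fix u assume u: "u \<in> {u \<in> S. snd u = k}"
    have "u \<in> mirror_pt ` A" if "fst u \<le> - 2"
      using u that mirror_pt_mem_iff[OF S, of u] by (intro image_eqI[of _ _ "mirror_pt u"]) (auto simp: A_def)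
    then show "u \<in> A \<union> mirror_pt ` A \<union> B" using u by (force simp: A_def B_def)
  next
    fix u assume "u \<in> A \<union> mirror_pt ` A \<union> B"
    then show "u \<in> {u \<in> S. snd u = k}" using mirror_pt_mem_iff[OF S] by (auto simp: A_def B_def)
  qed
  moreover have "A \<inter> mirror_pt ` A = {}" "(A \<union> mirror_pt ` A) \<inter> B = {}"
    by (auto simp: A_def B_def)
  moreover have "finite A" "finite B" "card (mirror_pt ` A) = card A"
    using fin by (auto simp: A_def B_def intro: card_image inj_mirror_pt)
  ultimately have "card {u \<in> S. snd u = k} = 2 * card A + card B"
    by (simp add: card_Un_disjoint)
  then show ?thesis by (simp add: B power_add)
qed

text \<open>Reflection turns what lies to the right into what lies to the left, so the product of
  the two signs depends on the sizes of the full levels, whose parity is decided on the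
  axis.\<close>

lemma kappa_mirror_pt:
  assumes fin: "finite U" "finite D" and U: "mirror_pt ` U = U" and D: "mirror_pt ` D = D"
    and u: "u \<in> U" "u \<in> D"
  shows "kappa U D (mirror_pt u) =
    (- 1) ^ (of_bool ((- 1, snd u) \<in> U) + of_bool ((- 1, snd u) \<in> D)) * kappa U D u"
proof -
  have *: "card (right_of S (mirror_pt u)) + card (right_of S u) + 1 = card {v \<in> S. snd v = snd u}"
    if S: "finite S" "mirror_pt ` S = S" "u \<in> S" for S
  proof -
    have "right_of S (mirror_pt u) = mirror_pt ` left_of S u"
    proof (intro subset_antisym subsetI)
      fix v assume v: "v \<in> right_of S (mirror_pt u)"
      then show "v \<in> mirror_pt ` left_of S u" using mirror_pt_mem_iff[OF S(2), of v]
        by (intro image_eqI[of _ _ "mirror_pt v"]) (auto simp: right_of_def left_of_def)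
    next
      fix v assume "v \<in> mirror_pt ` left_of S u"
      then show "v \<in> right_of S (mirror_pt u)"
        using mirror_pt_mem_iff[OF S(2)] by (auto simp: right_of_def left_of_def)
    qed
    then have "card (right_of S (mirror_pt u)) = card (left_of S u)" by (simp add: card_image inj_mirror_pt)
    moreover have "{v \<in> S. snd v = snd u} = insert u (left_of S u \<union> right_of S u)"
      using S by (auto simp: left_of_def right_of_def prod_eq_iff)
    moreover have "finite (left_of S u)" "finite (right_of S u)" "left_of S u \<inter> right_of S u = {}"
      "u \<notin> left_of S u \<union> right_of S u"
      using S by (auto simp: left_of_def right_of_def)
    ultimately show ?thesis by (simp add: card_Un_disjoint)
  qed
  have "(- 1) ^ (of_bool ((- 1, snd u) \<in> U) + of_bool ((- 1, snd u) \<in> D)) =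
      (- 1 :: real) ^ (card {v \<in> U. snd v = snd u} + card {v \<in> D. snd v = snd u})"
    using card_level_parity[OF fin(1) U, of "snd u"] card_level_parity[OF fin(2) D, of "snd u"]
    by (simp add: power_add)
  also have "\<dots> = kappa U D (mirror_pt u) * kappa U D u"
  proof -
    have eq: "card {v \<in> U. snd v = snd u} + card {v \<in> D. snd v = snd u} =
        (card (right_of U (mirror_pt u)) + card (right_of D (mirror_pt u))) +
        (card (right_of U u) + card (right_of D u)) + 2"
      using *[OF fin(1) U u(1)] *[OF fin(2) D u(2)] by simp
    show ?thesis unfolding eq kappa_def by (simp add: power_add)
  qed
  moreover have "kappa U D u * kappa U D u = 1"
    by (simp add: kappa_def flip: power_mult_distrib)
  ultimately show ?thesis by simp
qed

text \<open>\<open>s_step\<close> concerns only the places of vertical lozenges, points of both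
  \<open>U\<close> and \<open>D\<close>. On the top or bottom side of a hexagon, where an axis
  triangle may have no counterpart beyond the side, the equation could fail.\<close>

locale folding =
  fixes U D :: "point set" and s :: "int \<Rightarrow> real" and c :: int
  assumes fin: "finite U" "finite D" and lat: "U \<subseteq> Defs.lattice c"
    and mirU: "mirror_pt ` U = U" and mirD: "mirror_pt ` D = D"
    and s: "\<And>k. s k = 1 \<or> s k = - 1"
    and s_step: "\<And>p k. (p, k) \<in> U \<Longrightarrow> (p, k) \<in> D \<Longrightarrow>
      s k * s (k - 1) = (- 1) ^ (of_bool ((- 1, k) \<in> U) + of_bool ((- 1, k) \<in> D))"
begin

text \<open>Both functions give the sign of the strip that contains the triangle:
  \<open>UP (p, k)\<close> and \<open>DN (p, k + 1)\<close> share a strip, hence the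
  \<open>- 1\<close> in \<open>tD\<close>.\<close>

definition tU :: "point \<Rightarrow> real" where "tU u = s (snd u)"
definition tD :: "point \<Rightarrow> real" where "tD d = s (snd d - 1)"

abbreviation K :: "point \<Rightarrow> point \<Rightarrow> real" where "K \<equiv> kast (kappa U D)"

lemma tU2: "tU u * tU u = 1" and tD2: "tD u * tD u = 1"
  using s by (metis tU_def mult_1 mult_minus1 minus_minus, metis tD_def mult_1 mult_minus1 minus_minus)

lemma tU_cases: "tU u = 1 \<or> tU u = - 1" and tD_cases: "tD u = 1 \<or> tD u = - 1"
  using s by (simp_all add: tU_def tD_def)

lemma t_mirror_pt [simp]: "tU (mirror_pt u) = tU u" "tD (mirror_pt u) = tD u"
  by (simp_all add: tU_def tD_def)

text \<open>For a lozenge inside a strip the two signs cancel; for a vertical one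
  \<open>s_step\<close> matches exactly the change of \<open>kappa\<close> under reflection.\<close>

lemma K_mirror_pt:
  assumes "u \<in> U" "d \<in> D"
  shows "K (mirror_pt u) (mirror_pt d) = tU u * tD d * K u d"
proof (cases "d = u")
  case True
  then have "s (snd u) * s (snd u - 1) =
      (- 1) ^ (of_bool ((- 1, snd u) \<in> U) + of_bool ((- 1, snd u) \<in> D))"
    using s_step[of "fst u" "snd u"] assms by simp
  then show ?thesis
    using kappa_mirror_pt[OF fin mirU mirD, of u] True assms by (simp add: kast_def tU_def tD_def)
next
  case False
  have adj: "adj (mirror_pt u) (mirror_pt d) \<longleftrightarrow> adj u d"
    by (auto simp: adj_def prod_eq_iff)
  have "tU u * tD d = 1" if "adj u d"
  proof -
    have "snd d = snd u + 1" using that False by (auto simp: adj_def)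
    then show ?thesis using tU2[of u] by (simp add: tU_def tD_def)
  qed
  moreover have "mirror_pt d \<noteq> mirror_pt u" using False by (simp add: mirror_pt_eq_iff)
  ultimately show ?thesis using False adj by (simp add: kast_def)
qed

lemma K_across: "0 \<le> fst u \<Longrightarrow> fst d \<le> - 2 \<Longrightarrow> K u d = 0"
  "fst u \<le> - 2 \<Longrightarrow> 0 \<le> fst d \<Longrightarrow> K u d = 0"
  by (auto simp: kast_def adj_def)

lemma K_axis: "fst u = - 1 \<Longrightarrow> fst d = - 1 \<Longrightarrow> u \<noteq> d \<Longrightarrow> K u d = 0"
  by (auto simp: kast_def adj_def)

definition folded :: "point \<Rightarrow> point \<Rightarrow> real" where
  "folded v e = fold_row tD (\<lambda>d. fold_row tU (\<lambda>u. K u d) v) e"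

abbreviation KW :: "point \<Rightarrow> point \<Rightarrow> real" where
  "KW \<equiv> kast (\<lambda>u. kappa U D u * axis_weight u)"

lemma KW_eq: "fst u \<noteq> - 1 \<or> u \<noteq> d \<Longrightarrow> KW u d = K u d"
  by (auto simp: kast_def axis_weight_def)

lemma KW_axis: "fst u = - 1 \<Longrightarrow> 2 * KW u u = K u u"
  by (auto simp: kast_def axis_weight_def)

abbreviation side :: "(point \<Rightarrow> real) \<Rightarrow> point \<Rightarrow> bool" where
  "side t v \<equiv> 0 \<le> fst v \<or> fst v = - 1 \<and> t v = 1"

definition fold_pt :: "point \<Rightarrow> point" where
  "fold_pt v = (if fst v \<le> - 2 then mirror_pt v else v)"

lemma region_cases:
  obtains "fst (v :: point) = - 1" | "0 \<le> fst v" "fst v \<noteq> - 1" "\<not> fst v \<le> - 2"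
  | "fst v \<le> - 2" "fst v \<noteq> - 1" "\<not> 0 \<le> fst v"
  by linarith

lemma K_mirror_pt':
  assumes "u \<in> U" "d \<in> D"
  shows "K (mirror_pt u) d = tU u * tD d * K u (mirror_pt d)"
  using K_mirror_pt[of u "mirror_pt d"] assms mirror_pt_mem_iff[OF mirD] by simp

text \<open>By \<open>K_mirror_pt\<close> the mirror terms either double the original ones or cancel
  them. This yields twice an entry of \<open>K\<close> even when just one of the two triangles is on
  the axis, since it then meets both components of the other vector. Only a vertical lozenge on the
  axis contributes a single \<open>K v v\<close>, which the weight 1/2 in \<open>KW\<close> brings
  to the same form.\<close>

lemma folded_eq:
  assumes v: "v \<in> U" and e: "e \<in> D"
  shows "folded v e = (if side tU v \<longleftrightarrow> side tD e
    then 2 * KW (fold_pt v) (fold_pt e) else 0)"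
proof (cases v rule: region_cases)
  case 1
  note v1 = 1 mirror_pt_axis[OF 1]
  show ?thesis
  proof (cases e rule: region_cases)
    case 1
    \<comment> \<open>For \<open>e = v\<close> this leaves two possibilities, equal signs or a zero
      entry, so that an axis lozenge never links the two blocks.\<close>
    then have "K v e = tU v * tD e * K v e" using K_mirror_pt[OF v e] v1 mirror_pt_axis[OF 1] by simp
    then show ?thesis using v1 1 K_axis[of v e] KW_axis[of v] tU_cases[of v] tD_cases[of e]
      by (cases "v = e") (auto simp: folded_def fold_row_def fold_pt_def KW_eq)
  next
    case 2
    have "K v (mirror_pt e) = tU v * tD e * K v e" using K_mirror_pt[OF v e] v1 by simp
    moreover have "v \<noteq> e" using v1 2 by auto
    ultimately show ?thesis using v1 2 tU_cases[of v] tD_cases[of e]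
      by (auto simp: folded_def fold_row_def fold_pt_def KW_eq)
  next
    case 3
    have "K v e = tU v * tD e * K v (mirror_pt e)" using K_mirror_pt'[OF v e] v1 by simp
    moreover have "v \<noteq> mirror_pt e" using v1 3 by auto
    ultimately show ?thesis using v1 3 tU_cases[of v] tD_cases[of e]
      by (auto simp: folded_def fold_row_def fold_pt_def KW_eq)
  qed
next
  case 2
  note v2 = 2
  show ?thesis
  proof (cases e rule: region_cases)
    case 1
    have "K (mirror_pt v) e = tU v * tD e * K v e" using K_mirror_pt[OF v e] mirror_pt_axis[OF 1] by simp
    moreover have "v \<noteq> e" using v2 1 by auto
    ultimately show ?thesis using v2 1 tU_cases[of v] tD_cases[of e]
      by (auto simp: folded_def fold_row_def fold_pt_def KW_eq)
  next
    case 2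
    have "K (mirror_pt v) (mirror_pt e) = tU v * tD e * K v e" by (rule K_mirror_pt[OF v e])
    moreover have "K (mirror_pt v) e = 0" "K v (mirror_pt e) = 0" using v2 2 by (auto intro: K_across)
    ultimately show ?thesis using v2 2 tU_cases[of v] tD_cases[of e]
      by (auto simp: folded_def fold_row_def fold_pt_def KW_eq)
  next
    case 3
    have "K (mirror_pt v) e = tU v * tD e * K v (mirror_pt e)" by (rule K_mirror_pt'[OF v e])
    moreover have "K (mirror_pt v) (mirror_pt e) = 0" "K v e = 0" using v2 3 by (auto intro: K_across)
    ultimately show ?thesis using v2 3 tU_cases[of v] tD_cases[of e]
      by (auto simp: folded_def fold_row_def fold_pt_def KW_eq)
  qed
next
  case 3
  note v3 = 3
  show ?thesis
  proof (cases e rule: region_cases)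
    case 1
    have "K (mirror_pt v) e = tU v * tD e * K v e" using K_mirror_pt[OF v e] mirror_pt_axis[OF 1] by simp
    moreover have "mirror_pt v \<noteq> e" using v3 1 by auto
    ultimately show ?thesis using v3 1 tU_cases[of v] tD_cases[of e]
      by (auto simp: folded_def fold_row_def fold_pt_def KW_eq)
  next
    case 2
    have "K (mirror_pt v) e = tU v * tD e * K v (mirror_pt e)" by (rule K_mirror_pt'[OF v e])
    moreover have "K (mirror_pt v) (mirror_pt e) = 0" "K v e = 0" using v3 2 by (auto intro: K_across)
    ultimately show ?thesis using v3 2 tU_cases[of v] tD_cases[of e]
      by (auto simp: folded_def fold_row_def fold_pt_def KW_eq)
  next
    case 3
    have "K (mirror_pt v) (mirror_pt e) = tU v * tD e * K v e" by (rule K_mirror_pt[OF v e])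
    moreover have "K (mirror_pt v) e = 0" "K v (mirror_pt e) = 0" using v3 3 by (auto intro: K_across)
    ultimately show ?thesis using v3 3 tU_cases[of v] tD_cases[of e]
      by (auto simp: folded_def fold_row_def fold_pt_def KW_eq)
  qed
qed

end

section \<open>Block decomposition of the folded determinant\<close>

lemma det_fold_square:
  assumes fin: "finite A" and A: "mirror_pt ` A = A" and f: "bij_betw f {0..<n} A"
    and t: "\<And>v. t v * t v = 1" "\<And>v. t (mirror_pt v) = t v"
  shows "(det (mat n n (\<lambda>(i, j). fold_coeff t (f i) (f j))))\<^sup>2 = 2 ^ card {u \<in> A. fst u \<noteq> - 1}"
proof -
  let ?H = "mat n n (\<lambda>(i, j). fold_coeff t (f i) (f j))"
  let ?d = "\<lambda>u :: point. if fst u = - 1 then 1 else 2 :: real"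
  have fA: "f i \<in> A" if "i < n" for i using f that by (auto simp: bij_betw_def)
  have fi: "f i = f j \<longleftrightarrow> i = j" if "i < n" "j < n" for i j
    using f that by (auto simp: bij_betw_def inj_on_def)
  let ?D = "mat n n (\<lambda>(i, j). if i = j then ?d (f i) else 0)"
  have "?H * transpose_mat ?H = ?D"
  proof (rule eq_matI)
    fix i j assume "i < dim_row ?D" "j < dim_col ?D"
    then have ij: "i < n" "j < n" by auto
    have "(?H * transpose_mat ?H) $$ (i, j) =
        (\<Sum>l\<in>{0..<n}. fold_coeff t (f i) (f l) * fold_coeff t (f j) (f l))"
      using ij by (simp add: scalar_prod_def)
    also have "\<dots> = (\<Sum>u\<in>A. fold_coeff t (f i) u * fold_coeff t (f j) u)"
      by (rule sum.reindex_bij_betw[OF f])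
    also have "\<dots> = ?D $$ (i, j)"
      using ij fi by (simp add: sum_fold_coeff[OF fin A fA] fold_row_orthogonal[of t, OF t])
    finally show "(?H * transpose_mat ?H) $$ (i, j) = ?D $$ (i, j)" .
  qed simp_all
  moreover have "det (?H * transpose_mat ?H) = (det ?H)\<^sup>2"
    by (subst det_mult[of _ n]) (simp_all add: det_transpose[of _ n] power2_eq_square)
  moreover have "det ?D = (\<Prod>i\<in>{0..<n}. ?d (f i))"
    by (subst det_upper_triangular[of _ n])
      (auto simp: upper_triangular_def diag_mat_def prod.list_conv_set_nth intro!: prod.cong)
  moreover have "(\<Prod>i\<in>{0..<n}. ?d (f i)) = (\<Prod>u\<in>A. ?d u)"
    by (rule prod.reindex_bij_betw[OF f])
  moreover have "(\<Prod>u\<in>A. ?d u) = 2 ^ card {u \<in> A. fst u \<noteq> - 1}"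
    using fin by (simp add: prod.If_cases Int_def)
  ultimately show ?thesis by simp
qed

text \<open>By the pigeonhole principle no permutation maps all of \<open>I\<close> outside
  \<open>J\<close>, so every term of the expansion has a zero factor. This handles folded matrices
  whose blocks are not square.\<close>

lemma det_zero_block:
  fixes X :: "real mat"
  assumes X: "X \<in> carrier_mat n n" and I: "I \<subseteq> {0..<n}" and J: "J \<subseteq> {0..<n}"
    and card: "n < card I + card J" and zero: "\<And>i j. i \<in> I \<Longrightarrow> j \<in> J \<Longrightarrow> X $$ (i, j) = 0"
  shows "det X = 0"
proof -
  have fin: "finite I" "finite J" using I J finite_subset by blast+
  have z: "(\<Prod>i\<in>{0..<n}. X $$ (i, p i)) = 0" if p: "p permutes {0..<n}" for p
  proof -
    have "\<exists>i\<in>I. p i \<in> J"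
    proof (rule ccontr)
      assume "\<not> ?thesis"
      then have "p ` I \<subseteq> {0..<n} - J" using permutes_in_image[OF p] I by blast
      then have "card (p ` I) \<le> n - card J"
        using card_mono[of "{0..<n} - J" "p ` I"] J fin by (simp add: card_Diff_subset)
      moreover have "card (p ` I) = card I"
        using permutes_inj[OF p] by (simp add: card_image inj_on_subset)
      moreover have "card J \<le> n" using card_mono[OF _ J] by simp
      ultimately show False using card by simp
    qed
    then show ?thesis using zero I by (force simp: prod_zero_iff)
  qed
  show ?thesis unfolding det_def'[OF X]
  proof (rule sum.neutral, rule ballI)
    fix p assume "p \<in> {p. p permutes {0..<n}}"
    then show "signof p * (\<Prod>i = 0..<n. X $$ (i, p i)) = 0" unfolding mem_Collect_eq by (simp only: z mult_zero_right)
  qed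
qed

lemma ex_split_enumeration:
  assumes "finite A" "finite B" "A \<inter> B = {}"
  obtains f :: "nat \<Rightarrow> 'a" where "bij_betw f {0..<card A + card B} (A \<union> B)"
    "bij_betw f {0..<card A} A" "bij_betw (\<lambda>i. f (card A + i)) {0..<card B} B"
proof -
  obtain f1 where f1: "bij_betw f1 {0..<card A} A" using ex_bij_betw_nat_finite[OF assms(1)] by blast
  obtain f2 where f2: "bij_betw f2 {0..<card B} B" using ex_bij_betw_nat_finite[OF assms(2)] by blast
  define f where "f i = (if i < card A then f1 i else f2 (i - card A))" for i
  have A: "bij_betw f {0..<card A} A"
    using f1 by (rule bij_betw_cong[THEN iffD1, rotated]) (simp add: f_def)
  have B: "bij_betw (\<lambda>i. f (card A + i)) {0..<card B} B"
    using f2 by (rule bij_betw_cong[THEN iffD1, rotated]) (simp add: f_def)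
  have "bij_betw ((+) (card A)) {0..<card B} {card A..<card A + card B}"
    by (simp add: bij_betw_def add.commute)
  then have "bij_betw (\<lambda>i. i - card A) {card A..<card A + card B} {0..<card B}"
    by (intro bij_betw_byWitness[where f' = "(+) (card A)"]) auto
  from bij_betw_trans[OF this B] have "bij_betw f {card A..<card A + card B} B"
    by (rule bij_betw_cong[THEN iffD1, rotated]) simp
  from bij_betw_combine[OF A this assms(3)] have "bij_betw f {0..<card A + card B} (A \<union> B)"
    by (simp add: ivl_disj_un)
  then show ?thesis using A B by (rule that)
qed

context folding
begin

definition "U1 = half U (\<lambda>u. tU u = 1)"
definition "D1 = half D (\<lambda>d. tD d = 1)"
definition "U2 = half U (\<lambda>u. tU u = - 1)"
definition "D2 = half D (\<lambda>d. tD d = - 1)"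

text \<open>Outside the first half remain the left triangles and the axis triangles of sign -1;
  reflecting the former gives the second half.\<close>

lemma half_complement:
  assumes fin: "finite A" and A: "mirror_pt ` A = A" and t: "\<And>u. t u = 1 \<or> t u = (- 1 :: real)"
  shows "bij_betw fold_pt (A - half A (\<lambda>u. t u = 1)) (half A (\<lambda>u. t u = - 1))"
proof (rule bij_betw_byWitness[where f' = "\<lambda>u. if fst u = - 1 then u else mirror_pt u"])
  have m: "mirror_pt u \<in> A \<longleftrightarrow> u \<in> A" for u by (rule mirror_pt_mem_iff[OF A])
  have t': "t u \<noteq> 1 \<longleftrightarrow> t u = - 1" for u using t[of u] by auto
  show "\<forall>u\<in>A - half A (\<lambda>u. t u = 1). (if fst (fold_pt u) = - 1 then fold_pt u else mirror_pt (fold_pt u)) = u"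
    by (auto simp: half_def fold_pt_def)
  show "\<forall>u\<in>half A (\<lambda>u. t u = - 1). fold_pt (if fst u = - 1 then u else mirror_pt u) = u"
    by (auto simp: half_def fold_pt_def)
  show "fold_pt ` (A - half A (\<lambda>u. t u = 1)) \<subseteq> half A (\<lambda>u. t u = - 1)"
    using m t' by (auto simp: half_def fold_pt_def)
  show "(\<lambda>u. if fst u = - 1 then u else mirror_pt u) ` half A (\<lambda>u. t u = - 1) \<subseteq> A - half A (\<lambda>u. t u = 1)"
    using m t' by (auto simp: half_def)
qed

text \<open>Whatever lies to the right of a triangle of the half has nonnegative first coordinate
  and so belongs to the half as well.\<close>

lemma kappa_half:
  assumes "u \<in> half U P"
  shows "kappa (half U P) (half D Q) u = kappa U D u"
proof -
  have "right_of (half U P) u = right_of U u" "right_of (half D Q) u = right_of D u"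
    using assms by (auto simp: right_of_def half_def)
  then show ?thesis by (simp add: kappa_def)
qed

lemma abs_det_half:
  assumes f: "bij_betw f {0..<n} (half U P)" and g: "bij_betw g {0..<n} (half D Q)"
  shows "\<bar>det (mat n n (\<lambda>(i, j). 2 * KW (f i) (g j)))\<bar> = 2 ^ n * \<bar>per (half U P) (half D Q) axis_weight\<bar>"
proof -
  have fU: "f i \<in> half U P" if "i < n" for i using f that by (auto simp: bij_betw_def)
  have fin': "finite (half U P)" "finite (half D Q)" "half U P \<subseteq> Defs.lattice c"
    using fin lat by (auto simp: half_def)
  have "mat n n (\<lambda>(i, j). 2 * KW (f i) (g j)) =
      2 \<cdot>\<^sub>m mat n n (\<lambda>(i, j). kast (\<lambda>u. kappa (half U P) (half D Q) u * axis_weight u) (f i) (g j))"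
    by (rule eq_matI) (auto simp: kast_def kappa_half[OF fU])
  then show ?thesis
    using abs_det_kasteleyn[OF fin' f g, of axis_weight] by (simp add: abs_mult power_abs)
qed

text \<open>The determinant of the folded matrix \<open>X\<close> is evaluated twice: as a product
  with the two base changes \<open>H\<close> and \<open>G\<close>, and through its block
  form.\<close>

theorem per_square_factorization:
  "(per U D (\<lambda>_. 1))\<^sup>2 = 2 ^ (card {u \<in> U. fst u = - 1} + card {d \<in> D. fst d = - 1}) *
    (per U1 D1 axis_weight * per U2 D2 axis_weight)\<^sup>2"
proof -
  have sub: "U1 \<subseteq> U" "D1 \<subseteq> D" by (auto simp: U1_def D1_def half_def)
  have fin1: "finite U1" "finite D1" using sub fin finite_subset by blast+
  have bU: "bij_betw fold_pt (U - U1) U2" unfolding U1_def U2_def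
    by (rule half_complement[OF fin(1) mirU tU_cases])
  have bD: "bij_betw fold_pt (D - D1) D2" unfolding D1_def D2_def
    by (rule half_complement[OF fin(2) mirD tD_cases])
  have cU: "card (U - U1) = card U - card U1" "card U1 \<le> card U"
    using sub fin1 fin by (simp_all add: card_Diff_subset card_mono)
  have cD: "card (D - D1) = card D - card D1" "card D1 \<le> card D"
    using sub fin1 fin by (simp_all add: card_Diff_subset card_mono)
  have c2: "card U2 = card U - card U1" "card D2 = card D - card D1"
    using bij_betw_same_card[OF bU] bij_betw_same_card[OF bD] cU cD by auto
  show ?thesis
  proof (cases "card U = card D")
    case False
    \<comment> \<open>An unbalanced region has no matching, and at least one of its halves is
      unbalanced too.\<close>
    then have "card U1 \<noteq> card D1 \<or> card U2 \<noteq> card D2" using c2 cU cD by linarith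
    then show ?thesis using False by (auto simp: per_card_neq)
  next
    case True
    define N n m where "N = card U" and "n = card U1" and "m = card D1"
    \<comment> \<open>Enumerating the first half before its complement brings the folded matrix into
      block form.\<close>
    obtain f where f: "bij_betw f {0..<n + card (U - U1)} (U1 \<union> (U - U1))"
      and f1: "bij_betw f {0..<n} U1" and f2: "bij_betw (\<lambda>i. f (n + i)) {0..<card (U - U1)} (U - U1)"
      unfolding n_def by (rule ex_split_enumeration[of U1 "U - U1"]) (use fin1 fin in auto)
    obtain g where g: "bij_betw g {0..<m + card (D - D1)} (D1 \<union> (D - D1))"
      and g1: "bij_betw g {0..<m} D1" and g2: "bij_betw (\<lambda>i. g (m + i)) {0..<card (D - D1)} (D - D1)"
      unfolding m_def by (rule ex_split_enumeration[of D1 "D - D1"]) (use fin1 fin in auto)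
    have nN: "n \<le> N" "m \<le> N" "card (U - U1) = N - n" "card (D - D1) = N - m"
      using cU cD True by (simp_all add: N_def n_def m_def)
    have f: "bij_betw f {0..<N} U" using f nN sub by (simp add: Un_absorb1)
    have g: "bij_betw g {0..<N} D" using g nN sub by (simp add: Un_absorb1)
    have fU: "f i \<in> U" "g i \<in> D" if "i < N" for i using f g that by (auto simp: bij_betw_def)
    have fside: "side tU (f i) \<longleftrightarrow> i < n" if "i < N" for i
    proof -
      have "f i \<in> U1" if "i < n" using f1 that by (auto simp: bij_betw_def)
      moreover have "f i \<in> U - U1" if "n \<le> i"
      proof -
        have "(\<lambda>i. f (n + i)) (i - n) \<in> U - U1"
          by (rule bij_betw_apply[OF f2]) (use that \<open>i < N\<close> nN in auto)
        then show ?thesis using that by simp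
      qed
      ultimately show ?thesis using fU(1)[OF that] by (cases "i < n") (auto simp: U1_def half_def)
    qed
    have gside: "side tD (g i) \<longleftrightarrow> i < m" if "i < N" for i
    proof -
      have "g i \<in> D1" if "i < m" using g1 that by (auto simp: bij_betw_def)
      moreover have "g i \<in> D - D1" if "m \<le> i"
      proof -
        have "(\<lambda>i. g (m + i)) (i - m) \<in> D - D1"
          by (rule bij_betw_apply[OF g2]) (use that \<open>i < N\<close> nN in auto)
        then show ?thesis using that by simp
      qed
      ultimately show ?thesis using fU(2)[OF that] by (cases "i < m") (auto simp: D1_def half_def)
    qed
    define H where "H = mat N N (\<lambda>(i, j). fold_coeff tU (f i) (f j))"
    define G where "G = mat N N (\<lambda>(i, j). fold_coeff tD (g i) (g j))"
    define Km where "Km = mat N N (\<lambda>(i, j). K (f i) (g j))"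
    define X where "X = mat N N (\<lambda>(i, j). folded (f i) (g j))"
    have carr: "H \<in> carrier_mat N N" "G \<in> carrier_mat N N" "Km \<in> carrier_mat N N" "X \<in> carrier_mat N N"
      by (simp_all add: H_def G_def Km_def X_def)
    have HK: "H * Km = mat N N (\<lambda>(i, j). fold_row tU (\<lambda>u. K u (g j)) (f i))" (is "_ = ?HK")
    proof (rule eq_matI)
      fix i j assume "i < dim_row ?HK" "j < dim_col ?HK"
      then have ij: "i < N" "j < N" by auto
      have "(H * Km) $$ (i, j) = (\<Sum>l\<in>{0..<N}. (\<lambda>u. fold_coeff tU (f i) u * K u (g j)) (f l))"
        using ij by (simp add: scalar_prod_def H_def Km_def)
      also have "\<dots> = (\<Sum>u\<in>U. fold_coeff tU (f i) u * K u (g j))"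
        by (rule sum.reindex_bij_betw[OF f])
      also have "\<dots> = fold_row tU (\<lambda>u. K u (g j)) (f i)"
        by (rule sum_fold_coeff[OF fin(1) mirU fU(1)[OF ij(1)]])
      finally show "(H * Km) $$ (i, j) = ?HK $$ (i, j)" using ij by simp
    qed (simp_all add: H_def Km_def)
    have HKG: "H * Km * transpose_mat G = X"
    proof (rule eq_matI)
      fix i j assume "i < dim_row X" "j < dim_col X"
      then have ij: "i < N" "j < N" by (auto simp: X_def)
      have "(H * Km * transpose_mat G) $$ (i, j) =
          (\<Sum>l\<in>{0..<N}. (\<lambda>d. fold_coeff tD (g j) d * fold_row tU (\<lambda>u. K u d) (f i)) (g l))"
        using ij unfolding HK by (simp add: scalar_prod_def G_def mult.commute)
      also have "\<dots> = (\<Sum>d\<in>D. fold_coeff tD (g j) d * fold_row tU (\<lambda>u. K u d) (f i))"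
        by (rule sum.reindex_bij_betw[OF g])
      also have "\<dots> = folded (f i) (g j)"
        unfolding folded_def by (rule sum_fold_coeff[OF fin(2) mirD fU(2)[OF ij(2)]])
      finally show "(H * Km * transpose_mat G) $$ (i, j) = X $$ (i, j)" using ij by (simp add: X_def)
    qed (simp_all add: H_def Km_def G_def X_def)
    have "det X = det H * det Km * det G"
      unfolding HKG[symmetric] using carr by (simp add: det_mult[of _ N] det_transpose[of _ N])
    then have "(det X)\<^sup>2 = (det H)\<^sup>2 * (det Km)\<^sup>2 * (det G)\<^sup>2" by (simp add: power_mult_distrib)
    also have "(det H)\<^sup>2 = 2 ^ card {u \<in> U. fst u \<noteq> - 1}"
      unfolding H_def by (rule det_fold_square[OF fin(1) mirU f]) (simp_all add: tU2)
    also have "(det G)\<^sup>2 = 2 ^ card {u \<in> D. fst u \<noteq> - 1}"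
      unfolding G_def by (rule det_fold_square[OF fin(2) mirD g]) (simp_all add: tD2)
    also have "(det Km)\<^sup>2 = (per U D (\<lambda>_. 1))\<^sup>2"
      using abs_det_kasteleyn[OF fin lat f g, of "\<lambda>_. 1"] unfolding Km_def by (simp add: power2_eq_iff abs_eq_iff)
    finally have dX: "(det X)\<^sup>2 =
      2 ^ card {u \<in> U. fst u \<noteq> - 1} * (per U D (\<lambda>_. 1))\<^sup>2 * 2 ^ card {u \<in> D. fst u \<noteq> - 1}" .
    have dX': "(det X)\<^sup>2 = 2 ^ (N + N) * (per U1 D1 axis_weight * per U2 D2 axis_weight)\<^sup>2"
    proof (cases "n = m")
      case True
      have m: "m = n" using True by simp
      define X1 where "X1 = mat n n (\<lambda>(i, j). 2 * KW (f i) (g j))"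
      define X2 where "X2 = mat (N - n) (N - n)
        (\<lambda>(i, j). 2 * KW (fold_pt (f (n + i))) (fold_pt (g (n + j))))"
      have fp: "fold_pt v = v" if "side t v" for v :: point and t :: "point \<Rightarrow> real"
        using that by (auto simp: fold_pt_def)
      have "X = four_block_mat X1 (0\<^sub>m n (N - n)) (0\<^sub>m (N - n) n) X2"
      proof (rule eq_matI)
        fix i j
        assume "i < dim_row (four_block_mat X1 (0\<^sub>m n (N - n)) (0\<^sub>m (N - n) n) X2)"
          "j < dim_col (four_block_mat X1 (0\<^sub>m n (N - n)) (0\<^sub>m (N - n) n) X2)"
        then have ij: "i < N" "j < N" using nN by (auto simp: X1_def X2_def)
        have "folded (f i) (g j) = (if i < n \<longleftrightarrow> j < n then 2 * KW (fold_pt (f i)) (fold_pt (g j)) else 0)"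
          unfolding folded_eq[OF fU(1)[OF ij(1)] fU(2)[OF ij(2)]] fside[OF ij(1)] gside[OF ij(2)] m ..
        moreover have "fold_pt (f i) = f i" if "i < n" using fside[OF ij(1)] that fp by blast
        moreover have "fold_pt (g j) = g j" if "j < n" using gside[OF ij(2)] that fp m by blast
        ultimately show "X $$ (i, j) = four_block_mat X1 (0\<^sub>m n (N - n)) (0\<^sub>m (N - n) n) X2 $$ (i, j)"
          using ij by (auto simp: X_def X1_def X2_def)
      qed (use nN in \<open>auto simp: X_def X1_def X2_def\<close>)
      then have "det X = det X1 * det X2"
        by (simp only:) (rule det_four_block_mat_lower_left_zero[of X1 n _ "N - n" _ X2],
            auto simp: X1_def X2_def)
      then have "\<bar>det X\<bar> = \<bar>det X1\<bar> * \<bar>det X2\<bar>" by (simp add: abs_mult)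
      also have "\<bar>det X1\<bar> = 2 ^ n * \<bar>per U1 D1 axis_weight\<bar>"
        unfolding X1_def U1_def D1_def by (rule abs_det_half) (use f1 g1 m U1_def D1_def in auto)
      also have "\<bar>det X2\<bar> = 2 ^ (N - n) * \<bar>per U2 D2 axis_weight\<bar>"
        unfolding X2_def U2_def D2_def
        by (rule abs_det_half)
          (use bij_betw_trans[OF f2 bU] bij_betw_trans[OF g2 bD] nN m U2_def D2_def in \<open>auto simp: comp_def\<close>)
      also have "2 ^ n * \<bar>per U1 D1 axis_weight\<bar> * (2 ^ (N - n) * \<bar>per U2 D2 axis_weight\<bar>) =
          \<bar>2 ^ N * (per U1 D1 axis_weight * per U2 D2 axis_weight)\<bar>"
        using nN power_add[of "2::real" n "N - n"] by (simp add: abs_mult)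
      finally have "(det X)\<^sup>2 = (2 ^ N * (per U1 D1 axis_weight * per U2 D2 axis_weight))\<^sup>2"
        by (simp only: power2_eq_iff abs_eq_iff)
      then show ?thesis by (simp add: power_mult_distrib power_add power2_eq_square)
    next
      case False
      \<comment> \<open>With blocks of different shapes one of the two zero blocks is too large for
        a nonzero determinant; correspondingly the unbalanced first half has no matching.\<close>
      have "det X = 0"
      proof (cases "m < n")
        case True
        show ?thesis
        proof (rule det_zero_block[OF carr(4), of "{0..<n}" "{m..<N}"])
          fix i j assume ij: "i \<in> {0..<n}" "j \<in> {m..<N}"
          then have ij': "i < N" "j < N" using nN by auto
          show "X $$ (i, j) = 0"
            using ij ij' folded_eq[OF fU(1)[OF ij'(1)] fU(2)[OF ij'(2)]] fside[OF ij'(1)] gside[OF ij'(2)]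
            by (simp add: X_def)
        qed (use True nN in auto)
      next
        case False
        show ?thesis
        proof (rule det_zero_block[OF carr(4), of "{n..<N}" "{0..<m}"])
          fix i j assume ij: "i \<in> {n..<N}" "j \<in> {0..<m}"
          then have ij': "i < N" "j < N" using nN by auto
          show "X $$ (i, j) = 0"
            using ij ij' folded_eq[OF fU(1)[OF ij'(1)] fU(2)[OF ij'(2)]] fside[OF ij'(1)] gside[OF ij'(2)]
            by (simp add: X_def)
        qed (use False \<open>n \<noteq> m\<close> nN in auto)
      qed
      moreover have "per U1 D1 axis_weight = 0"
        using False by (intro per_card_neq) (simp add: n_def m_def)
      ultimately show ?thesis by simp
    qed
    have split: "card {u \<in> A. fst u = - 1} + card {u \<in> A. fst u \<noteq> - 1} = card A" if "finite A" for A :: "point set"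
    proof -
      have "A = {u \<in> A. fst u = - 1} \<union> {u \<in> A. fst u \<noteq> - 1}" by auto
      then show ?thesis using card_Un_disjoint[of "{u \<in> A. fst u = - 1}" "{u \<in> A. fst u \<noteq> - 1}"] that
        by fastforce
    qed
    define i j k l where "i = card {u \<in> U. fst u = - 1}" and "j = card {u \<in> U. fst u \<noteq> - 1}"
      and "k = card {u \<in> D. fst u = - 1}" and "l = card {u \<in> D. fst u \<noteq> - 1}"
    have "N = i + j" "N = k + l"
      using split[OF fin(1)] split[OF fin(2)] True by (simp_all add: N_def i_def j_def k_def l_def)
    \<comment> \<open>The factors belonging to triangles off the axis cancel against the squared
      determinants of \<open>H\<close> and \<open>G\<close>; the axis triangles keep theirs.\<close>
    then have "2 ^ (N + N) = 2 ^ (i + k) * (2 ^ j * 2 ^ l :: real)"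
      by (simp flip: power_add)
    then have "2 ^ j * 2 ^ l * (per U D (\<lambda>_. 1))\<^sup>2 =
        2 ^ j * 2 ^ l * (2 ^ (i + k) * (per U1 D1 axis_weight * per U2 D2 axis_weight)\<^sup>2)"
      using dX dX' unfolding i_def j_def k_def l_def by (simp add: ac_simps)
    then show ?thesis unfolding i_def k_def by simp
  qed
qed

corollary per_factorization:
  assumes "card {u \<in> U. fst u = - 1} + card {d \<in> D. fst d = - 1} = 2 * w"
  shows "per U D (\<lambda>_. 1) = 2 ^ w * per U1 D1 axis_weight * per U2 D2 axis_weight"
proof -
  have "(per U D (\<lambda>_. 1))\<^sup>2 = (2 ^ w * per U1 D1 axis_weight * per U2 D2 axis_weight)\<^sup>2"
    unfolding per_square_factorization assms
    by (simp add: power_mult_distrib power_mult flip: power_even_eq)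
  moreover have "0 \<le> per U D (\<lambda>_. 1)" "0 \<le> per U1 D1 axis_weight" "0 \<le> per U2 D2 axis_weight"
    by (auto intro: per_nonneg simp: axis_weight_def)
  ultimately show ?thesis by (simp add: power2_eq_iff_nonneg)
qed

end

section \<open>Forced strips\<close>

lemma per_cong:
  assumes "\<And>u. u \<in> U \<Longrightarrow> u \<in> D \<Longrightarrow> w u = w' u"
  shows "per U D w = per U D w'"
  unfolding per_def
proof (intro sum.cong prod.cong refl)
  fix \<pi> u assume "\<pi> \<in> matchings U D" "u \<in> U"
  then have "\<pi> u \<in> D" by (auto simp: matchings_def bij_betw_def)
  then show "(if \<pi> u = u then w u else 1) = (if \<pi> u = u then w' u else 1)"
    using assms[of u] \<open>u \<in> U\<close> by auto
qed

definition shift :: "int \<Rightarrow> point \<Rightarrow> point" where "shift a u = (fst u + a, snd u)"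

lemma shift_shift [simp]: "shift a (shift b u) = shift (a + b) u"
  by (simp add: shift_def)

lemma shift_0 [simp]: "shift 0 u = u"
  by (simp add: shift_def)

lemma shift_eq_iff [simp]: "shift a u = shift a v \<longleftrightarrow> u = v"
  by (auto simp: shift_def prod_eq_iff)

lemma adj_shift [simp]: "adj (shift a u) (shift a d) \<longleftrightarrow> adj u d"
  by (auto simp: adj_def shift_def prod_eq_iff)

lemma per_shift:
  "per (shift a ` U) (shift a ` D) w = per U D (\<lambda>u. w (shift a u))"
proof -
  define \<Phi> where "\<Phi> \<pi> = restrict (shift a \<circ> \<pi> \<circ> shift (- a)) (shift a ` U)" for \<pi>
  define \<Psi> where "\<Psi> \<pi> = restrict (shift (- a) \<circ> \<pi> \<circ> shift a) U" for \<pi>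
  have inj: "inj_on (shift b) X" for b X by (simp add: inj_on_def)
  have bij: "bij_betw (shift b) X (shift b ` X)" for b X using inj by (simp add: bij_betw_def)
  have bij': "bij_betw (shift (- a)) (shift a ` X) X" for X
    using bij[of "- a" "shift a ` X"] by (simp add: image_image)
  have "bij_betw \<Phi> (matchings U D) (matchings (shift a ` U) (shift a ` D))"
  proof (rule bij_betw_byWitness[where f' = \<Psi>])
    show "\<forall>\<pi>\<in>matchings U D. \<Psi> (\<Phi> \<pi>) = \<pi>"
    proof
      fix \<pi> assume "\<pi> \<in> matchings U D"
      then have "\<pi> \<in> extensional U" by (simp add: matchings_def)
      then show "\<Psi> (\<Phi> \<pi>) = \<pi>"
        by (intro extensionalityI[of _ U]) (auto simp: \<Psi>_def \<Phi>_def)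
    qed
    show "\<forall>\<pi>\<in>matchings (shift a ` U) (shift a ` D). \<Phi> (\<Psi> \<pi>) = \<pi>"
    proof
      fix \<pi> assume "\<pi> \<in> matchings (shift a ` U) (shift a ` D)"
      then have "\<pi> \<in> extensional (shift a ` U)" by (simp add: matchings_def)
      then show "\<Phi> (\<Psi> \<pi>) = \<pi>"
        by (intro extensionalityI[of _ "shift a ` U"]) (auto simp: \<Psi>_def \<Phi>_def)
    qed
    show "\<Phi> ` matchings U D \<subseteq> matchings (shift a ` U) (shift a ` D)"
    proof (rule image_subsetI)
      fix \<pi> assume "\<pi> \<in> matchings U D"
      then have m: "bij_betw \<pi> U D" "\<And>u. u \<in> U \<Longrightarrow> adj u (\<pi> u)" by (auto simp: matchings_def)
      have "bij_betw (shift a \<circ> \<pi> \<circ> shift (- a)) (shift a ` U) (shift a ` D)"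
        using bij_betw_trans[OF bij_betw_trans[OF bij' m(1)] bij] by (simp add: comp_assoc)
      then have "bij_betw (\<Phi> \<pi>) (shift a ` U) (shift a ` D)"
        by (rule bij_betw_cong[THEN iffD1, rotated]) (simp add: \<Phi>_def)
      then show "\<Phi> \<pi> \<in> matchings (shift a ` U) (shift a ` D)"
        using m(2) by (auto simp: matchings_def \<Phi>_def)
    qed
    show "\<Psi> ` matchings (shift a ` U) (shift a ` D) \<subseteq> matchings U D"
    proof (rule image_subsetI)
      fix \<pi> assume "\<pi> \<in> matchings (shift a ` U) (shift a ` D)"
      then have m: "bij_betw \<pi> (shift a ` U) (shift a ` D)"
        "\<And>u. u \<in> U \<Longrightarrow> adj (shift a u) (\<pi> (shift a u))" by (auto simp: matchings_def)
      have "bij_betw (shift (- a) \<circ> \<pi> \<circ> shift a) U D"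
        using bij_betw_trans[OF bij_betw_trans[OF bij m(1)] bij'] by (simp add: comp_assoc)
      then have "bij_betw (\<Psi> \<pi>) U D"
        by (rule bij_betw_cong[THEN iffD1, rotated]) (simp add: \<Psi>_def)
      moreover have "adj u (\<Psi> \<pi> u)" if "u \<in> U" for u
      proof -
        have "adj (shift (- a) (shift a u)) (shift (- a) (\<pi> (shift a u)))"
          using m(2)[OF that] by (simp only: adj_shift)
        then show ?thesis using that by (simp add: \<Psi>_def)
      qed
      ultimately show "\<Psi> \<pi> \<in> matchings U D"
        by (auto simp: matchings_def \<Psi>_def)
    qed
  qed
  then have "per (shift a ` U) (shift a ` D) w =
      (\<Sum>\<pi>\<in>matchings U D. \<Prod>u\<in>shift a ` U. if \<Phi> \<pi> u = u then w u else 1)"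
    unfolding per_def by (simp add: sum.reindex_bij_betw[symmetric])
  also have "\<dots> = per U D (\<lambda>u. w (shift a u))"
    unfolding per_def by (intro sum.cong refl) (simp add: prod.reindex inj \<Phi>_def)
  finally show ?thesis .
qed

text \<open>The forced lozenges are not vertical, hence have weight 1 and can be deleted without
  leaving a factor.\<close>

lemma per_forced:
  assumes fin: "finite U" and F: "F \<subseteq> U" "\<phi> ` F \<subseteq> D" "inj_on \<phi> F"
    and adj: "\<And>u. u \<in> F \<Longrightarrow> adj u (\<phi> u) \<and> \<phi> u \<noteq> u"
    and forced: "\<And>\<pi> u. \<pi> \<in> matchings U D \<Longrightarrow> u \<in> F \<Longrightarrow> \<pi> u = \<phi> u"
  shows "per U D w = per (U - F) (D - \<phi> ` F) w"
proof -
  define \<Psi> where "\<Psi> \<pi> u = (if u \<in> F then \<phi> u else \<pi> u)" for \<pi> u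
  have "bij_betw (\<lambda>\<pi>. restrict \<pi> (U - F)) (matchings U D) (matchings (U - F) (D - \<phi> ` F))"
  proof (rule bij_betw_byWitness[where f' = \<Psi>])
    show "\<forall>\<pi>\<in>matchings U D. \<Psi> (restrict \<pi> (U - F)) = \<pi>"
    proof
      fix \<pi> assume \<pi>: "\<pi> \<in> matchings U D"
      have "\<Psi> (restrict \<pi> (U - F)) u = \<pi> u" for u
      proof (cases "u \<in> F")
        case True then show ?thesis using forced[OF \<pi>, of u] by (simp add: \<Psi>_def)
      next
        case False
        have "u \<notin> U \<Longrightarrow> \<pi> u = undefined"
          using \<pi> extensional_arb[of \<pi> U u] by (simp add: matchings_def)
        then show ?thesis using False by (simp add: \<Psi>_def)
      qed
      then show "\<Psi> (restrict \<pi> (U - F)) = \<pi>" ..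
    qed
    show "\<forall>\<pi>\<in>matchings (U - F) (D - \<phi> ` F). restrict (\<Psi> \<pi>) (U - F) = \<pi>"
    proof
      fix \<pi> assume "\<pi> \<in> matchings (U - F) (D - \<phi> ` F)"
      then have "\<pi> \<in> extensional (U - F)" by (simp add: matchings_def)
      then show "restrict (\<Psi> \<pi>) (U - F) = \<pi>"
        by (intro extensionalityI[of _ "U - F"]) (auto simp: \<Psi>_def)
    qed
    show "(\<lambda>\<pi>. restrict \<pi> (U - F)) ` matchings U D \<subseteq> matchings (U - F) (D - \<phi> ` F)"
    proof (rule image_subsetI)
      fix \<pi> assume \<pi>: "\<pi> \<in> matchings U D"
      then have b: "bij_betw \<pi> U D" "\<And>u. u \<in> U \<Longrightarrow> adj u (\<pi> u)" by (auto simp: matchings_def)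
      have "\<pi> ` F = \<phi> ` F" using forced[OF \<pi>] by (intro image_cong) auto
      then have "\<pi> ` (U - F) = D - \<phi> ` F"
        using b(1) F(1) by (simp add: bij_betw_def inj_on_image_set_diff[of \<pi> U])
      then have "bij_betw \<pi> (U - F) (D - \<phi> ` F)"
        using b(1) by (auto simp: bij_betw_def intro: inj_on_subset)
      then have "bij_betw (restrict \<pi> (U - F)) (U - F) (D - \<phi> ` F)"
        by (rule bij_betw_cong[THEN iffD1, rotated]) simp
      then show "restrict \<pi> (U - F) \<in> matchings (U - F) (D - \<phi> ` F)"
        using b(2) by (auto simp: matchings_def)
    qed
    show "\<Psi> ` matchings (U - F) (D - \<phi> ` F) \<subseteq> matchings U D"
    proof (rule image_subsetI)
      fix \<pi> assume \<pi>: "\<pi> \<in> matchings (U - F) (D - \<phi> ` F)"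
      then have b: "bij_betw \<pi> (U - F) (D - \<phi> ` F)" "\<And>u. u \<in> U - F \<Longrightarrow> adj u (\<pi> u)"
        "\<pi> \<in> extensional (U - F)" by (auto simp: matchings_def)
      have "bij_betw (\<Psi> \<pi>) (U - F) (D - \<phi> ` F)"
        using b(1) by (rule bij_betw_cong[THEN iffD1, rotated]) (simp add: \<Psi>_def)
      moreover have "bij_betw (\<Psi> \<pi>) F (\<phi> ` F)"
        using F(3) by (intro bij_betw_cong[THEN iffD1, OF _ inj_on_imp_bij_betw]) (simp_all add: \<Psi>_def)
      ultimately have "bij_betw (\<Psi> \<pi>) ((U - F) \<union> F) ((D - \<phi> ` F) \<union> \<phi> ` F)"
        by (rule bij_betw_combine) auto
      then have "bij_betw (\<Psi> \<pi>) U D" using F(1,2) by (simp add: Un_absorb2)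
      moreover have "\<Psi> \<pi> \<in> extensional U"
        using b(3) F(1) by (auto simp: \<Psi>_def extensional_def)
      ultimately show "\<Psi> \<pi> \<in> matchings U D"
        using b(2) adj by (auto simp: matchings_def \<Psi>_def)
    qed
  qed
  then have "per (U - F) (D - \<phi> ` F) w =
      (\<Sum>\<pi>\<in>matchings U D. \<Prod>u\<in>U - F. if restrict \<pi> (U - F) u = u then w u else 1)"
    unfolding per_def by (simp add: sum.reindex_bij_betw[symmetric])
  also have "\<dots> = per U D w"
    unfolding per_def
  proof (rule sum.cong[OF refl])
    fix \<pi> assume \<pi>: "\<pi> \<in> matchings U D"
    have "(\<Prod>u\<in>U. if \<pi> u = u then w u else 1) = (\<Prod>u\<in>U - F. if \<pi> u = u then w u else 1)"
      using forced[OF \<pi>] adj by (intro prod.mono_neutral_right fin) auto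
    also have "\<dots> = (\<Prod>u\<in>U - F. if restrict \<pi> (U - F) u = u then w u else 1)"
      by (intro prod.cong refl) simp
    finally show "(\<Prod>u\<in>U - F. if restrict \<pi> (U - F) u = u then w u else 1) =
        (\<Prod>u\<in>U. if \<pi> u = u then w u else 1)" ..
  qed
  finally show ?thesis ..
qed

lemma sum_le_eq_imp_eq:
  fixes f g :: "'a \<Rightarrow> int"
  assumes "finite A" "\<And>x. x \<in> A \<Longrightarrow> f x \<le> g x" "sum f A = sum g A" "x \<in> A"
  shows "f x = g x"
proof (rule ccontr)
  assume "f x \<noteq> g x"
  then have "f x < g x" using assms(2)[OF assms(4)] by simp
  then have "sum f A < sum g A"
    using assms(1,2,4) by (intro sum_strict_mono_ex1) auto
  then show False using assms by simp
qed

text \<open>The triangles of the top strip must be matched within the strip. Each lozenge contributes at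
  most 1 to the difference of the sums of the positions of its two kinds of triangles, and this
  difference is the number of lozenges, so that every lozenge leans in the same direction.\<close>

lemma per_forced_top:
  assumes fin: "finite U" and top: "\<And>u. u \<in> U \<Longrightarrow> snd u \<le> t"
    and alt: "\<And>p. (p, t) \<in> U \<longleftrightarrow> (p - 1, t + 1) \<in> D"
  shows "per U D w = per {u \<in> U. snd u \<noteq> t} {d \<in> D. snd d \<noteq> t + 1} w"
proof -
  define F where "F = {u \<in> U. snd u = t}"
  define \<phi> where "\<phi> = (\<lambda>u :: point. (fst u - 1, snd u + 1))"
  have inj: "inj_on \<phi> F" by (auto simp: inj_on_def \<phi>_def prod_eq_iff)
  have im: "\<phi> ` F = {d \<in> D. snd d = t + 1}"
  proof (intro subset_antisym subsetI)
    fix d assume d: "d \<in> {d \<in> D. snd d = t + 1}"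
    then have "(fst d + 1, t) \<in> U" using alt[of "fst d + 1"] by (cases d) auto
    then show "d \<in> \<phi> ` F" using d by (intro image_eqI[of _ _ "(fst d + 1, t)"]) (auto simp: \<phi>_def F_def prod_eq_iff)
  next
    fix d assume "d \<in> \<phi> ` F"
    then obtain u where u: "u \<in> F" "d = \<phi> u" by blast
    then have "(fst u, t) \<in> U" by (cases u) (auto simp: F_def)
    then show "d \<in> {d \<in> D. snd d = t + 1}" using alt[of "fst u"] u by (simp add: \<phi>_def F_def)
  qed
  have forced: "\<pi> u = \<phi> u" if \<pi>: "\<pi> \<in> matchings U D" and u: "u \<in> F" for \<pi> u
  proof -
    have bij: "bij_betw \<pi> U D" using \<pi> by (simp add: matchings_def)
    define G where "G = {u \<in> U. \<pi> u \<in> \<phi> ` F}"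
    have "\<pi> ` G = \<phi> ` F" using bij im by (auto simp: G_def bij_betw_def)
    moreover have injG: "inj_on \<pi> G" using bij by (auto simp: G_def bij_betw_def intro: inj_on_subset)
    ultimately have bG: "bij_betw \<pi> G (\<phi> ` F)" by (simp add: bij_betw_def)
    have finF: "finite F" "finite G" using fin by (simp_all add: F_def G_def)
    have "v \<in> F" if "v \<in> G" for v
    proof -
      have "v \<in> U" "snd (\<pi> v) = t + 1" using that im by (auto simp: G_def)
      moreover from this have "\<pi> v \<noteq> v" using top[of v] by auto
      ultimately show ?thesis using matching_step(1)[OF \<pi>, of v] by (simp add: F_def)
    qed
    then have "G = F"
      using bij_betw_same_card[OF bG] card_image[OF inj] finF by (intro card_subset_eq) auto
    then have bF: "bij_betw \<pi> F (\<phi> ` F)" using bG by simp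
    have sum: "(\<Sum>v\<in>F. fst (\<phi> v)) = (\<Sum>v\<in>F. fst (\<pi> v))"
      using sum.reindex_bij_betw[OF bF, of fst] sum.reindex[OF inj, of fst] by simp
    have step: "snd (\<pi> v) = t + 1" "fst (\<phi> v) \<le> fst (\<pi> v)" if "v \<in> F" for v
    proof -
      have "\<pi> v \<in> \<phi> ` F" using bF that by (auto simp: bij_betw_def)
      then show s: "snd (\<pi> v) = t + 1" using im by auto
      then have "\<pi> v \<noteq> v" "v \<in> U" using that by (auto simp: F_def)
      then show "fst (\<phi> v) \<le> fst (\<pi> v)" using matching_step(2)[OF \<pi>, of v] by (auto simp: \<phi>_def)
    qed
    have "fst (\<phi> u) = fst (\<pi> u)"
      by (rule sum_le_eq_imp_eq[OF finF(1) step(2) sum u])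
    then show ?thesis using step(1)[OF u] u by (simp add: prod_eq_iff \<phi>_def F_def)
  qed
  have "per U D w = per (U - F) (D - \<phi> ` F) w"
  proof (rule per_forced[OF fin _ _ inj])
    show "\<pi> u = \<phi> u" if "\<pi> \<in> matchings U D" "u \<in> F" for \<pi> u by (rule forced[OF that])
    show "adj u (\<phi> u) \<and> \<phi> u \<noteq> u" for u by (auto simp: adj_def \<phi>_def prod_eq_iff)
    show "\<phi> ` F \<subseteq> D" using im by blast
  qed (auto simp: F_def)
  moreover have "U - F = {u \<in> U. snd u \<noteq> t}" "D - \<phi> ` F = {d \<in> D. snd d \<noteq> t + 1}"
    unfolding im by (auto simp: F_def)
  ultimately show ?thesis by simp
qed

text \<open>Here the up-pointing triangles cannot leave the strip, as level \<open>t\<close> carries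
  no down-pointing ones. The comparison of positions runs the other way, and every lozenge leans to
  the right.\<close>

lemma per_forced_bottom:
  assumes fin: "finite U" and bottom: "\<And>d. d \<in> D \<Longrightarrow> t < snd d"
    and alt: "\<And>p. (p, t) \<in> U \<longleftrightarrow> (p + 1, t + 1) \<in> D"
  shows "per U D w = per {u \<in> U. snd u \<noteq> t} {d \<in> D. snd d \<noteq> t + 1} w"
proof -
  define F where "F = {u \<in> U. snd u = t}"
  define \<phi> where "\<phi> = (\<lambda>u :: point. (fst u + 1, snd u + 1))"
  have inj: "inj_on \<phi> F" by (auto simp: inj_on_def \<phi>_def prod_eq_iff)
  have im: "\<phi> ` F = {d \<in> D. snd d = t + 1}"
  proof (intro subset_antisym subsetI)
    fix d assume d: "d \<in> {d \<in> D. snd d = t + 1}"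
    then have "(fst d - 1, t) \<in> U" using alt[of "fst d - 1"] by (cases d) auto
    then show "d \<in> \<phi> ` F" using d by (intro image_eqI[of _ _ "(fst d - 1, t)"]) (auto simp: \<phi>_def F_def prod_eq_iff)
  next
    fix d assume "d \<in> \<phi> ` F"
    then obtain u where u: "u \<in> F" "d = \<phi> u" by blast
    then have "(fst u, t) \<in> U" by (cases u) (auto simp: F_def)
    then show "d \<in> {d \<in> D. snd d = t + 1}" using alt[of "fst u"] u by (simp add: \<phi>_def F_def)
  qed
  have forced: "\<pi> u = \<phi> u" if \<pi>: "\<pi> \<in> matchings U D" and u: "u \<in> F" for \<pi> u
  proof -
    have bij: "bij_betw \<pi> U D" using \<pi> by (simp add: matchings_def)
    have finF: "finite F" using fin by (simp add: F_def)
    have step: "snd (\<pi> v) = t + 1" "fst (\<pi> v) \<le> fst (\<phi> v)" if "v \<in> F" for v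
    proof -
      have v: "v \<in> U" "snd v = t" using that by (auto simp: F_def)
      then have "\<pi> v \<in> D" using bij by (auto simp: bij_betw_def)
      then have "\<pi> v \<noteq> v" using bottom[of "\<pi> v"] v(2) by auto
      then show "snd (\<pi> v) = t + 1" "fst (\<pi> v) \<le> fst (\<phi> v)"
        using matching_step[OF \<pi> v(1)] v by (auto simp: \<phi>_def)
    qed
    have injF: "inj_on \<pi> F" using bij by (auto simp: F_def bij_betw_def intro: inj_on_subset)
    have "\<pi> ` F \<subseteq> \<phi> ` F"
      using step(1) bij unfolding im by (auto simp: F_def bij_betw_def)
    then have "\<pi> ` F = \<phi> ` F"
      using finF card_image[OF inj] card_image[OF injF] by (intro card_subset_eq) auto
    then have sum: "(\<Sum>v\<in>F. fst (\<pi> v)) = (\<Sum>v\<in>F. fst (\<phi> v))"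
      using sum.reindex[OF injF, of fst] sum.reindex[OF inj, of fst] by simp
    have "fst (\<pi> u) = fst (\<phi> u)"
      by (rule sum_le_eq_imp_eq[OF finF step(2) sum u])
    then show ?thesis using step(1)[OF u] u by (simp add: prod_eq_iff \<phi>_def F_def)
  qed
  have "per U D w = per (U - F) (D - \<phi> ` F) w"
  proof (rule per_forced[OF fin _ _ inj])
    show "\<pi> u = \<phi> u" if "\<pi> \<in> matchings U D" "u \<in> F" for \<pi> u by (rule forced[OF that])
    show "adj u (\<phi> u) \<and> \<phi> u \<noteq> u" for u by (auto simp: adj_def \<phi>_def prod_eq_iff)
    show "\<phi> ` F \<subseteq> D" using im by blast
  qed (auto simp: F_def)
  moreover have "U - F = {u \<in> U. snd u \<noteq> t}" "D - \<phi> ` F = {d \<in> D. snd d \<noteq> t + 1}"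
    unfolding im by (auto simp: F_def)
  ultimately show ?thesis by simp
qed

section \<open>Symmetric hexagons with holes along a line\<close>

lemma UP_subset: "UP (p, k) \<subseteq> P \<longleftrightarrow> (p, k) \<in> P \<and> (p + 2, k) \<in> P \<and> (p + 1, k + 1) \<in> P"
  by (simp add: UP_def up_tri_def)

lemma DN_subset: "DN (p, k) \<subseteq> P \<longleftrightarrow> (p, k) \<in> P \<and> (p + 2, k) \<in> P \<and> (p + 1, k - 1) \<in> P"
  by (simp add: DN_def down_tri_def)

lemma UP_lattice: "UP (p, k) \<subseteq> Defs.lattice c \<longleftrightarrow> even (p - k - c)"
  by (simp add: UP_subset Defs.lattice_def)

lemma DN_lattice: "DN (p, k) \<subseteq> Defs.lattice c \<longleftrightarrow> even (p - k - c)"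
  by (simp add: DN_subset Defs.lattice_def)

lemma mirror_mirror [simp]: "mirror (mirror P) = P"
  by (force simp: mirror_def image_iff)

lemma mem_mirror: "(p, k) \<in> mirror P \<longleftrightarrow> (- p, k) \<in> P"
  by (force simp: mirror_def image_iff)

lemma mirror_subset_iff: "mirror P \<subseteq> Q \<longleftrightarrow> P \<subseteq> mirror Q"
  by (force simp: mirror_def image_iff)

lemma UP_mirror_pt: "UP (mirror_pt u) = mirror (UP u)"
  by (cases u) (auto simp: UP_def up_tri_def mirror_def mirror_pt_def)

lemma DN_mirror_pt: "DN (mirror_pt u) = mirror (DN u)"
  by (cases u) (auto simp: DN_def down_tri_def mirror_def mirror_pt_def)

text \<open>A lattice point has the parity of its level, and so has the value of the zigzag there.
  Where the zigzag takes its larger value, no lattice point sits at the smaller one; on lattice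
  points it acts like a vertical line at the smaller value.\<close>

lemma zigzag_le_iff:
  assumes "even e" "odd d" "\<bar>e - d\<bar> = 1" "even (q - k)"
  shows "zigzag e d k \<le> q \<longleftrightarrow> min e d \<le> q"
  using assms by (cases "even k") (auto simp: zigzag_def min_def; presburger)+

text \<open>\<open>H\<close> and \<open>G\<close> are the extents above and below the line k = 0,
  which runs \<open>z\<close> levels above the east and west vertices. \<open>Hs\<close> lists the
  holes right of the axis. A hole of nonzero side is shorter than its part of the hexagon and so
  avoids the outermost strip, which the forcing argument uses.\<close>

locale holed_hexagon =
  fixes W z H G :: int and a1 :: nat and Hs :: "(bool \<times> int \<times> nat) set"
  assumes z: "0 \<le> z" and H: "0 \<le> H" "H \<le> W"
    and G: "2 * z \<le> G" "int a1 \<le> G" "G \<le> W + 2 * z"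
    and par: "even (W + int a1)"
    and holes: "\<And>b r n. (b, r, n) \<in> Hs \<Longrightarrow> 0 \<le> r \<and> (n \<noteq> 0 \<longrightarrow> int n < (if b then H else G))"
begin

definition hex :: "point set" where
  "hex = {(p, k). - G \<le> k \<and> k \<le> H \<and> \<bar>p\<bar> \<le> W + z - \<bar>k + z\<bar>}"

definition reg :: "(point \<Rightarrow> triangle) \<Rightarrow> point set" where
  "reg f = {u. f u \<subseteq> Defs.lattice W \<and> f u \<subseteq> hex \<and> \<not> f u \<subseteq> side_tri False (- int a1) a1 \<and>
    (\<forall>(b, r, n)\<in>Hs. \<not> f u \<subseteq> side_tri b r n \<and> \<not> f u \<subseteq> mirror (side_tri b r n))}"

definition right_free :: "(point \<Rightarrow> triangle) \<Rightarrow> point \<Rightarrow> bool" where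
  "right_free f u \<longleftrightarrow> (\<forall>(b, r, n)\<in>Hs. \<not> f u \<subseteq> side_tri b r n)"

text \<open>A triangle with \<open>- 1 \<le> p\<close> has a vertex strictly to the right of the
  axis. Hence no mirrored hole contains it, and each symmetric constraint reduces to its right-hand
  half.\<close>

lemma mem_reg_UP:
  assumes p: "- 1 \<le> p"
  shows "(p, k) \<in> reg UP \<longleftrightarrow> even (p - k - W) \<and> - G \<le> k \<and> k < H \<and> p + 2 \<le> W - k \<and>
    p + 2 \<le> W + 2 * z + k \<and> \<not> (k < 0 \<and> p + 2 \<le> int a1 + k) \<and> right_free UP (p, k)"
proof -
  have 1: "UP (p, k) \<subseteq> hex \<longleftrightarrow> - G \<le> k \<and> k < H \<and> p + 2 \<le> W - k \<and> p + 2 \<le> W + 2 * z + k"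
    using p by (auto simp: UP_subset hex_def abs_le_iff abs_if split: if_splits)
  have 2: "UP (p, k) \<subseteq> side_tri False (- int a1) a1 \<longleftrightarrow> k < 0 \<and> p + 2 \<le> int a1 + k"
    using p by (auto simp: UP_subset side_tri_def)
  have 3: "\<not> UP (p, k) \<subseteq> mirror (side_tri b r n)" if "(b, r, n) \<in> Hs" for b r n
    using holes[OF that] p by (auto simp: UP_subset mem_mirror side_tri_def)
  show ?thesis unfolding reg_def right_free_def mem_Collect_eq UP_lattice 1 2 using 3 by blast
qed

lemma mem_reg_DN:
  assumes p: "- 1 \<le> p"
  shows "(p, k) \<in> reg DN \<longleftrightarrow> even (p - k - W) \<and> - G < k \<and> k \<le> H \<and> p + 2 \<le> W - k \<and>
    p + 2 \<le> W + 2 * z + k \<and> \<not> (k \<le> 0 \<and> p + 2 \<le> int a1 + k) \<and> right_free DN (p, k)"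
proof -
  have 1: "DN (p, k) \<subseteq> hex \<longleftrightarrow> - G < k \<and> k \<le> H \<and> p + 2 \<le> W - k \<and> p + 2 \<le> W + 2 * z + k"
    using p by (auto simp: DN_subset hex_def abs_le_iff abs_if split: if_splits)
  have 2: "DN (p, k) \<subseteq> side_tri False (- int a1) a1 \<longleftrightarrow> k \<le> 0 \<and> p + 2 \<le> int a1 + k"
    using p by (auto simp: DN_subset side_tri_def)
  have 3: "\<not> DN (p, k) \<subseteq> mirror (side_tri b r n)" if "(b, r, n) \<in> Hs" for b r n
    using holes[OF that] p by (auto simp: DN_subset mem_mirror side_tri_def)
  show ?thesis unfolding reg_def right_free_def mem_Collect_eq DN_lattice 1 2 using 3 by blast
qed

lemma right_freeI:
  "(\<And>b r n. (b, r, n) \<in> Hs \<Longrightarrow> \<not> f u \<subseteq> side_tri b r n) \<Longrightarrow> right_free f u"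
  unfolding right_free_def by (simp add: case_prod_beta)

lemma right_free_axis:
  assumes "p < 0"
  shows "right_free UP (p, k)" "right_free DN (p, k)"
proof -
  have "(p, k) \<notin> side_tri b r n" if "(b, r, n) \<in> Hs" for b r n
    using holes[OF that] assms by (auto simp: side_tri_def)
  then show "right_free UP (p, k)" "right_free DN (p, k)"
    by (intro right_freeI; simp add: UP_subset DN_subset)+
qed

lemma axis_UP: "(- 1, k) \<in> reg UP \<longleftrightarrow> odd (k + W) \<and> - G \<le> k \<and> k < H \<and> \<not> (- int a1 \<le> k \<and> k < 0)"
proof (cases "odd (k + W)")
  case True
  \<comment> \<open>Parity excludes the boundary cases: the tip of the central hole, and a south
    side shrunk to a point.\<close>
  have a: "k \<noteq> - int a1" "k + W + 2 * z \<noteq> 0" using True par by presburger+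
  show ?thesis
    using True a H G z by (auto simp: mem_reg_UP right_free_axis)
next
  case False
  then have "odd (- 1 - k - W)" by presburger
  then show ?thesis using False mem_reg_UP[of "- 1" k] by auto
qed

lemma axis_DN: "(- 1, k) \<in> reg DN \<longleftrightarrow>
    odd (k + W) \<and> - G < k \<and> k \<le> H \<and> \<not> (- int a1 \<le> k - 1 \<and> k \<le> 0)"
proof (cases "odd (k + W)")
  case True
  have a: "k \<noteq> - int a1" "k \<noteq> W" using True par by presburger+
  show ?thesis
    using True a H G z by (auto simp: mem_reg_DN right_free_axis)
next
  case False
  then have "odd (- 1 - k - W)" by presburger
  then show ?thesis using False mem_reg_DN[of "- 1" k] by auto
qed

lemma finite_reg: "finite (reg UP)" "finite (reg DN)"
proof -
  have "reg f \<subseteq> {- (W + z)..W + z} \<times> {- G..H}" if "\<And>u. u \<in> f u" for f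
  proof
    fix u assume "u \<in> reg f"
    then have "u \<in> hex" using that[of u] by (auto simp: reg_def)
    then show "u \<in> {- (W + z)..W + z} \<times> {- G..H}" by (cases u) (auto simp: hex_def)
  qed
  moreover have "u \<in> UP u" "u \<in> DN u" for u by (simp_all add: UP_def up_tri_def DN_def down_tri_def)
  ultimately show "finite (reg UP)" "finite (reg DN)"
    using finite_subset by (blast intro: finite_cartesian_product finite_atLeastAtMost_int)+
qed

lemma mirror_reg: "mirror_pt ` reg UP = reg UP" "mirror_pt ` reg DN = reg DN"
proof -
  have "mirror_pt ` reg f = reg f" if f: "\<And>u. f (mirror_pt u) = mirror (f u)" for f
  proof -
    have m: "mirror (Defs.lattice W) = Defs.lattice W" "mirror hex = hex"
      "mirror (side_tri False (- int a1) a1) = side_tri False (- int a1) a1"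
      by (auto simp: set_eq_iff mem_mirror Defs.lattice_def hex_def side_tri_def)
    have "mirror_pt u \<in> reg f \<longleftrightarrow> u \<in> reg f" for u
      unfolding reg_def mem_Collect_eq f mirror_subset_iff m mirror_mirror by blast
    then show ?thesis by (intro subset_antisym image_subsetI subsetI) (metis, metis imageI mirror_pt_mirror_pt)
  qed
  then show "mirror_pt ` reg UP = reg UP" "mirror_pt ` reg DN = reg DN"
    using UP_mirror_pt DN_mirror_pt by blast+
qed

definition strip_sign :: "int \<Rightarrow> real" where
  "strip_sign k = (if odd a1 \<and> 0 \<le> k then - 1 else 1)"

sublocale folding "reg UP" "reg DN" strip_sign W
proof
  show "finite (reg UP)" "finite (reg DN)" by (fact finite_reg)+
  show "reg UP \<subseteq> Defs.lattice W"
  proof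
    fix u assume "u \<in> reg UP"
    then show "u \<in> Defs.lattice W" by (cases u) (auto simp: reg_def UP_subset)
  qed
  show "mirror_pt ` reg UP = reg UP" "mirror_pt ` reg DN = reg DN" by (fact mirror_reg)+
  show "strip_sign k = 1 \<or> strip_sign k = - 1" for k by (simp add: strip_sign_def)
  fix p k assume "(p, k) \<in> reg UP" "(p, k) \<in> reg DN"
  then have k: "- G < k" "k < H" by (auto simp: reg_def UP_subset DN_subset hex_def)
  show "strip_sign k * strip_sign (k - 1) =
    (- 1) ^ (of_bool ((- 1, k) \<in> reg UP) + of_bool ((- 1, k) \<in> reg DN))"
  proof (cases "k = 0")
    case True
    then show ?thesis using k par odd_pos[of a1] by (auto simp: axis_UP axis_DN strip_sign_def)
  next
    case False
    \<comment> \<open>Strictly inside the hexagon and away from level 0, the presence of axis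
      triangles could change only at the tip of the central hole, and there the parity is
      wrong.\<close>
    have "(- 1, k) \<in> reg UP \<longleftrightarrow> (- 1, k) \<in> reg DN"
    proof (cases "odd (k + W)")
      case True
      then have "k \<noteq> - int a1" using par by presburger
      then show ?thesis using k \<open>k \<noteq> 0\<close> by (auto simp: axis_UP axis_DN)
    qed (simp add: axis_UP axis_DN)
    then show ?thesis using False by (simp add: strip_sign_def)
  qed
qed

text \<open>The axis crosses each strip in one unit triangle, whose orientation is given by the
  parity of \<open>k + W\<close>. \<open>A\<close> and \<open>B\<close> are the corresponding sets
  of strips outside the central hole; a down-pointing triangle in strip k has level k + 1.\<close>

lemma card_axis:
  "card {u \<in> reg UP. fst u = - 1} + card {d \<in> reg DN. fst d = - 1} = nat (H + G - int a1)"
proof -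
  define A where "A = {k. odd (k + W) \<and> - G \<le> k \<and> k < H \<and> \<not> (- int a1 \<le> k \<and> k < 0)}"
  define B where "B = {k. even (k + W) \<and> - G \<le> k \<and> k < H \<and> \<not> (- int a1 \<le> k \<and> k < 0)}"
  have fin: "finite A" "finite B"
    by (rule finite_subset[of _ "{- G..<H}"]; auto simp: A_def B_def)+
  have "{u \<in> reg UP. fst u = - 1} = Pair (- 1) ` A"
  proof (intro subset_antisym subsetI)
    fix u assume "u \<in> {u \<in> reg UP. fst u = - 1}"
    then have "u = (- 1, snd u)" "(- 1, snd u) \<in> reg UP" by (cases u; simp)+
    then show "u \<in> Pair (- 1) ` A" unfolding axis_UP A_def by blast
  qed (auto simp: axis_UP A_def)
  then have cU: "card {u \<in> reg UP. fst u = - 1} = card A" by (simp add: card_image inj_on_def)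
  have "{u \<in> reg DN. fst u = - 1} = (\<lambda>k. (- 1, k + 1)) ` B"
  proof (intro subset_antisym subsetI)
    fix u assume "u \<in> {u \<in> reg DN. fst u = - 1}"
    then have "u = (- 1, (snd u - 1) + 1)" "(- 1, snd u) \<in> reg DN" by (cases u; simp)+
    moreover from this have "snd u - 1 \<in> B" unfolding axis_DN B_def by auto
    ultimately show "u \<in> (\<lambda>k. (- 1, k + 1)) ` B" by blast
  qed (auto simp: axis_DN B_def)
  then have cD: "card {u \<in> reg DN. fst u = - 1} = card B" by (simp add: card_image inj_on_def)
  have "card A + card B = card (A \<union> B)"
    using fin by (intro card_Un_disjoint[symmetric]) (auto simp: A_def B_def)
  also have "A \<union> B = {- G..<H} - {- int a1..<0}" by (auto simp: A_def B_def)
  also have "card \<dots> = nat (H + G) - a1"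
    using H G by (subst card_Diff_subset) auto
  finally show ?thesis using cU cD by simp
qed

text \<open>The right half, together with the axis triangles in the strips selected by Q.\<close>

definition HU :: "(int \<Rightarrow> bool) \<Rightarrow> point set" where
  "HU Q = half (reg UP) (\<lambda>u. Q (snd u))"

definition HD :: "(int \<Rightarrow> bool) \<Rightarrow> point set" where
  "HD Q = half (reg DN) (\<lambda>d. Q (snd d - 1))"

text \<open>\<open>Q\<close> and \<open>Q'\<close> describe the strips of sign 1 and -1 for both
  parities at once; for even \<open>a1\<close> the second half receives no axis triangle.\<close>

lemma per_S:
  assumes "H + G - int a1 = 2 * int w"
    and Q: "\<And>k. Q k \<longleftrightarrow> even a1 \<or> k < 0" and Q': "\<And>k. Q' k \<longleftrightarrow> odd a1 \<and> 0 \<le> k"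
  shows "per (reg UP) (reg DN) (\<lambda>_. 1) =
    2 ^ w * per (HU Q) (HD Q) axis_weight * per (HU Q') (HD Q') axis_weight"
proof -
  have "U1 = HU Q" "D1 = HD Q" "U2 = HU Q'" "D2 = HD Q'"
    unfolding U1_def D1_def U2_def D2_def HU_def HD_def half_def tU_def tD_def Q Q' strip_sign_def
    by auto
  then show ?thesis
    using per_factorization[of w] card_axis assms(1) by simp
qed

section \<open>Removal of forced strips at the top and the bottom\<close>

definition cut_UP :: "int \<Rightarrow> int \<Rightarrow> (int \<Rightarrow> bool) \<Rightarrow> point set" where
  "cut_UP A B Q = {u \<in> HU Q. - B \<le> snd u \<and> snd u < A}"

definition cut_DN :: "int \<Rightarrow> int \<Rightarrow> (int \<Rightarrow> bool) \<Rightarrow> point set" where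
  "cut_DN A B Q = {d \<in> HD Q. - B < snd d \<and> snd d \<le> A}"

lemma finite_cut_UP: "finite (cut_UP A B Q)"
  using finite_reg by (simp add: cut_UP_def HU_def half_def)

lemma mem_HU: "(p, k) \<in> HU Q \<longleftrightarrow> (p, k) \<in> reg UP \<and> - 1 \<le> p \<and> (p = - 1 \<longrightarrow> Q k)"
  by (auto simp: HU_def half_def)

lemma mem_HD: "(p, k) \<in> HD Q \<longleftrightarrow> (p, k) \<in> reg DN \<and> - 1 \<le> p \<and> (p = - 1 \<longrightarrow> Q (k - 1))"
  by (auto simp: HD_def half_def)

text \<open>The parity condition says that the top strip of the half starts with a down-pointing
  triangle. It ends with an up-pointing one at the slanted side and meets no hole, so it is balanced
  and forced.\<close>

lemma cut_top:
  assumes "0 < H" and e: "even (H + W + of_bool (Q (H - 1)))"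
  shows "per (cut_UP H G Q) (cut_DN H G Q) w = per (cut_UP (H - 1) G Q) (cut_DN (H - 1) G Q) w"
proof -
  have "per (cut_UP H G Q) (cut_DN H G Q) w =
      per {u \<in> cut_UP H G Q. snd u \<noteq> H - 1} {d \<in> cut_DN H G Q. snd d \<noteq> (H - 1) + 1} w"
  proof (rule per_forced_top[OF finite_cut_UP])
    fix p
    have nf: "\<not> UP (p, H - 1) \<subseteq> side_tri b r n" "\<not> DN (p - 1, H) \<subseteq> side_tri b r n"
      if "(b, r, n) \<in> Hs" for b r n
      using holes[OF that] \<open>0 < H\<close> by (cases b; auto simp: UP_subset DN_subset side_tri_def)+
    have free: "right_free UP (p, H - 1)" "right_free DN (p - 1, H)"
      by (rule right_freeI, erule nf)+
    show "(p, H - 1) \<in> cut_UP H G Q \<longleftrightarrow> (p - 1, H - 1 + 1) \<in> cut_DN H G Q"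
    proof (cases "even (p - (H - 1) - W)")
      case True
      then have "p \<noteq> - 1 \<or> \<not> Q (H - 1)" "p \<noteq> 0 \<or> Q (H - 1)" using e by (auto split: if_splits)
      then show ?thesis
        using True free \<open>0 < H\<close> z G H
        by (auto simp: cut_UP_def cut_DN_def mem_HU mem_HD mem_reg_UP mem_reg_DN)
    next
      case False
      moreover from False have "odd (p - 1 - H - W)" by presburger
      ultimately show ?thesis
        by (auto simp: cut_UP_def cut_DN_def mem_HU mem_HD mem_reg_UP mem_reg_DN)
    qed
  qed (auto simp: cut_UP_def)
  also have "{u \<in> cut_UP H G Q. snd u \<noteq> H - 1} = cut_UP (H - 1) G Q"
    by (auto simp: cut_UP_def)
  also have "{d \<in> cut_DN H G Q. snd d \<noteq> (H - 1) + 1} = cut_DN (H - 1) G Q"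
    by (auto simp: cut_DN_def)
  finally show ?thesis .
qed

text \<open>The condition is the counterpart for the bottom strip: it starts with an up-pointing
  triangle and ends with a down-pointing one.\<close>

lemma cut_bottom:
  assumes "0 < G" "0 \<le> A" "A \<le> H" and e: "even (G + W + of_bool (Q (- G)))"
  shows "per (cut_UP A G Q) (cut_DN A G Q) w = per (cut_UP A (G - 1) Q) (cut_DN A (G - 1) Q) w"
proof -
  have "per (cut_UP A G Q) (cut_DN A G Q) w =
      per {u \<in> cut_UP A G Q. snd u \<noteq> - G} {d \<in> cut_DN A G Q. snd d \<noteq> - G + 1} w"
  proof (rule per_forced_bottom[OF finite_cut_UP])
    fix p
    have nf: "\<not> UP (p, - G) \<subseteq> side_tri b r n" "\<not> DN (p + 1, - G + 1) \<subseteq> side_tri b r n"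
      if "(b, r, n) \<in> Hs" for b r n
      using holes[OF that] \<open>0 < G\<close> by (cases b; auto simp: UP_subset DN_subset side_tri_def)+
    have free: "right_free UP (p, - G)" "right_free DN (p + 1, - G + 1)"
      by (rule right_freeI, erule nf)+
    show "(p, - G) \<in> cut_UP A G Q \<longleftrightarrow> (p + 1, - G + 1) \<in> cut_DN A G Q"
    proof (cases "even (p + G - W)")
      case True
      then have Q: "p \<noteq> - 2 \<or> \<not> Q (- G)" "p \<noteq> - 1 \<or> Q (- G)" using e by (auto split: if_splits)
      \<comment> \<open>Throughout the bottom strip the south-east side bounds the region more
        tightly than the line of the side above the east vertex.\<close>
      have zG: "2 * z - G \<le> G - 2" using G(1) z assms(1) by presburger
      have ev: "even (p - - G - W)" "even (p + 1 - (- G + 1) - W)" using True by presburger+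
      show ?thesis
      proof (cases "- 1 \<le> p")
        case True
        then have p: "- 1 \<le> p + 1" by simp
        have "(p, - G) \<in> cut_UP A G Q \<longleftrightarrow> p + 2 \<le> W + 2 * z - G"
          unfolding cut_UP_def mem_Collect_eq mem_HU mem_reg_UP[OF True] fst_conv snd_conv
          using ev(1) Q(2) free(1) True assms z G H by auto
        also have "\<dots> \<longleftrightarrow> (p + 1, - G + 1) \<in> cut_DN A G Q"
          unfolding cut_DN_def mem_Collect_eq mem_HD mem_reg_DN[OF p] fst_conv snd_conv
          using ev(2) Q(2) free(2) True assms zG z G H by auto
        finally show ?thesis .
      next
        case False
        then show ?thesis using Q(1) by (auto simp: cut_UP_def cut_DN_def mem_HU mem_HD)
      qed
    next
      case False
      moreover from False have "odd (p + 1 - (- G + 1) - W)" by presburger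
      ultimately show ?thesis
        by (auto simp: cut_UP_def cut_DN_def mem_HU mem_HD mem_reg_UP mem_reg_DN)
    qed
  qed (auto simp: cut_DN_def)
  also have "{u \<in> cut_UP A G Q. snd u \<noteq> - G} = cut_UP A (G - 1) Q"
    by (auto simp: cut_UP_def)
  also have "{d \<in> cut_DN A G Q. snd d \<noteq> - G + 1} = cut_DN A (G - 1) Q"
    by (auto simp: cut_DN_def)
  finally show ?thesis .
qed

text \<open>The maxima are needed because A = -1 or B = -1 encodes an empty part of a halved region.\<close>

lemma per_cut:
  assumes A: "A = H \<or> A = H - 1 \<and> (0 < H \<longrightarrow> even (H + W + of_bool (Q (H - 1))))"
    and B: "B = G \<or> B = G - 1 \<and> (0 < G \<longrightarrow> even (G + W + of_bool (Q (- G))))"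
  shows "per (HU Q) (HD Q) w = per (cut_UP (max A 0) (max B 0) Q) (cut_DN (max A 0) (max B 0) Q) w"
proof -
  have "HU Q = cut_UP H G Q" "HD Q = cut_DN H G Q"
    by (auto simp: cut_UP_def cut_DN_def mem_HU mem_HD mem_reg_UP mem_reg_DN)
  then have "per (HU Q) (HD Q) w = per (cut_UP H G Q) (cut_DN H G Q) w" by simp
  also have "\<dots> = per (cut_UP (max A 0) G Q) (cut_DN (max A 0) G Q) w"
  proof (cases "A = H \<or> H = 0")
    case True
    then have "max A 0 = H" using A H by auto
    then show ?thesis by simp
  next
    case False
    then have "max A 0 = H - 1" "0 < H" "even (H + W + of_bool (Q (H - 1)))" using A H by auto
    then show ?thesis using cut_top by simp
  qed
  also have "\<dots> = per (cut_UP (max A 0) (max B 0) Q) (cut_DN (max A 0) (max B 0) Q) w"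
  proof (cases "B = G \<or> G = 0")
    case True
    then have "max B 0 = G" using B G z by auto
    then show ?thesis by simp
  next
    case False
    then have "max B 0 = G - 1" "0 < G" "even (G + W + of_bool (Q (- G)))" using B G z by auto
    then show ?thesis using A H cut_bottom[of "max A 0"] by (auto simp: max_def)
  qed
  finally show ?thesis .
qed

text \<open>\<open>halved_region\<close> in the parameters of the hexagon:
  \<open>W + \<delta>\<close> is its \<open>2 * L\<close>, and the holes are moved by
  \<open>\<delta>\<close>. The shift will be 0 for an even first entry, and -1 or 1 for an odd
  one.\<close>

definition halfreg :: "(point \<Rightarrow> triangle) \<Rightarrow> int \<Rightarrow> int \<Rightarrow> (int \<Rightarrow> int) \<Rightarrow> (int \<Rightarrow> int) \<Rightarrow> int \<Rightarrow> point set"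
  where "halfreg f A B al be \<delta> = {u. f u \<subseteq> Defs.lattice 0 \<and>
    (f u \<subseteq> {(p, k). 0 \<le> k \<and> k \<le> A \<and> al k \<le> p \<and> p \<le> W + \<delta> - k} \<or>
     f u \<subseteq> {(p, k). 0 \<le> - k \<and> - k \<le> B \<and> be (- k) \<le> p \<and>
       p \<le> min (W + \<delta> + (- k)) (W + \<delta> + 2 * z - (- k))}) \<and>
    \<not> f u \<subseteq> {(p, k). k \<le> 0 \<and> p \<le> int a1 + \<delta> - (- k)} \<and>
    (\<forall>(b, r, n)\<in>Hs. \<not> f u \<subseteq> side_tri b (r + \<delta>) n)}"

lemma right_free_shift:
  "right_free UP (p, k) \<longleftrightarrow> (\<forall>(b, r, n)\<in>Hs. \<not> UP (p + \<delta>, k) \<subseteq> side_tri b (r + \<delta>) n)"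
  "right_free DN (p, k) \<longleftrightarrow> (\<forall>(b, r, n)\<in>Hs. \<not> DN (p + \<delta>, k) \<subseteq> side_tri b (r + \<delta>) n)"
  unfolding right_free_def UP_subset DN_subset side_tri_def
  by (intro ball_cong refl; clarsimp simp: algebra_simps)+

text \<open>After the shift the axis is at \<open>\<delta>\<close>, and axis triangles are named by
  \<open>\<delta> - 1\<close>. The smaller value of a zigzag thus tells whether its part keeps the
  axis triangles, which is what \<open>up\<close> and \<open>lo\<close> express.\<close>

lemma halfreg_eq_cut:
  assumes al: "even e" "odd d" "\<bar>e - d\<bar> = 1" and be: "even e'" "odd d'" "\<bar>e' - d'\<bar> = 1"
    and \<delta>: "even (W + \<delta>)"
    and up: "min e d = \<delta> - of_bool (Q 0)" and lo: "min e' d' = \<delta> - of_bool (Q (- 1))"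
    and Q: "\<And>k. Q k \<longleftrightarrow> Q (if 0 \<le> k then 0 else - 1)"
    and AB: "A \<le> H" "B \<le> G"
  shows "halfreg UP A B (zigzag e d) (zigzag e' d') \<delta> = shift \<delta> ` cut_UP (max A 0) (max B 0) Q"
    and "halfreg DN A B (zigzag e d) (zigzag e' d') \<delta> = shift \<delta> ` cut_DN (max A 0) (max B 0) Q"
proof -
  have sh: "(p + \<delta>, k) \<in> shift \<delta> ` X \<longleftrightarrow> (p, k) \<in> X" for p k X
    by (force simp: shift_def image_iff)
  have ex: "\<exists>p k. u = (p + \<delta>, k)" for u :: point
    by (rule exI[of _ "fst u - \<delta>"], rule exI[of _ "snd u"]) simp
  have zu: "zigzag e d j \<le> p + \<delta> + i \<longleftrightarrow> - of_bool (Q k) \<le> p + i"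
    if "even (p + \<delta> + i - j)" "0 \<le> k" for p i j k
    using zigzag_le_iff[OF al that(1)] up Q[of k] that(2) by (simp; linarith)
  have zl: "zigzag e' d' (- j) \<le> p + \<delta> + i \<longleftrightarrow> - of_bool (Q k) \<le> p + i"
    if "even (p + \<delta> + i - j)" "k < 0" for p i j k
    using zigzag_le_iff[OF be, of "p + \<delta> + i" "- j"] lo Q[of k] that by (simp; linarith)
  let ?up = "{(p, k). 0 \<le> k \<and> k \<le> A \<and> zigzag e d k \<le> p \<and> p \<le> W + \<delta> - k}"
  let ?lo = "{(p, k). 0 \<le> - k \<and> - k \<le> B \<and> zigzag e' d' (- k) \<le> p \<and>
          p \<le> min (W + \<delta> + (- k)) (W + \<delta> + 2 * z - (- k))}"
  let ?a = "{(p, k). k \<le> 0 \<and> p \<le> int a1 + \<delta> - (- k)}"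
  show "halfreg UP A B (zigzag e d) (zigzag e' d') \<delta> = shift \<delta> ` cut_UP (max A 0) (max B 0) Q"
  proof (rule Set.set_eqI)
    fix u :: point
    obtain p k where u: "u = (p + \<delta>, k)" using ex by blast
    show "u \<in> halfreg UP A B (zigzag e d) (zigzag e' d') \<delta> \<longleftrightarrow>
      u \<in> shift \<delta> ` cut_UP (max A 0) (max B 0) Q"
    proof (cases "even (p + \<delta> - k)")
      case True
      have ev: "even (p - k - W)" using True \<delta> by presburger
      have ev': "even (p + \<delta> + 0 - k)" "even (p + \<delta> + 2 - k)" "even (p + \<delta> + 1 - (k + 1))"
        using True by presburger+
      define \<theta> where "\<theta> = - (of_bool (Q k) :: int)"
      have u0: "zigzag e d k \<le> p + \<delta> \<longleftrightarrow> \<theta> \<le> p" "zigzag e d k \<le> p + \<delta> + 2 \<longleftrightarrow> \<theta> \<le> p + 2"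
        "zigzag e d (k + 1) \<le> p + \<delta> + 1 \<longleftrightarrow> \<theta> \<le> p + 1" if "0 \<le> k"
        using zu[OF ev'(1) that] zu[OF ev'(2) that] zu[OF ev'(3) that] unfolding \<theta>_def by simp_all
      have l0: "zigzag e' d' (- k) \<le> p + \<delta> \<longleftrightarrow> \<theta> \<le> p" "zigzag e' d' (- k) \<le> p + \<delta> + 2 \<longleftrightarrow> \<theta> \<le> p + 2"
        "zigzag e' d' (- (k + 1)) \<le> p + \<delta> + 1 \<longleftrightarrow> \<theta> \<le> p + 1" if "k < 0"
        using zl[OF ev'(1) that] zl[OF ev'(2) that] zl[OF ev'(3) that] unfolding \<theta>_def by simp_all
      have 1: "UP (p + \<delta>, k) \<subseteq> ?up \<longleftrightarrow> 0 \<le> k \<and> k < A \<and> \<theta> \<le> p \<and> p + 2 \<le> W - k"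
      proof (cases "0 \<le> k")
        case True
        then show ?thesis unfolding UP_subset mem_Collect_eq prod.case u0[OF True] by auto
      qed (auto simp: UP_subset)
      have 2: "UP (p + \<delta>, k) \<subseteq> ?lo \<longleftrightarrow>
          k < 0 \<and> - B \<le> k \<and> \<theta> \<le> p \<and> p + 2 \<le> W - k \<and> p + 2 \<le> W + 2 * z + k"
      proof (cases "k < 0")
        case True
        then show ?thesis unfolding UP_subset mem_Collect_eq prod.case l0[OF True] by auto
      qed (auto simp: UP_subset)
      have 3: "UP (p + \<delta>, k) \<subseteq> ?a \<longleftrightarrow> k < 0 \<and> p + 2 \<le> int a1 + k"
        by (auto simp: UP_subset)
      have "u \<in> halfreg UP A B (zigzag e d) (zigzag e' d') \<delta> \<longleftrightarrow>
          \<theta> \<le> p \<and> p + 2 \<le> W - k \<and> (0 \<le> k \<and> k < A \<or> k < 0 \<and> - B \<le> k \<and> p + 2 \<le> W + 2 * z + k) \<and>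
          \<not> (k < 0 \<and> p + 2 \<le> int a1 + k) \<and> right_free UP (p, k)"
        unfolding halfreg_def mem_Collect_eq u 1 2 3 UP_lattice right_free_shift(1)[of p k \<delta>]
        using True by (simp cong: conj_cong) blast
      also have "\<dots> \<longleftrightarrow> (p, k) \<in> cut_UP (max A 0) (max B 0) Q"
      proof (cases "- 1 \<le> p")
        case False
        then show ?thesis by (auto simp: cut_UP_def mem_HU \<theta>_def)
      next
        case True
        have th: "\<theta> \<le> p \<longleftrightarrow> (p = - 1 \<longrightarrow> Q k)"
          using True by (auto simp: \<theta>_def)
        have A: "k < max A 0 \<longleftrightarrow> k < A \<or> k < 0" and B: "- max B 0 \<le> k \<longleftrightarrow> 0 \<le> k \<or> - B \<le> k"
          by linarith+
        have "- B \<le> k \<Longrightarrow> - G \<le> k" "0 \<le> k \<Longrightarrow> - G \<le> k" "k < A \<Longrightarrow> k < H" "k < 0 \<Longrightarrow> k < H"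
          "0 \<le> k \<Longrightarrow> p + 2 \<le> W - k \<Longrightarrow> p + 2 \<le> W + 2 * z + k" "k < 0 \<or> 0 \<le> k" "\<not> (k < 0 \<and> 0 \<le> k)"
          using AB z H G by linarith+
        then show ?thesis
          unfolding cut_UP_def mem_Collect_eq mem_HU mem_reg_UP[OF True] th fst_conv snd_conv A B
          using ev True by argo
      qed
      finally show ?thesis unfolding u sh .
    next
      case False
      then have "odd (p - k - W)" using \<delta> by presburger
      then show ?thesis using False unfolding u sh
        by (auto simp: halfreg_def UP_lattice cut_UP_def mem_HU mem_reg_UP)
    qed
  qed
  show "halfreg DN A B (zigzag e d) (zigzag e' d') \<delta> = shift \<delta> ` cut_DN (max A 0) (max B 0) Q"
  proof (rule Set.set_eqI)
    fix u :: point
    obtain p k where u: "u = (p + \<delta>, k)" using ex by blast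
    show "u \<in> halfreg DN A B (zigzag e d) (zigzag e' d') \<delta> \<longleftrightarrow>
      u \<in> shift \<delta> ` cut_DN (max A 0) (max B 0) Q"
    proof (cases "even (p + \<delta> - k)")
      case True
      have ev: "even (p - k - W)" using True \<delta> by presburger
      have ev': "even (p + \<delta> + 0 - k)" "even (p + \<delta> + 2 - k)" "even (p + \<delta> + 1 - (k - 1))"
        using True by presburger+
      define \<theta> where "\<theta> = - (of_bool (Q (k - 1)) :: int)"
      have u0: "zigzag e d k \<le> p + \<delta> \<longleftrightarrow> \<theta> \<le> p" "zigzag e d k \<le> p + \<delta> + 2 \<longleftrightarrow> \<theta> \<le> p + 2"
        "zigzag e d (k - 1) \<le> p + \<delta> + 1 \<longleftrightarrow> \<theta> \<le> p + 1" if "0 \<le> k - 1"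
        using zu[OF ev'(1) that] zu[OF ev'(2) that] zu[OF ev'(3) that] unfolding \<theta>_def by simp_all
      have l0: "zigzag e' d' (- k) \<le> p + \<delta> \<longleftrightarrow> \<theta> \<le> p" "zigzag e' d' (- k) \<le> p + \<delta> + 2 \<longleftrightarrow> \<theta> \<le> p + 2"
        "zigzag e' d' (- (k - 1)) \<le> p + \<delta> + 1 \<longleftrightarrow> \<theta> \<le> p + 1" if "k - 1 < 0"
        using zl[OF ev'(1) that] zl[OF ev'(2) that] zl[OF ev'(3) that] unfolding \<theta>_def by simp_all
      have 1: "DN (p + \<delta>, k) \<subseteq> ?up \<longleftrightarrow> 0 < k \<and> k \<le> A \<and> \<theta> \<le> p \<and> p + 2 \<le> W - k"
      proof (cases "0 \<le> k - 1")
        case True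
        then show ?thesis unfolding DN_subset mem_Collect_eq prod.case u0[OF True] by auto
      qed (auto simp: DN_subset)
      have 2: "DN (p + \<delta>, k) \<subseteq> ?lo \<longleftrightarrow>
          k \<le> 0 \<and> - B < k \<and> \<theta> \<le> p \<and> p + 2 \<le> W - k \<and> p + 2 \<le> W + 2 * z + k"
      proof (cases "k - 1 < 0")
        case True
        then show ?thesis unfolding DN_subset mem_Collect_eq prod.case l0[OF True] by auto
      qed (auto simp: DN_subset)
      have 3: "DN (p + \<delta>, k) \<subseteq> ?a \<longleftrightarrow> k \<le> 0 \<and> p + 2 \<le> int a1 + k"
        by (auto simp: DN_subset)
      have "u \<in> halfreg DN A B (zigzag e d) (zigzag e' d') \<delta> \<longleftrightarrow>
          \<theta> \<le> p \<and> p + 2 \<le> W - k \<and> (0 < k \<and> k \<le> A \<or> k \<le> 0 \<and> - B < k \<and> p + 2 \<le> W + 2 * z + k) \<and>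
          \<not> (k \<le> 0 \<and> p + 2 \<le> int a1 + k) \<and> right_free DN (p, k)"
        unfolding halfreg_def mem_Collect_eq u 1 2 3 DN_lattice right_free_shift(2)[of p k \<delta>]
        using True by (simp cong: conj_cong) blast
      also have "\<dots> \<longleftrightarrow> (p, k) \<in> cut_DN (max A 0) (max B 0) Q"
      proof (cases "- 1 \<le> p")
        case False
        then show ?thesis by (auto simp: cut_DN_def mem_HD \<theta>_def)
      next
        case True
        have th: "\<theta> \<le> p \<longleftrightarrow> (p = - 1 \<longrightarrow> Q (k - 1))"
          using True by (auto simp: \<theta>_def)
        have A: "k \<le> max A 0 \<longleftrightarrow> k \<le> A \<or> k \<le> 0" and B: "- max B 0 < k \<longleftrightarrow> 0 < k \<or> - B < k"
          by linarith+
        have "- B < k \<Longrightarrow> - G < k" "0 < k \<Longrightarrow> - G < k" "k \<le> A \<Longrightarrow> k \<le> H" "k \<le> 0 \<Longrightarrow> k \<le> H"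
          "0 < k \<Longrightarrow> p + 2 \<le> W - k \<Longrightarrow> p + 2 \<le> W + 2 * z + k" "k \<le> 0 \<or> 0 < k" "\<not> (k \<le> 0 \<and> 0 < k)"
          using AB z H G by linarith+
        then show ?thesis
          unfolding cut_DN_def mem_Collect_eq mem_HD mem_reg_DN[OF True] th fst_conv snd_conv A B
          using ev True by argo
      qed
      finally show ?thesis unfolding u sh .
    next
      case False
      then have "odd (p - k - W)" using \<delta> by presburger
      then show ?thesis using False unfolding u sh
        by (auto simp: halfreg_def DN_lattice cut_DN_def mem_HD mem_reg_DN)
    qed
  qed
qed

end

section \<open>From lists of side lengths to the abstract hexagon\<close>

lemma odd_sum_eq: "odd_sum s = entry s 1 + (\<Sum>i | i \<in> {2..length s} \<and> odd i. entry s i)"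
proof (cases s)
  case Nil
  then show ?thesis by (simp add: odd_sum_def entry_def)
next
  case (Cons c t)
  have i: "{1..length s} = insert 1 {2..length s}" using Cons by auto
  have "{i. i \<in> {1..length s} \<and> odd i} = insert 1 {i. i \<in> {2..length s} \<and> odd i}"
    unfolding i by auto
  then show ?thesis by (simp add: odd_sum_def)
qed

lemma even_sum_eq: "even_sum s = (\<Sum>i | i \<in> {2..length s} \<and> even i. entry s i)"
proof -
  have "i \<in> {1..length s} \<and> even i \<longleftrightarrow> i \<in> {2..length s} \<and> even i" for i
    by (cases "i = 1") auto
  then show ?thesis by (simp add: even_sum_def)
qed

text \<open>\<open>c # tl a\<close> replaces the first entry even if \<open>a\<close> is empty, in
  accordance with reading the empty sequence as (0).\<close>

lemma entry_Cons_tl: "entry (c # tl a) 1 = c" "2 \<le> i \<Longrightarrow> entry (c # tl a) i = entry a i"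
proof -
  show "entry (c # tl a) 1 = c" by (simp add: entry_def)
  assume "2 \<le> i"
  then obtain k where "i = Suc (Suc k)" by (metis add_2_eq_Suc le_Suc_ex)
  then show "entry (c # tl a) i = entry a i" by (cases a) (auto simp: entry_def)
qed

lemma atLeast2_length_Cons_tl: "{2..length (c # tl a)} = {2..length a}"
  by (cases a) auto

lemma sums_Cons_tl:
  "odd_sum (c # tl a) + entry a 1 = odd_sum a + c"
  "even_sum (c # tl a) = even_sum a"
  "sum_list (c # tl a) + entry a 1 = sum_list a + c"
proof -
  have "(\<Sum>i | i \<in> {2..length a} \<and> odd i. entry (c # tl a) i) =
      (\<Sum>i | i \<in> {2..length a} \<and> odd i. entry a i)"
    by (intro sum.cong refl) (simp add: entry_Cons_tl)
  then show o: "odd_sum (c # tl a) + entry a 1 = odd_sum a + c"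
    unfolding odd_sum_eq atLeast2_length_Cons_tl entry_Cons_tl(1) by simp
  have "(\<Sum>i | i \<in> {2..length a} \<and> even i. entry (c # tl a) i) =
      (\<Sum>i | i \<in> {2..length a} \<and> even i. entry a i)"
    by (intro sum.cong refl) (simp add: entry_Cons_tl)
  then show e: "even_sum (c # tl a) = even_sum a"
    unfolding even_sum_eq atLeast2_length_Cons_tl .
  show "sum_list (c # tl a) + entry a 1 = sum_list a + c"
    using o e odd_sum_plus_even_sum[of a] odd_sum_plus_even_sum[of "c # tl a"] by linarith
qed

lemma entry_le_even_sum: "i \<in> {1..length s} \<Longrightarrow> even i \<Longrightarrow> entry s i \<le> even_sum s"
  unfolding even_sum_def by (intro member_le_sum) auto

lemma entry_le_odd_sum: "i \<in> {1..length s} \<Longrightarrow> odd i \<Longrightarrow> entry s i \<le> odd_sum s"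
  unfolding odd_sum_def by (intro member_le_sum) auto

text \<open>The additional first entry compensates for the \<open>- entry a 1\<close> in the depth;
  without it a hole could only be shown to be no longer than the depth.\<close>

lemma entry_le_odd_sum': "i \<in> {2..length s} \<Longrightarrow> odd i \<Longrightarrow> entry s i + entry s 1 \<le> odd_sum s"
  unfolding odd_sum_eq using member_le_sum[of i "{i. i \<in> {2..length s} \<and> odd i}" "entry s"] by simp

lemma first_entry_le_odd_sum: "entry s 1 \<le> odd_sum s"
  by (simp add: odd_sum_eq)

lemma mem_triangles_in:
  assumes "unit_triangle t"
  shows "t \<in> triangles_in c P \<longleftrightarrow> t \<subseteq> Defs.lattice c \<and> t \<subseteq> P"
  using assms by (simp add: triangles_in_def)

lemma unit_triangle_UP_DN [simp]: "unit_triangle (UP u)" "unit_triangle (DN u)"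
  by (auto simp: unit_triangle_def UP_def DN_def)

text \<open>The two kinds of edges are the western sides of the vertical lozenge at (p, k). The
  ranges record that an upper zigzag stays on or above level 0 and a lower one on or below
  it.\<close>

lemma zigzag_edges:
  "{(p, k), (p + 1, k + 1)} \<in> upper_zigzag A al \<longleftrightarrow> 0 \<le> k \<and> k < A \<and> al k = p \<and> al (k + 1) = p + 1"
  "{(p, k), (p + 1, k - 1)} \<in> upper_zigzag A al \<longleftrightarrow>
    1 \<le> k \<and> k - 1 < A \<and> al k = p \<and> al (k - 1) = p + 1"
  "{(p, k), (p + 1, k + 1)} \<in> lower_zigzag B be \<longleftrightarrow>
    k \<le> - 1 \<and> - k - 1 < B \<and> be (- k) = p \<and> be (- k - 1) = p + 1"
  "{(p, k), (p + 1, k - 1)} \<in> lower_zigzag B be \<longleftrightarrow>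
    k \<le> 0 \<and> - k < B \<and> be (- k) = p \<and> be (- k + 1) = p + 1"
proof -
  have 1: "{(p, k), (p + 1, k + 1)} = {(al j, j), (al (j + 1), j + 1)} \<longleftrightarrow>
      j = k \<and> al k = p \<and> al (k + 1) = p + 1" for j
    by (auto simp: doubleton_eq_iff add.commute)
  show "{(p, k), (p + 1, k + 1)} \<in> upper_zigzag A al \<longleftrightarrow>
      0 \<le> k \<and> k < A \<and> al k = p \<and> al (k + 1) = p + 1"
    unfolding upper_zigzag_def image_iff 1 by auto
  have 2: "{(p, k), (p + 1, k - 1)} = {(al j, j), (al (j + 1), j + 1)} \<longleftrightarrow>
      j = k - 1 \<and> al k = p \<and> al (k - 1) = p + 1" for j
    by (auto simp: doubleton_eq_iff add.commute)
  show "{(p, k), (p + 1, k - 1)} \<in> upper_zigzag A al \<longleftrightarrow>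
      1 \<le> k \<and> k - 1 < A \<and> al k = p \<and> al (k - 1) = p + 1"
    unfolding upper_zigzag_def image_iff 2 by auto
  have 3: "{(p, k), (p + 1, k + 1)} = {(be j, - j), (be (j + 1), - (j + 1))} \<longleftrightarrow>
      j = - k - 1 \<and> be (- k) = p \<and> be (- k - 1) = p + 1" for j
    by (auto simp: doubleton_eq_iff add.commute)
  show "{(p, k), (p + 1, k + 1)} \<in> lower_zigzag B be \<longleftrightarrow>
      k \<le> - 1 \<and> - k - 1 < B \<and> be (- k) = p \<and> be (- k - 1) = p + 1"
    unfolding lower_zigzag_def image_iff 3 by auto
  have 4: "{(p, k), (p + 1, k - 1)} = {(be j, - j), (be (j + 1), - (j + 1))} \<longleftrightarrow>
      j = - k \<and> be (- k) = p \<and> be (- k + 1) = p + 1" for j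
    by (auto simp: doubleton_eq_iff add.commute)
  show "{(p, k), (p + 1, k - 1)} \<in> lower_zigzag B be \<longleftrightarrow>
      k \<le> 0 \<and> - k < B \<and> be (- k) = p \<and> be (- k + 1) = p + 1"
    unfolding lower_zigzag_def image_iff 4 by auto
qed

lemma lozenge_weight_vertical:
  "lozenge_weight E {UP (p, k), DN (p, k)} =
    (if {(p, k), (p + 1, k + 1)} \<in> E \<and> {(p, k), (p + 1, k - 1)} \<in> E then 1 / 2 else 1)"
proof -
  have "{UP (p, k), DN (p, k)} = {up_tri q l, down_tri q l} \<longleftrightarrow> q = p \<and> l = k" for q l
    using lozenge_pair_eq[of "(p, k)" "(p, k)" "(q, l)" "(q, l)"] by (auto simp: UP_def DN_def)
  then show ?thesis unfolding lozenge_weight_def by simp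
qed

locale symmetric_hexagon =
  fixes x y z :: nat and a b :: "nat list"
  assumes parity: "x mod 2 = y mod 2"
begin

definition width :: int where "width = S_width x y a b"
text \<open>The slanted sides start at level -z, so \<open>z\<close> is subtracted from the one
  going up and added to the one going down.\<close>

definition height :: int where "height = S_north_east y z a b - int z"
definition depth :: int where "depth = S_south_east y z a b + int z"

definition hole_set :: "(bool \<times> int \<times> nat) set" where
  "hole_set =
    (\<lambda>i. (even i, int (entry a 1) + 2 * int (\<Sum>t\<in>{2..<i}. entry a t), entry a i)) ` {2..length a} \<union>
    (\<lambda>j. (odd j, width - 2 * int (\<Sum>t\<in>{1..j}. entry b t), entry b j)) ` {1..length b}"

lemma height_eq: "height = int (y + 2 * even_sum a + 2 * odd_sum b)"
  by (simp add: height_def S_north_east_def)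

lemma depth_eq: "depth = int (y + 2 * z + 2 * odd_sum a + 2 * even_sum b) - int (entry a 1)"
  by (simp add: depth_def S_south_east_def)

lemma width_eq: "width = int (x + y + 2 * odd_sum a + 2 * even_sum a + 2 * odd_sum b + 2 * even_sum b)
    - int (entry a 1)"
  using odd_sum_plus_even_sum[of a] odd_sum_plus_even_sum[of b]
  by (simp add: width_def S_width_def)

sublocale holed_hexagon width "int z" height depth "entry a 1" hole_set
proof
  have le: "int (entry a 1) \<le> int (odd_sum a)" using first_entry_le_odd_sum[of a] by simp
  show "0 \<le> int z" "0 \<le> height" "height \<le> width" "2 * int z \<le> depth" "int (entry a 1) \<le> depth"
    "depth \<le> width + 2 * int z"
    using le unfolding height_eq depth_eq width_eq by auto
  have "even (int x + int y)" using parity by presburger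
  then show "even (width + int (entry a 1))" unfolding width_eq by simp
  fix c r n assume "(c, r, n) \<in> hole_set"
  then consider i where "i \<in> {2..length a}" "c = even i"
      "r = int (entry a 1) + 2 * int (\<Sum>t\<in>{2..<i}. entry a t)" "n = entry a i"
    | j where "j \<in> {1..length b}" "c = odd j" "r = width - 2 * int (\<Sum>t\<in>{1..j}. entry b t)" "n = entry b j"
    unfolding hole_set_def by blast
  then show "0 \<le> r \<and> (n \<noteq> 0 \<longrightarrow> int n < (if c then height else depth))"
  proof cases
    case 1
    have "0 \<le> r" unfolding 1(3) by (simp add: add_nonneg_nonneg sum_nonneg)
    then show ?thesis
      using 1(1,2,4) entry_le_even_sum[of i a] entry_le_odd_sum'[of i a] unfolding height_eq depth_eq
      by auto
  next
    case 2
    define t where "t = (\<Sum>t\<in>{1..j}. entry b t)"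
    have "t \<le> sum_list b"
      unfolding sum_list_entry t_def using 2 by (intro sum_mono2) auto
    then have "0 \<le> r"
      using le odd_sum_plus_even_sum[of b] unfolding 2(3) width_eq t_def[symmetric] by simp
    then show ?thesis
      using 2(1,2,4) le entry_le_even_sum[of j b] entry_le_odd_sum[of j b]
      unfolding height_eq depth_eq by auto
  qed
qed

lemma S2_triangles:
  assumes f: "\<And>u. unit_triangle (f u)"
  shows "{u. f u \<in> fst (S2 x y z a b)} = reg f"
proof -
  have hexeq: "S_hexagon x y z a b = hex"
    unfolding S_hexagon_def hex_def unfolding width_def height_def depth_def by auto
  have holes: "S_holes x y a b = (\<lambda>(c, r, n). side_tri c r n) ` hole_set"
    by (simp add: S_holes_def hole_set_def image_Un image_image width_def)
  show ?thesis
    unfolding S2_def Let_def fst_conv hexeq holes reg_def width_def[symmetric]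
    by (auto simp: mem_triangles_in[OF f])
qed

lemma M_S2: "M (S2 x y z a b) = per (reg UP) (reg DN) (\<lambda>_. 1)"
proof -
  define R where "R = fst (S2 x y z a b)"
  have S2: "S2 x y z a b = (R, {})" by (simp add: R_def S2_def Let_def)
  have u: "ups R = reg UP" "downs R = reg DN"
    unfolding ups_def downs_def R_def by (simp_all add: S2_triangles)
  have "unit_triangle t" if "t \<in> R" for t
    using that by (auto simp: R_def S2_def Let_def triangles_in_def)
  then have "M (R, {}) = per (ups R) (downs R) (\<lambda>u. lozenge_weight {} {UP u, DN u})"
    using finite_reg by (intro M_eq_per) (simp_all add: u)
  then show ?thesis by (simp add: S2 u lozenge_weight_def)
qed

lemma halved_region_triangles:
  assumes f: "\<And>u. unit_triangle (f u)"
    and L: "2 * int (x' + y' + sum_list (c # tl a) + sum_list b) = width + \<delta>"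
    and c: "2 * int c = int (entry a 1) + \<delta>"
  shows "{u. f u \<in> halved_region A B al be x' y' z (c # tl a) b} = halfreg f A B al be \<delta>"
proof -
  have a: "2 * int (\<Sum>t\<in>{1..<i}. entry (c # tl a) t) =
      int (entry a 1) + 2 * int (\<Sum>t\<in>{2..<i}. entry a t) + \<delta>" if "i \<in> {2..length a}" for i
  proof -
    have "{1..<i} = insert 1 {2..<i}" using that by auto
    then have "(\<Sum>t\<in>{1..<i}. entry (c # tl a) t) = c + (\<Sum>t\<in>{2..<i}. entry (c # tl a) t)"
      by (simp add: entry_Cons_tl(1)[simplified])
    also have "(\<Sum>t\<in>{2..<i}. entry (c # tl a) t) = (\<Sum>t\<in>{2..<i}. entry a t)"
      by (intro sum.cong refl) (simp add: entry_Cons_tl)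
    finally show ?thesis using c by simp
  qed
  have b: "2 * (int (x' + y' + sum_list (c # tl a) + sum_list b) - int (\<Sum>t\<in>{1..j}. entry b t)) =
      width - 2 * int (\<Sum>t\<in>{1..j}. entry b t) + \<delta>" for j
    using L by simp
  have free: "(\<forall>(b, r, n)\<in>hole_set. \<not> f u \<subseteq> side_tri b (r + \<delta>) n) \<longleftrightarrow>
    (\<forall>i\<in>{2..length a}. \<not> f u \<subseteq>
      side_tri (even i) (int (entry a 1) + 2 * int (\<Sum>t\<in>{2..<i}. entry a t) + \<delta>) (entry a i)) \<and>
    (\<forall>j\<in>{1..length b}. \<not> f u \<subseteq>
      side_tri (odd j) (width - 2 * int (\<Sum>t\<in>{1..j}. entry b t) + \<delta>) (entry b j))" for u
    unfolding hole_set_def ball_Un ball_simps(9) prod.case ..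
  show ?thesis
    unfolding halved_region_def Let_def halfreg_def free L atLeast2_length_Cons_tl entry_Cons_tl(1) c b
    using a by (auto simp: mem_triangles_in[OF f] entry_Cons_tl(2))
qed

text \<open>By \<open>E\<close> the vertical lozenges weighted by the zigzags have to be those on
  the axis. Agreement inside the cut suffices, because the removed strips contain forced lozenges of
  weight 1 only.\<close>

lemma M_halved_region:
  assumes L: "2 * int (x' + y' + sum_list (c # tl a) + sum_list b) = width + \<delta>"
    and c: "2 * int c = int (entry a 1) + \<delta>"
    and al: "even e" "odd d" "\<bar>e - d\<bar> = 1" and be: "even e'" "odd d'" "\<bar>e' - d'\<bar> = 1"
    and \<delta>: "even (width + \<delta>)"
    and up: "min e d = \<delta> - of_bool (Q 0)" and lo: "min e' d' = \<delta> - of_bool (Q (- 1))"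
    and Q: "\<And>k. Q k \<longleftrightarrow> Q (if 0 \<le> k then 0 else - 1)"
    and A: "A = height \<or> A = height - 1 \<and>
      (0 < height \<longrightarrow> even (height + width + of_bool (Q (height - 1))))"
    and B: "B = depth \<or> B = depth - 1 \<and>
      (0 < depth \<longrightarrow> even (depth + width + of_bool (Q (- depth))))"
    and E: "\<And>p k. (p, k) \<in> HU Q \<Longrightarrow> (p, k) \<in> HD Q \<Longrightarrow> even (p + \<delta> - k) \<Longrightarrow>
      - max B 0 < k \<Longrightarrow> k < max A 0 \<Longrightarrow>
      lozenge_weight E {UP (p + \<delta>, k), DN (p + \<delta>, k)} = axis_weight (p, k)"
  shows "M (halved_region A B (zigzag e d) (zigzag e' d') x' y' z (c # tl a) b, E) =
    per (HU Q) (HD Q) axis_weight"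
proof -
  define R where "R = halved_region A B (zigzag e d) (zigzag e' d') x' y' z (c # tl a) b"
  let ?U = "cut_UP (max A 0) (max B 0) Q" and ?D = "cut_DN (max A 0) (max B 0) Q"
  have AB: "A \<le> height" "B \<le> depth" using A B by auto
  have u: "ups R = shift \<delta> ` ?U" "downs R = shift \<delta> ` ?D"
    unfolding ups_def downs_def R_def
    using halved_region_triangles[OF _ L c, of UP] halved_region_triangles[OF _ L c, of DN]
      halfreg_eq_cut[OF al be \<delta> up lo Q AB] by simp_all
  have fin: "finite (ups R)"
    unfolding u by (rule finite_imageI[OF finite_cut_UP])
  have "unit_triangle t" if "t \<in> R" for t
    using that by (auto simp: R_def halved_region_def Let_def triangles_in_def)
  then have "M (R, E) = per (ups R) (downs R) (\<lambda>u. lozenge_weight E {UP u, DN u})"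
    using fin by (rule M_eq_per)
  also have "\<dots> = per ?U ?D (\<lambda>u. lozenge_weight E {UP (shift \<delta> u), DN (shift \<delta> u)})"
    unfolding u by (rule per_shift)
  also have "\<dots> = per ?U ?D axis_weight"
  proof (rule per_cong)
    fix u assume u: "u \<in> ?U" "u \<in> ?D"
    obtain p k where pk: "u = (p, k)" by (cases u)
    have "(p, k) \<in> HU Q" "(p, k) \<in> HD Q" "- max B 0 < k" "k < max A 0"
      using u unfolding pk cut_UP_def cut_DN_def by auto
    moreover from this have "even (p - k - width)"
      unfolding mem_HU reg_def mem_Collect_eq UP_lattice by blast
    then have "even (p + \<delta> - k)" using \<delta> by presburger
    ultimately show "lozenge_weight E {UP (shift \<delta> u), DN (shift \<delta> u)} = axis_weight u"
      using E[of p k] by (simp add: pk shift_def)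
  qed
  also have "\<dots> = per (HU Q) (HD Q) axis_weight"
    using per_cut[OF A B] by simp
  finally show ?thesis by (simp add: R_def)
qed

end

theorem theorem2p21:
  fixes x y z :: nat and a b :: "nat list"
  assumes "x mod 2 = y mod 2"
  shows "(even (entry a 1) \<longrightarrow>
            M (S2 x y z a b) =
              2 ^ (y + z + sum_list a + sum_list b - entry a 1)
              * M (R2 (x div 2) ((y + 1) div 2) z (entry a 1 div 2 # tl a) b)
              * M (RW1 ((x + 1) div 2) (y div 2) z (entry a 1 div 2 # tl a) b)) \<and>
         (odd (entry a 1) \<longrightarrow>
            M (S2 x y z a b) =
              2 ^ (y + z + sum_list a + sum_list b - entry a 1)
              * M (NR1 ((x + 1) div 2) (y div 2) z ((entry a 1 - 1) div 2 # tl a) b)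
              * M (NR4 (x div 2) ((y + 1) div 2) z ((entry a 1 + 1) div 2 # tl a) b))"
proof -
  interpret symmetric_hexagon x y z a b by unfold_locales (rule assms)
  note One_nat_def [simp del]
  define w where "w = y + z + sum_list a + sum_list b - entry a 1"
  have le: "entry a 1 \<le> odd_sum a" by (rule first_entry_le_odd_sum)
  have w: "height + depth - int (entry a 1) = 2 * int w"
    using le odd_sum_plus_even_sum[of a] odd_sum_plus_even_sum[of b]
    unfolding w_def height_eq depth_eq by (simp add: of_nat_diff)
  have sl: "sum_list a = odd_sum a + even_sum a" "sum_list b = odd_sum b + even_sum b"
    using odd_sum_plus_even_sum by simp_all
  have xy: "2 * (x div 2) + 2 * ((y + 1) div 2) = x + y" "2 * ((x + 1) div 2) + 2 * (y div 2) = x + y"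
    using assms by presburger+
  \<comment> \<open>The rounding of y/2 decides, through the parity of \<open>y\<close>, whether an
    outermost strip has been cut off; hence the later case distinctions.\<close>
  have yc: "2 * int ((y + 1) div 2) = (if even y then int y else int y + 1)"
    "2 * int (y div 2) = (if even y then int y else int y - 1)"
    by (auto elim!: evenE oddE)
  show ?thesis
  proof (intro conjI impI)
    assume ev: "even (entry a 1)"
    define c where "c = entry a 1 div 2"
    have c: "2 * int c = int (entry a 1) + 0" using ev by (auto simp: c_def)
    note sc = sums_Cons_tl[of c a]
    have Wev: "even width" using par ev by simp
    \<comment> \<open>For an even first entry this selection of strips is empty: the half has no
      axis triangle, in accordance with the absence of weights.\<close>
    have R2: "M (R2 (x div 2) ((y + 1) div 2) z (c # tl a) b) =
        per (HU (\<lambda>k. odd (entry a 1) \<and> 0 \<le> k)) (HD (\<lambda>k. odd (entry a 1) \<and> 0 \<le> k)) axis_weight"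
      unfolding R2_def
    proof (rule M_halved_region[OF _ c])
      show "2 * int (x div 2 + (y + 1) div 2 + sum_list (c # tl a) + sum_list b) = width + 0"
        using xy(1) sc c sl unfolding width_eq by simp
      show "2 * h_par ((y + 1) div 2) (c # tl a) b - 1 = height \<or>
          2 * h_par ((y + 1) div 2) (c # tl a) b - 1 = height - 1 \<and>
          (0 < height \<longrightarrow> even (height + width + of_bool (odd (entry a 1) \<and> 0 \<le> height - 1)))"
        using yc(1) sc(2) Wev ev unfolding h_par_def height_eq by (cases "even y") auto
      show "2 * g_par ((y + 1) div 2) z (c # tl a) b - 1 = depth \<or>
          2 * g_par ((y + 1) div 2) z (c # tl a) b - 1 = depth - 1 \<and>
          (0 < depth \<longrightarrow> even (depth + width + of_bool (odd (entry a 1) \<and> 0 \<le> - depth)))"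
        using yc(1) sc(1) c Wev ev unfolding g_par_def depth_eq by (cases "even y") auto
    qed (use ev Wev in \<open>auto simp: mem_HU axis_weight_def lozenge_weight_def\<close>)
    \<comment> \<open>This half owns all axis triangles, so both of its zigzags carry
      weights.\<close>
    have RW1: "M (RW1 ((x + 1) div 2) (y div 2) z (c # tl a) b) =
        per (HU (\<lambda>k. even (entry a 1) \<or> k < 0)) (HD (\<lambda>k. even (entry a 1) \<or> k < 0)) axis_weight"
      unfolding RW1_def
    proof (rule M_halved_region[OF _ c])
      show "2 * int ((x + 1) div 2 + y div 2 + sum_list (c # tl a) + sum_list b) = width + 0"
        using xy(2) sc c sl unfolding width_eq by simp
      show "2 * h_par (y div 2) (c # tl a) b = height \<or>
          2 * h_par (y div 2) (c # tl a) b = height - 1 \<and>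
          (0 < height \<longrightarrow> even (height + width + of_bool (even (entry a 1) \<or> height - 1 < 0)))"
        using yc(2) sc(2) Wev ev unfolding h_par_def height_eq by (cases "even y") auto
      show "2 * g_par (y div 2) z (c # tl a) b = depth \<or>
          2 * g_par (y div 2) z (c # tl a) b = depth - 1 \<and>
          (0 < depth \<longrightarrow> even (depth + width + of_bool (even (entry a 1) \<or> - depth < 0)))"
        using yc(2) sc(1) c Wev ev unfolding g_par_def depth_eq by (cases "even y") auto
      fix p k
      assume pk: "(p, k) \<in> HU (\<lambda>k. even (entry a 1) \<or> k < 0)" "even (p + 0 - k)"
        "- max (2 * g_par (y div 2) z (c # tl a) b) 0 < k" "k < max (2 * h_par (y div 2) (c # tl a) b) 0"
      have "0 \<le> g_par (y div 2) z (c # tl a) b" "0 \<le> h_par (y div 2) (c # tl a) b"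
        by (simp_all add: g_par_def h_par_def)
      moreover have "- 1 \<le> p" using pk(1) by (simp add: mem_HU)
      ultimately show "lozenge_weight (upper_zigzag (2 * h_par (y div 2) (c # tl a) b) (zigzag 0 (- 1)) \<union>
            lower_zigzag (2 * g_par (y div 2) z (c # tl a) b) (zigzag 0 (- 1)))
          {UP (p + 0, k), DN (p + 0, k)} = axis_weight (p, k)"
        \<comment> \<open>Here axis lozenges occur on odd levels only, so none sits on level 0,
          where the upper and the lower zigzag meet.\<close>
        using pk(2-) unfolding lozenge_weight_vertical axis_weight_def Un_iff zigzag_edges
        by (cases "k = 0") (auto simp: zigzag_def)
    qed (use ev Wev in auto)
    show "M (S2 x y z a b) = 2 ^ (y + z + sum_list a + sum_list b - entry a 1)
        * M (R2 (x div 2) ((y + 1) div 2) z (entry a 1 div 2 # tl a) b)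
        * M (RW1 ((x + 1) div 2) (y div 2) z (entry a 1 div 2 # tl a) b)"
      unfolding M_S2 w_def[symmetric] c_def[symmetric] R2 RW1
      using per_S[OF w] by (simp add: mult.assoc mult.commute)
  next
    assume od: "odd (entry a 1)"
    have Wod: "odd width" using par od by simp
    \<comment> \<open>The central hole is nonempty and reaches below the line, so the bottom strip
      has a negative index.\<close>
    have pos: "0 < depth" using G od odd_pos[of "entry a 1"] by linarith
    define c where "c = (entry a 1 - 1) div 2"
    have c: "2 * int c = int (entry a 1) + (- 1)" using od by (auto simp: c_def elim: oddE)
    note sc = sums_Cons_tl[of c a]
    define c' where "c' = (entry a 1 + 1) div 2"
    have c': "2 * int c' = int (entry a 1) + 1" using od by (auto simp: c'_def elim: oddE)
    note sc' = sums_Cons_tl[of c' a]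
    \<comment> \<open>This half owns the axis triangles below level 0: with shift -1 the lower
      zigzag goes back to -2, while the upper one stops at -1.\<close>
    have NR1: "M (NR1 ((x + 1) div 2) (y div 2) z (c # tl a) b) =
        per (HU (\<lambda>k. even (entry a 1) \<or> k < 0)) (HD (\<lambda>k. even (entry a 1) \<or> k < 0)) axis_weight"
      unfolding NR1_def
    proof (rule M_halved_region[OF _ c])
      show "2 * int ((x + 1) div 2 + y div 2 + sum_list (c # tl a) + sum_list b) = width + - 1"
        using xy(2) sc c sl unfolding width_eq by simp
      show "2 * h_par (y div 2) (c # tl a) b = height \<or>
          2 * h_par (y div 2) (c # tl a) b = height - 1 \<and>
          (0 < height \<longrightarrow> even (height + width + of_bool (even (entry a 1) \<or> height - 1 < 0)))"
        using yc(2) sc(2) Wod od unfolding h_par_def height_eq by (cases "even y") auto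
      show "2 * g_par (y div 2) z (c # tl a) b + 1 = depth \<or>
          2 * g_par (y div 2) z (c # tl a) b + 1 = depth - 1 \<and>
          (0 < depth \<longrightarrow> even (depth + width + of_bool (even (entry a 1) \<or> - depth < 0)))"
        using yc(2) sc(1) c Wod od unfolding g_par_def depth_eq by (cases "even y") auto
      fix p k
      assume pk: "(p, k) \<in> HU (\<lambda>k. even (entry a 1) \<or> k < 0)"
        "(p, k) \<in> HD (\<lambda>k. even (entry a 1) \<or> k < 0)" "even (p + - 1 - k)"
        "- max (2 * g_par (y div 2) z (c # tl a) b + 1) 0 < k" "k < max (2 * h_par (y div 2) (c # tl a) b) 0"
      have "0 \<le> g_par (y div 2) z (c # tl a) b" by (simp add: g_par_def)
      moreover have "- 1 \<le> p" "p = - 1 \<longrightarrow> k < 0" using pk(1) od by (simp_all add: mem_HU)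
      ultimately show "lozenge_weight (lower_zigzag (2 * g_par (y div 2) z (c # tl a) b + 1) (zigzag (- 2) (- 1)))
          {UP (p + - 1, k), DN (p + - 1, k)} = axis_weight (p, k)"
        using pk(3-) unfolding lozenge_weight_vertical axis_weight_def zigzag_edges
        by (auto simp: zigzag_def)
    qed (use od Wod in auto)
    \<comment> \<open>The complementary choice: with shift 1 the upper zigzag reaches 0 and keeps
      the axis triangles, while the lower one stops at 1.\<close>
    have NR4: "M (NR4 (x div 2) ((y + 1) div 2) z (c' # tl a) b) =
        per (HU (\<lambda>k. odd (entry a 1) \<and> 0 \<le> k)) (HD (\<lambda>k. odd (entry a 1) \<and> 0 \<le> k)) axis_weight"
      unfolding NR4_def
    proof (rule M_halved_region[OF _ c'])
      show "2 * int (x div 2 + (y + 1) div 2 + sum_list (c' # tl a) + sum_list b) = width + 1"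
        using xy(1) sc' c' sl unfolding width_eq by simp
      show "2 * h_par ((y + 1) div 2) (c' # tl a) b - 1 = height \<or>
          2 * h_par ((y + 1) div 2) (c' # tl a) b - 1 = height - 1 \<and>
          (0 < height \<longrightarrow> even (height + width + of_bool (odd (entry a 1) \<and> 0 \<le> height - 1)))"
        using yc(1) sc'(2) Wod od unfolding h_par_def height_eq by (cases "even y") auto
      show "2 * g_par ((y + 1) div 2) z (c' # tl a) b - 2 = depth \<or>
          2 * g_par ((y + 1) div 2) z (c' # tl a) b - 2 = depth - 1 \<and>
          (0 < depth \<longrightarrow> even (depth + width + of_bool (odd (entry a 1) \<and> 0 \<le> - depth)))"
        using yc(1) sc'(1) c' Wod od pos unfolding g_par_def depth_eq by (cases "even y") auto
      fix p k
      assume pk: "(p, k) \<in> HU (\<lambda>k. odd (entry a 1) \<and> 0 \<le> k)"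
        "(p, k) \<in> HD (\<lambda>k. odd (entry a 1) \<and> 0 \<le> k)" "even (p + 1 - k)"
        "k < max (2 * h_par ((y + 1) div 2) (c' # tl a) b - 1) 0"
      \<comment> \<open>A vertical lozenge on level k has its down-pointing triangle in strip k - 1.
        The axis triangles of this half start in strip 0, so an axis lozenge lies on level 1 or
        higher.\<close>
      moreover have "- 1 \<le> p" "p = - 1 \<longrightarrow> 0 \<le> k - 1" using pk(1,2) od by (simp_all add: mem_HU mem_HD)
      ultimately show "lozenge_weight (upper_zigzag (2 * h_par ((y + 1) div 2) (c' # tl a) b - 1) (zigzag 0 1))
          {UP (p + 1, k), DN (p + 1, k)} = axis_weight (p, k)"
        unfolding lozenge_weight_vertical axis_weight_def zigzag_edges
        by (auto simp: zigzag_def)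
    qed (use od Wod in auto)
    show "M (S2 x y z a b) = 2 ^ (y + z + sum_list a + sum_list b - entry a 1)
        * M (NR1 ((x + 1) div 2) (y div 2) z ((entry a 1 - 1) div 2 # tl a) b)
        * M (NR4 (x div 2) ((y + 1) div 2) z ((entry a 1 + 1) div 2 # tl a) b)"
      unfolding M_S2 w_def[symmetric] c_def[symmetric] c'_def[symmetric] NR1 NR4
      using per_S[OF w] by (simp add: mult.assoc)
  qed
qed

end
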